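(* Fix $\eta>0$, $\alpha\in(1/2,1)$, $p>2$, $q\in[1,p/2]$, $\gamma>0$, let $\eta_t=\eta t^{-\alpha}$, and put $$a_{\mathrm{cov}}=\gamma,\quad a_{\mathrm{osc}}=\frac{p-2}{2(p+1)},\quad a_{\mathrm{sm}}=\frac{1-\alpha}{2},\quad a_{\mathrm{nl}}=\frac{(\alpha-1/2)q}{q+1}.$$ Let $\mathfrak C_{\mathrm{lb}}=\mathfrak C_{\mathrm{cov}}\cup\mathfrak C_{\mathrm{osc}}\cup\mathfrak C_{\mathrm{sm}}\cup\mathfrak C_{\mathrm{nl}}$ be the union of the four oracle classes defined in the context. Then there exist constants $c>0$ and $T_0<\infty$, independent of $T$, such that for every integer $T\ge T_0$, $$\mathcal D_T(\mathfrak C_{\mathrm{lb}})\ge c\Big\{T^{-a_{\mathrm{cov}}}+T^{-a_{\mathrm{osc}}}+T^{-a_{\mathrm{sm}}}\sqrt{\log T}+T^{-a_{\mathrm{nl}}}\Big\}.$$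
   Context: Stochastic oracle. A (scalar) stochastic oracle is a tuple $\mathcal M=(g_{\mathcal M},(\epsilon_t^{\mathcal M})_{t\ge1},(\mathcal F_t^{\mathcal M})_{t\ge0},\mathbb P_{\mathcal M})$ where $g_{\mathcal M}:\mathbb R\to\mathbb R$ has root $x^\star=0$ and $(\epsilon_t^{\mathcal M})$ is a martingale-difference sequence adapted to $(\mathcal F_t^{\mathcal M})$ under $\mathbb P_{\mathcal M}$. Its dynamics are $x_1^{\mathcal M}=0$, $x_{t+1}^{\mathcal M}=x_t^{\mathcal M}-\eta_tg_{\mathcal M}(x_t^{\mathcal M})+\eta_t\epsilon_t^{\mathcal M}$. The path $\Phi_T^{\mathcal M}:[0,1]\to\mathbb R$ has $\Phi_T^{\mathcal M}(n/T)=T^{-1/2}\sum_{t=1}^nx_{t+1}^{\mathcal M}$, $0\le n\le T$, and is linearly interpolated in between. $G_{\mathcal M}>0$ is the linearization coefficient of $g_{\mathcal M}$ at $0$ (its derivative there), $S_{\mathcal M}\ge0$ the limiting variance (the limit as $m\to\infty$ of $\frac1m\sum_{t\le m}\mathbb E_{\mathcal M}[(\epsilon_t^{\mathcal M})^2\mid\mathcal F^{\mathcal M}_{t-1}]$), and the target is $Z^{\mathcal M}=G_{\mathcal M}^{-1}S_{\mathcal M}^{1/2}W_\star^{(1)}$, with $W_\star^{(1)}$ standard one-dimensional Brownian motion on $[0,1]$. For a nonempty class, $\mathcal D_T(\mathfrak C)=\sup_{\mathcal M\in\mathfrak C}d_{\mathrm P}(\Phi_T^{\mathcal M},Z^{\mathcal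 M})$. Metrics. With $\Lambda$ the set of strictly increasing continuous bijections of $[0,1]$, for càdlàg $f,h\in D([0,1],\mathbb R)$: $d_{\mathrm S}(f,h)=\inf_{\lambda\in\Lambda}\{\sup_{0\le s<t\le1}|\log\frac{\lambda(t)-\lambda(s)}{t-s}|\vee\sup_{r}|f(\lambda(r))-h(r)|\}$. $d_{\mathrm P}(\mu,\nu)$ is the infimum of $\delta>0$ such that $\mu(\Gamma)\le\nu(\Gamma^\delta)+\delta$ and $\nu(\Gamma)\le\mu(\Gamma^\delta)+\delta$ for every Borel $\Gamma\subset(D([0,1],\mathbb R),d_{\mathrm S})$, where $\Gamma^\delta=\{h:\inf_{f\in\Gamma}d_{\mathrm S}(f,h)<\delta\}$; for random elements it is applied to their laws. The four classes. $\mathfrak C_{\mathrm{cov}}$: empty if $a_{\mathrm{cov}}\ge\min\{a_{\mathrm{osc}},a_{\mathrm{sm}}\}$; otherwise $\{\mathcal M^{\mathrm{cov}}_N:N\ge1\}$, where $\mathcal M_N^{\mathrm{cov}}$ has $g(x)=x$ and, for a standard Brownian motion $W$ with its augmented filtration (observed at integer times) and $\tau_N=\inf\{s\ge N-\frac14N^{1-2\gamma}:W(s)=0\}\wedge N$, noise $\epsilon_j=W(j\wedge\tau_N)-W((j-1)\wedge\tau_N)$ for $1\le j\le N$ and $\epsilon_j=W(j)-W(j-1)$ for $j>N$. Here $G=S=1$. $\mathfrak C_{\mathrm{osc}}$: empty if $a_{\mathrm{osc}}\ge a_{\mathrm{sm}}$; otherwise fix $M>1$, $K_*>4$, $\kappa_*>0$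 and $c_*>0$ with $\kappa_*K_*^pc_*^{p+1}\le M-1$, put $\varepsilon_N=c_*N^{-a_{\mathrm{osc}}}$, $q_N=\kappa_*\varepsilon_N/N$, $u_N=K_*\varepsilon_N\sqrt N$, $v_N^2=(1-q_Nu_N^2)/(1-q_N)$ with $v_N>0$, and let the class be $\{\mathcal M_N^{\mathrm{osc}}:N\ge N_0\}$ with $N_0$ so large that $q_N<1$, $q_Nu_N^2<1$ and $u_N\ge1$ for $N\ge N_0$; $\mathcal M_N^{\mathrm{osc}}$ has $g(x)=x$ and i.i.d. noise (natural filtration) taking the values $\pm u_N$ with probability $q_N/2$ each and $\pm v_N$ with probability $(1-q_N)/2$ each. Here $G=S=1$. $\mathfrak C_{\mathrm{sm}}$: the single oracle with $g(x)=x$ and i.i.d. standard Gaussian noise (natural filtration). Here $G=S=1$. $\mathfrak C_{\mathrm{nl}}=\{\mathcal M_N^{\mathrm{nl}}:N\ge N_1\}$: put $\rho_N=N^{-a_{\mathrm{nl}}}$, fix $\lambda>0$ with $\lambda\eta\le1/4$ and a smooth $\chi:\mathbb R\to[0,1]$ with $\chi(z)=0$ for $z\le1$ and $\chi(z)=1$ for $z\ge2$. Fix $c_0>0$ sufficiently small and $N_1$ sufficiently large that, for some $\kappa>0$ and all $N\ge N_1$: $c_0N^{\alpha-1}\le\lambda$, $c_0N^{\alpha-1}\eta\le1/2$, $\rho_N\le1/2$, $\prod_{s=2}^{N-1}(1-c_0N^{\alpha-1}\eta_s)\ge\kappa$ and $2\rho_N^{1/2}<\kappa$. The oracle $\mathcal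 M_N^{\mathrm{nl}}$ has $g(x)=\lambda x$ for $x\le0$ and $g(x)=\big[\lambda-(\lambda-c_0N^{\alpha-1})\chi(\sqrt N\,x/\rho_N^{3/2})\chi(3-x)\big]x$ for $x>0$; with $\omega_N$ Bernoulli of success probability $\rho_N$, $\mathcal F_0$ trivial and $\mathcal F_t=\sigma(\omega_N)$ for $t\ge1$, its noise is $\epsilon_1=\frac{\rho_N}{\eta\sqrt N(1-\rho_N)}(\omega_N-\rho_N)$ and $\epsilon_t=0$ for $t\ge2$. Here $G=\lambda$, $S=0$, so the target is the zero path. *)

theory Defs
  imports "HOL-Probability.Probability"
begin

section \<open>The Skorokhod space on the unit interval\<close>

definition skorokhod_paths :: "(real \<Rightarrow> real) set" where
  "skorokhod_paths = {f \<in> extensional {0..1}.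
     (\<forall>t\<in>{0..<1}. continuous (at_right t) f) \<and>
     (\<forall>t\<in>{0<..1}. \<exists>l. (f \<longlongrightarrow> l) (at_left t))}"

definition time_changes :: "(real \<Rightarrow> real) set" where
  "time_changes = {l. strict_mono_on {0..1} l \<and> continuous_on {0..1} l \<and> bij_betw l {0..1} {0..1}}"

text \<open>The distance takes values in \<^typ>\<open>ereal\<close> because the logarithmic slopes of a time
  change may be unbounded, and such a time change must not contribute to the infimum.\<close>

definition skorokhod_dist :: "(real \<Rightarrow> real) \<Rightarrow> (real \<Rightarrow> real) \<Rightarrow> ereal" where
  "skorokhod_dist f h = (INF l\<in>time_changes.
     max (SUP (s, t)\<in>{(s, t). 0 \<le> s \<and> s < t \<and> t \<le> 1}. ereal \<bar>ln ((l t - l s) / (t - s))\<bar>)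
         (SUP r\<in>{0..1}. ereal \<bar>f (l r) - h r\<bar>))"

definition skorokhod_open :: "(real \<Rightarrow> real) set \<Rightarrow> bool" where
  "skorokhod_open U \<longleftrightarrow> U \<subseteq> skorokhod_paths \<and>
     (\<forall>f\<in>U. \<exists>r>0. \<forall>h\<in>skorokhod_paths. skorokhod_dist f h < ereal r \<longrightarrow> h \<in> U)"

definition skorokhod_borel :: "(real \<Rightarrow> real) measure" where
  "skorokhod_borel = sigma skorokhod_paths {U. skorokhod_open U}"

definition skorokhod_nbhd :: "(real \<Rightarrow> real) set \<Rightarrow> real \<Rightarrow> (real \<Rightarrow> real) set" where
  "skorokhod_nbhd \<Gamma> \<delta> = {h \<in> skorokhod_paths. (INF f\<in>\<Gamma>. skorokhod_dist f h) < ereal \<delta>}"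

definition prokhorov_dist :: "(real \<Rightarrow> real) measure \<Rightarrow> (real \<Rightarrow> real) measure \<Rightarrow> real" where
  "prokhorov_dist \<mu> \<nu> = Inf {\<delta>. 0 < \<delta> \<and> (\<forall>\<Gamma>\<in>sets skorokhod_borel.
     measure \<mu> \<Gamma> \<le> measure \<nu> (skorokhod_nbhd \<Gamma> \<delta>) + \<delta> \<and>
     measure \<nu> \<Gamma> \<le> measure \<mu> (skorokhod_nbhd \<Gamma> \<delta>) + \<delta>)}"

text \<open>Law of a random path, viewed as a random element of the Skorokhod space; only the values
  of the path on the unit interval matter.\<close>

definition path_law :: "'w measure \<Rightarrow> ('w \<Rightarrow> real \<Rightarrow> real) \<Rightarrow> (real \<Rightarrow> real) measure" where
  "path_law P X = distr P skorokhod_borel (\<lambda>\<omega>. restrict (X \<omega>) {0..1})"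

section \<open>Brownian motion\<close>

definition standard_brownian_motion_on ::
    "real set \<Rightarrow> 'w measure \<Rightarrow> (real \<Rightarrow> 'w \<Rightarrow> real) \<Rightarrow> bool" where
  "standard_brownian_motion_on I P W \<longleftrightarrow>
     prob_space P \<and>
     (\<forall>t\<in>I. W t \<in> borel_measurable P) \<and>
     (\<forall>\<omega>\<in>space P. W 0 \<omega> = 0 \<and> continuous_on I (\<lambda>t. W t \<omega>)) \<and>
     (\<forall>s\<in>I. \<forall>t\<in>I. s < t \<longrightarrow>
        distributed P lborel (\<lambda>\<omega>. W t \<omega> - W s \<omega>) (normal_density 0 (sqrt (t - s)))) \<and>
     (\<forall>n t. t ` {..n} \<subseteq> I \<longrightarrow> strict_mono_on {..n} t \<longrightarrow>
        prob_space.indep_vars P (\<lambda>_. borel) (\<lambda>i \<omega>. W (t (Suc i)) \<omega> - W (t i) \<omega>) {..<n})"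

text \<open>The augmented filtration at integer times; the null sets are those of the completed
  measure, so every subset of a null event is included.\<close>

definition augmented_filtration ::
    "'w measure \<Rightarrow> (real \<Rightarrow> 'w \<Rightarrow> real) \<Rightarrow> nat \<Rightarrow> 'w measure" where
  "augmented_filtration P W t = sigma (space P)
     ({W s -` A \<inter> space P | s A. 0 \<le> s \<and> s \<le> real t \<and> A \<in> sets borel} \<union> null_sets (completion P))"

section \<open>Stochastic oracles\<close>

text \<open>Noise is indexed from time 1 on and the filtration from time 0 on; the value
  of the noise at index 0 is never used.\<close>

record 'w stoch_oracle =
  drift :: "real \<Rightarrow> real"
  noise :: "nat \<Rightarrow> 'w \<Rightarrow> real"
  filt :: "nat \<Rightarrow> 'w measure"
  pmeasure :: "'w measure"

text \<open>The root, adaptedness and martingale-difference conditions on such a tuple. The classes below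
  consist of explicit tuples, so they are not stated through this predicate.\<close>

definition is_stoch_oracle :: "'w stoch_oracle \<Rightarrow> bool" where
  "is_stoch_oracle M \<longleftrightarrow>
     prob_space (pmeasure M) \<and> drift M 0 = 0 \<and>
     (\<forall>t. subalgebra (pmeasure M) (filt M t)) \<and>
     (\<forall>s t. s \<le> t \<longrightarrow> sets (filt M s) \<subseteq> sets (filt M t)) \<and>
     (\<forall>t\<ge>1. noise M t \<in> borel_measurable (filt M t) \<and> integrable (pmeasure M) (noise M t) \<and>
        (AE \<omega> in pmeasure M. real_cond_exp (pmeasure M) (filt M (t - 1)) (noise M t) \<omega> = 0))"

definition lin_coeff :: "'w stoch_oracle \<Rightarrow> real" where
  "lin_coeff M = deriv (drift M) 0"

definition lim_variance :: "'w stoch_oracle \<Rightarrow> real" where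
  "lim_variance M = (THE S. AE \<omega> in pmeasure M.
     (\<lambda>m. (\<Sum>t = 1..m. real_cond_exp (pmeasure M) (filt M (t - 1)) (\<lambda>\<omega>'. (noise M t \<omega>')\<^sup>2) \<omega>) / real m)
       \<longlonglongrightarrow> S)"

definition step_size :: "real \<Rightarrow> real \<Rightarrow> nat \<Rightarrow> real" where
  "step_size \<eta> \<alpha> t = \<eta> * real t powr (- \<alpha>)"

text \<open>The iterates start at index 1; the value at index 0 is a dummy.\<close>

primrec iterate :: "(nat \<Rightarrow> real) \<Rightarrow> 'w stoch_oracle \<Rightarrow> nat \<Rightarrow> 'w \<Rightarrow> real" where
  "iterate st M 0 \<omega> = 0"
| "iterate st M (Suc t) \<omega> = (if t = 0 then 0 else
     iterate st M t \<omega> - st t * drift M (iterate st M t \<omega>) + st t * noise M t \<omega>)"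

definition scaled_sum :: "(nat \<Rightarrow> real) \<Rightarrow> 'w stoch_oracle \<Rightarrow> nat \<Rightarrow> nat \<Rightarrow> 'w \<Rightarrow> real" where
  "scaled_sum st M T n \<omega> = (\<Sum>t = 1..n. iterate st M (t + 1) \<omega>) / sqrt (real T)"

definition oracle_path :: "(nat \<Rightarrow> real) \<Rightarrow> 'w stoch_oracle \<Rightarrow> nat \<Rightarrow> 'w \<Rightarrow> real \<Rightarrow> real" where
  "oracle_path st M T \<omega> r = (let n = nat \<lfloor>real T * r\<rfloor> in
     scaled_sum st M T n \<omega> +
     (real T * r - real n) * (scaled_sum st M T (n + 1) \<omega> - scaled_sum st M T n \<omega>))"

definition target_path :: "(real \<Rightarrow> 'v \<Rightarrow> real) \<Rightarrow> 'w stoch_oracle \<Rightarrow> 'v \<Rightarrow> real \<Rightarrow> real" where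
  "target_path B M \<omega> r = inverse (lin_coeff M) * sqrt (lim_variance M) * B r \<omega>"

text \<open>Here \<open>B\<close> is the Brownian motion on the unit interval, with underlying measure \<open>Q\<close>,
  that drives the targets.\<close>

definition worst_dist ::
    "(nat \<Rightarrow> real) \<Rightarrow> 'v measure \<Rightarrow> (real \<Rightarrow> 'v \<Rightarrow> real) \<Rightarrow> nat \<Rightarrow> 'w stoch_oracle set \<Rightarrow> real" where
  "worst_dist st Q B T C = (SUP M\<in>C.
     prokhorov_dist (path_law (pmeasure M) (oracle_path st M T)) (path_law Q (target_path B M)))"

section \<open>The four classes\<close>

definition a_cov :: "real \<Rightarrow> real" where
  "a_cov \<gamma> = \<gamma>"

definition a_osc :: "real \<Rightarrow> real" where
  "a_osc p = (p - 2) / (2 * (p + 1))"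

definition a_sm :: "real \<Rightarrow> real" where
  "a_sm \<alpha> = (1 - \<alpha>) / 2"

definition a_nl :: "real \<Rightarrow> real \<Rightarrow> real" where
  "a_nl \<alpha> q = (\<alpha> - 1/2) * q / (q + 1)"

text \<open>Inserting \<open>N\<close> into the set before taking the infimum is the minimum with \<open>N\<close>, also
  when there is no zero.\<close>

definition cov_time :: "real \<Rightarrow> (real \<Rightarrow> 'w \<Rightarrow> real) \<Rightarrow> nat \<Rightarrow> 'w \<Rightarrow> real" where
  "cov_time \<gamma> W N \<omega> =
     Inf (insert (real N) {s. real N - 1/4 * real N powr (1 - 2 * \<gamma>) \<le> s \<and> W s \<omega> = 0})"

definition cov_oracle ::
    "real \<Rightarrow> 'w measure \<Rightarrow> (real \<Rightarrow> 'w \<Rightarrow> real) \<Rightarrow> nat \<Rightarrow> 'w stoch_oracle" where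
  "cov_oracle \<gamma> P W N = \<lparr>
     drift = (\<lambda>x. x),
     noise = (\<lambda>j \<omega>. if j \<le> N
        then W (min (real j) (cov_time \<gamma> W N \<omega>)) \<omega> - W (min (real j - 1) (cov_time \<gamma> W N \<omega>)) \<omega>
        else W (real j) \<omega> - W (real j - 1) \<omega>),
     filt = augmented_filtration P W,
     pmeasure = completion P\<rparr>"

definition cov_class ::
    "real \<Rightarrow> real \<Rightarrow> real \<Rightarrow> 'w measure \<Rightarrow> (real \<Rightarrow> 'w \<Rightarrow> real) \<Rightarrow> 'w stoch_oracle set" where
  "cov_class \<alpha> p \<gamma> P W = (if a_cov \<gamma> \<ge> min (a_osc p) (a_sm \<alpha>) then {}
     else {cov_oracle \<gamma> P W N | N. N \<ge> 1})"

definition natural_filtration :: "'w measure \<Rightarrow> (nat \<Rightarrow> 'w \<Rightarrow> real) \<Rightarrow> nat \<Rightarrow> 'w measure" where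
  "natural_filtration P \<xi> t =
     sigma (space P) {\<xi> j -` A \<inter> space P | j A. 1 \<le> j \<and> j \<le> t \<and> A \<in> sets borel}"

text \<open>Identity drift, with noise a given sequence and its natural filtration.\<close>

definition linear_oracle :: "'w measure \<Rightarrow> (nat \<Rightarrow> 'w \<Rightarrow> real) \<Rightarrow> 'w stoch_oracle" where
  "linear_oracle P \<xi> =
     \<lparr>drift = (\<lambda>x. x), noise = \<xi>, filt = natural_filtration P \<xi>, pmeasure = P\<rparr>"

definition osc_eps :: "real \<Rightarrow> real \<Rightarrow> nat \<Rightarrow> real" where
  "osc_eps p c N = c * real N powr (- a_osc p)"

definition osc_q :: "real \<Rightarrow> real \<Rightarrow> real \<Rightarrow> nat \<Rightarrow> real" where
  "osc_q p \<kappa> c N = \<kappa> * osc_eps p c N / real N"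

definition osc_u :: "real \<Rightarrow> real \<Rightarrow> real \<Rightarrow> nat \<Rightarrow> real" where
  "osc_u p K c N = K * osc_eps p c N * sqrt (real N)"

definition osc_v :: "real \<Rightarrow> real \<Rightarrow> real \<Rightarrow> real \<Rightarrow> nat \<Rightarrow> real" where
  "osc_v p K \<kappa> c N =
     sqrt ((1 - osc_q p \<kappa> c N * (osc_u p K c N)\<^sup>2) / (1 - osc_q p \<kappa> c N))"

text \<open>The values \<open>u\<close> and \<open>v\<close> may coincide, in which case their weights add up.\<close>

definition osc_noise ::
    "real \<Rightarrow> real \<Rightarrow> real \<Rightarrow> 'w measure \<Rightarrow> (nat \<Rightarrow> 'w \<Rightarrow> real) \<Rightarrow> bool" where
  "osc_noise q u v P \<xi> \<longleftrightarrow>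
     prob_space P \<and> prob_space.indep_vars P (\<lambda>_. borel) \<xi> {1..} \<and>
     (\<forall>j\<ge>1. \<forall>A\<in>sets borel. measure P (\<xi> j -` A \<inter> space P) =
        q / 2 * (indicator A u + indicator A (- u)) +
        (1 - q) / 2 * (indicator A v + indicator A (- v)))"

definition osc_class ::
    "real \<Rightarrow> real \<Rightarrow> nat \<Rightarrow> (nat \<Rightarrow> 'w measure) \<Rightarrow> (nat \<Rightarrow> nat \<Rightarrow> 'w \<Rightarrow> real) \<Rightarrow> 'w stoch_oracle set" where
  "osc_class \<alpha> p N0 P \<xi> = (if a_osc p \<ge> a_sm \<alpha> then {}
     else {linear_oracle (P N) (\<xi> N) | N. N \<ge> N0})"

definition gaussian_noise :: "'w measure \<Rightarrow> (nat \<Rightarrow> 'w \<Rightarrow> real) \<Rightarrow> bool" where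
  "gaussian_noise P \<xi> \<longleftrightarrow>
     prob_space P \<and> prob_space.indep_vars P (\<lambda>_. borel) \<xi> {1..} \<and>
     (\<forall>j\<ge>1. distributed P lborel (\<xi> j) std_normal_density)"

definition sm_class :: "'w measure \<Rightarrow> (nat \<Rightarrow> 'w \<Rightarrow> real) \<Rightarrow> 'w stoch_oracle set" where
  "sm_class P \<xi> = {linear_oracle P \<xi>}"

definition smooth_cutoff :: "(real \<Rightarrow> real) \<Rightarrow> bool" where
  "smooth_cutoff chi \<longleftrightarrow>
     (\<forall>k z. ((deriv ^^ k) chi) differentiable (at z)) \<and>
     (\<forall>z. 0 \<le> chi z \<and> chi z \<le> 1) \<and> (\<forall>z\<le>1. chi z = 0) \<and> (\<forall>z\<ge>2. chi z = 1)"

definition nl_rho :: "real \<Rightarrow> real \<Rightarrow> nat \<Rightarrow> real" where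
  "nl_rho \<alpha> q N = real N powr (- a_nl \<alpha> q)"

definition nl_drift ::
    "real \<Rightarrow> real \<Rightarrow> real \<Rightarrow> real \<Rightarrow> (real \<Rightarrow> real) \<Rightarrow> nat \<Rightarrow> real \<Rightarrow> real" where
  "nl_drift \<alpha> q lam c0 chi N x = (if x \<le> 0 then lam * x else
     (lam - (lam - c0 * real N powr (\<alpha> - 1)) *
        chi (sqrt (real N) * x / nl_rho \<alpha> q N powr (3/2)) * chi (3 - x)) * x)"

definition bernoulli_variable :: "real \<Rightarrow> 'w measure \<Rightarrow> ('w \<Rightarrow> bool) \<Rightarrow> bool" where
  "bernoulli_variable r P b \<longleftrightarrow>
     prob_space P \<and> b \<in> measurable P (count_space UNIV) \<and>
     distr P (count_space UNIV) b = measure_pmf (bernoulli_pmf r)"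

definition nl_oracle ::
    "real \<Rightarrow> real \<Rightarrow> real \<Rightarrow> real \<Rightarrow> real \<Rightarrow> (real \<Rightarrow> real) \<Rightarrow> 'w measure \<Rightarrow> ('w \<Rightarrow> bool) \<Rightarrow> nat \<Rightarrow> 'w stoch_oracle"
  where
  "nl_oracle \<eta> \<alpha> q lam c0 chi P b N = \<lparr>
     drift = nl_drift \<alpha> q lam c0 chi N,
     noise = (\<lambda>t \<omega>. if t = 1
        then nl_rho \<alpha> q N / (\<eta> * sqrt (real N) * (1 - nl_rho \<alpha> q N)) * (of_bool (b \<omega>) - nl_rho \<alpha> q N)
        else 0),
     filt = (\<lambda>t. if t = 0 then sigma (space P) {} else vimage_algebra (space P) b (count_space UNIV)),
     pmeasure = P\<rparr>"

definition nl_class ::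
    "real \<Rightarrow> real \<Rightarrow> real \<Rightarrow> real \<Rightarrow> real \<Rightarrow> (real \<Rightarrow> real) \<Rightarrow> nat \<Rightarrow>
      (nat \<Rightarrow> 'w measure) \<Rightarrow> (nat \<Rightarrow> 'w \<Rightarrow> bool) \<Rightarrow> 'w stoch_oracle set" where
  "nl_class \<eta> \<alpha> q lam c0 chi N1 P b = {nl_oracle \<eta> \<alpha> q lam c0 chi (P N) (b N) N | N. N \<ge> N1}"

end

theory Submission
  imports Defs "HOL-Real_Asymp.Real_Asymp"
begin

text \<open>At time \<open>T\<close> a single oracle of each class, the one with \<open>N = T\<close>, is already far enough from
  its target.

  \<^item> Covariance: with probability of order \<open>T\<^bsup>-\<gamma>\<^esup>\<close> the Brownian motion vanishes in the stopping
    window, so the noise sums to \<open>0\<close>. By summation by parts the endpoint of the path differs from the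
    scaled noise sum only by a term controlled by the Hoelder constant of the noise walk, so
    its law has too much mass near \<open>0\<close>.
  \<^item> Oscillation: a jump moves the path by more than \<open>2\<epsilon>\<close> within a window of length of order
    \<open>T\<^bsup>\<alpha>-1\<^esup>\<close>. Flipping the sign of the first jump preserves the law and changes the increment over
    that window by a deterministic amount, so the other noise need not be controlled.
    Brownian motion has no such oscillation, by Kolmogorov-Chentsov with high moments.
  \<^item> Smoothing: conversely, Brownian motion oscillates by order \<open>sqrt (h ln T)\<close> over windows of
    length \<open>h\<close>, whereas the path is Lipschitz with constant \<open>sqrt T max |x|\<close>.
  \<^item> Nonlinearity: with probability \<open>\<rho>\<close> the iterate enters the region of weak drift and stays
    there, so that the endpoint is at least of order \<open>\<rho>\<close>.

  The slope condition in the Skorokhod metric keeps window lengths comparable under time changes.\<close>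

section \<open>Skorokhod and Prokhorov distances\<close>

text \<open>Every bound rests on a Borel set of paths, defined by the endpoint or by the oscillation
  over short windows, whose mass under one law exceeds the mass of its neighbourhood under the other
  by more than the radius. About the neighbourhood only pathwise information is used.

  Two error terms decide what can be proved: that of replacing the endpoint of the path by the
  scaled noise sum, and the modulus of Brownian motion over windows of length of order
  \<open>T powr (\<alpha> - 1)\<close>. Up to small powers of \<open>T\<close> both have order
  \<open>T powr (- (1 - \<alpha>) * \<beta>)\<close> for a Hoelder exponent
  \<open>\<beta> < 1/2\<close>. Some such \<open>\<beta>\<close> makes this smaller than
  \<open>T powr (- a)\<close> precisely when \<open>a < (1 - \<alpha>) / 2\<close>, that is, when
  \<open>a < a_sm \<alpha>\<close>. For all other \<open>a\<close> the rate
  \<open>T powr (- a)\<close> is dominated by the Gaussian one, so nothing is lost when the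
  corresponding class is empty.

  The Hoelder bound may fail only with a probability below the rate itself. One fixed moment would
  not give this for all parameters; moments of order \<open>2 * l\<close> do, with \<open>l\<close>
  chosen from the gap between \<open>(1 - \<alpha>) * \<beta>\<close> and \<open>a\<close>.\<close>

lemma time_changes_endpoints:
  assumes "l \<in> time_changes"
  shows "l 0 = 0" "l 1 = 1"
proof -
  have mono: "strict_mono_on {0..1} l" and bij: "bij_betw l {0..1} {0..1}"
    using assms by (auto simp: time_changes_def)
  have img: "l ` {0..1} = {0..1}"
    using bij by (auto simp: bij_betw_def)
  have le: "l x \<in> {0..1}" if "x \<in> {0..1}" for x
    using img that by blast
  obtain x where x: "x \<in> {0..1}" "l x = 0"
    using img by (metis (no_types, lifting) atLeastAtMost_iff imageE order_refl zero_le_one)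
  show "l 0 = 0"
  proof (cases "x = 0")
    case False
    then have "l 0 < l x"
      using x(1) mono by (intro strict_mono_onD[OF mono]) auto
    then show ?thesis using le[of 0] x(2) by auto
  qed (use x in auto)
  obtain y where y: "y \<in> {0..1}" "l y = 1"
    using img by (metis (no_types, lifting) atLeastAtMost_iff imageE order_refl zero_le_one)
  show "l 1 = 1"
  proof (cases "y = 1")
    case False
    then have "l y < l 1"
      using y(1) mono by (intro strict_mono_onD[OF mono]) auto
    then show ?thesis using le[of 1] y(2) by auto
  qed (use y in auto)
qed

lemma id_time_change: "(\<lambda>x. x) \<in> time_changes"
  by (auto simp: time_changes_def strict_mono_on_def intro: bij_betw_id[unfolded id_def])

text \<open>A strict bound on the infimum is met by a single time change, and for it every slope and
  every value obeys the bound. Later arguments can then stay within the reals.\<close>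

lemma skorokhod_dist_lessE:
  assumes "skorokhod_dist f g < ereal r"
  obtains l where "l \<in> time_changes"
    "\<And>s t. 0 \<le> s \<Longrightarrow> s < t \<Longrightarrow> t \<le> 1 \<Longrightarrow> \<bar>ln ((l t - l s) / (t - s))\<bar> < r"
    "\<And>u. u \<in> {0..1} \<Longrightarrow> \<bar>f (l u) - g u\<bar> < r"
proof -
  obtain l where l: "l \<in> time_changes" and
    *: "max (SUP (s, t)\<in>{(s, t). 0 \<le> s \<and> s < t \<and> t \<le> 1}. ereal \<bar>ln ((l t - l s) / (t - s))\<bar>)
         (SUP u\<in>{0..1}. ereal \<bar>f (l u) - g u\<bar>) < ereal r"
    using assms unfolding skorokhod_dist_def INF_less_iff by blast
  show thesis
  proof (rule that[OF l])
    fix s t :: real assume st: "0 \<le> s" "s < t" "t \<le> 1"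
    have "ereal \<bar>ln ((l t - l s) / (t - s))\<bar> \<le>
        (SUP (s, t)\<in>{(s, t). 0 \<le> s \<and> s < t \<and> t \<le> 1}. ereal \<bar>ln ((l t - l s) / (t - s))\<bar>)"
      using st by (intro SUP_upper2[of "(s, t)"]) auto
    also have "\<dots> < ereal r" using * by simp
    finally show "\<bar>ln ((l t - l s) / (t - s))\<bar> < r" by simp
  next
    fix u :: real assume u: "u \<in> {0..1}"
    have "ereal \<bar>f (l u) - g u\<bar> \<le> (SUP u\<in>{0..1}. ereal \<bar>f (l u) - g u\<bar>)"
      using u by (intro SUP_upper)
    also have "\<dots> < ereal r" using * by simp
    finally show "\<bar>f (l u) - g u\<bar> < r" by simp
  qed
qed

lemma skorokhod_dist_le_sup:
  assumes "\<And>u. u \<in> {0..1} \<Longrightarrow> \<bar>f u - g u\<bar> \<le> r" "0 \<le> r"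
  shows "skorokhod_dist f g \<le> ereal r"
  unfolding skorokhod_dist_def
proof (rule INF_lower2[OF id_time_change], rule max.boundedI)
  show "(SUP (s, t)\<in>{(s, t). 0 \<le> s \<and> s < t \<and> t \<le> 1}. ereal \<bar>ln ((t - s) / (t - s))\<bar>) \<le> ereal r"
    using assms(2) by (intro SUP_least) auto
  show "(SUP u\<in>{0..1}. ereal \<bar>f u - g u\<bar>) \<le> ereal r"
    using assms(1) by (intro SUP_least) auto
qed

lemma skorokhod_dist_endpoint:
  assumes "skorokhod_dist f g < ereal r"
  shows "\<bar>f 1 - g 1\<bar> < r"
  using assms
proof (rule skorokhod_dist_lessE)
  fix l assume "l \<in> time_changes" and *: "\<And>u. u \<in> {0..1} \<Longrightarrow> \<bar>f (l u) - g u\<bar> < r"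
  then show ?thesis using *[of 1] time_changes_endpoints(2)[of l] by auto
qed

text \<open>The time change carries a window of \<open>g\<close> onto the given window of
  \<open>f\<close>. Its slope over this window changes the length by a factor of at most
  \<open>exp r\<close>; its slope between 0 and the left end keeps that end away from 0 in the same
  proportion. The two ends cost \<open>r\<close> each.\<close>

lemma skorokhod_dist_window:
  assumes d: "skorokhod_dist f g < ereal r" and st: "0 \<le> s" "s < t" "t \<le> 1"
  obtains s' t' where "exp (- r) * s \<le> s'" "0 \<le> s'" "s' < t'" "t' \<le> 1" "t' - s' \<le> exp r * (t - s)"
    "\<bar>f t - f s\<bar> - 2 * r < \<bar>g t' - g s'\<bar>"
  using d
proof (rule skorokhod_dist_lessE)
  fix l assume l: "l \<in> time_changes"
    and sl: "\<And>s t. 0 \<le> s \<Longrightarrow> s < t \<Longrightarrow> t \<le> 1 \<Longrightarrow> \<bar>ln ((l t - l s) / (t - s))\<bar> < r"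
    and fg: "\<And>u. u \<in> {0..1} \<Longrightarrow> \<bar>f (l u) - g u\<bar> < r"
  have mono: "strict_mono_on {0..1} l" and bij: "bij_betw l {0..1} {0..1}"
    using l by (auto simp: time_changes_def)
  have img: "l ` {0..1} = {0..1}"
    using bij by (auto simp: bij_betw_def)
  have "s \<in> l ` {0..1}" "t \<in> l ` {0..1}" unfolding img using st by auto
  then obtain s' t' where s': "s' \<in> {0..1}" "l s' = s" and t': "t' \<in> {0..1}" "l t' = t"
    by blast
  have lt: "s' < t'"
    using strict_mono_on_less[OF mono s'(1) t'(1)] s'(2) t'(2) st by simp
  have 1: "exp (- r) * s \<le> s'"
  proof (cases "s' = 0")
    case True
    then show ?thesis using s'(2) time_changes_endpoints[OF l] by simp
  next
    case False
    then have pos: "0 < s'" using s' by simp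
    have "0 < s"
      using strict_mono_on_less[OF mono _ s'(1), of 0] s'(2) pos time_changes_endpoints[OF l] by auto
    have "ln (s / s') < r"
      using sl[of 0 s'] pos s' time_changes_endpoints[OF l] by (auto simp: abs_less_iff)
    then have "s / s' < exp r"
      using \<open>0 < s\<close> pos by (metis divide_pos_pos exp_less_mono exp_ln)
    then show ?thesis using pos by (simp add: field_simps exp_minus)
  qed
  have "- r < ln ((t - s) / (t' - s'))"
    using sl[of s' t'] lt s' t' by (auto simp: abs_less_iff)
  then have "exp (- r) < (t - s) / (t' - s')"
    using st lt by (metis diff_gt_0_iff_gt divide_pos_pos exp_less_mono exp_ln)
  then have 2: "t' - s' \<le> exp r * (t - s)"
    using lt by (simp add: field_simps exp_minus)
  have "\<bar>f t - g t'\<bar> < r" "\<bar>f s - g s'\<bar> < r"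
    using fg[of t'] fg[of s'] s' t' by auto
  then have "\<bar>f t - f s\<bar> - 2 * r < \<bar>g t' - g s'\<bar>" by linarith
  then show thesis using that[of s' t'] 1 2 lt s' t' by auto
qed

section \<open>Borel sets of the Skorokhod space that serve as test sets\<close>

lemma space_skorokhod_borel [simp]: "space skorokhod_borel = skorokhod_paths"
  by (simp add: skorokhod_borel_def space_measure_of_conv)

lemma skorokhod_open_sets: "skorokhod_open U \<Longrightarrow> U \<in> sets skorokhod_borel"
  unfolding skorokhod_borel_def
  by (subst sets_measure_of) (auto simp: skorokhod_open_def)

lemma continuous_skorokhod_path:
  assumes "continuous_on {0..1} f"
  shows "restrict f {0..1} \<in> skorokhod_paths"
proof -
  have c: "continuous_on {0..1} (restrict f {0..1})"
    using assms by (subst continuous_on_cong[OF refl]) auto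
  have "continuous (at_right t) (restrict f {0..1})" if "t \<in> {0..<1}" for t
  proof -
    have "continuous (at t within {t..1}) (restrict f {0..1})"
    proof (rule continuous_within_subset)
      show "continuous (at t within {0..1}) (restrict f {0..1})"
        using c that unfolding continuous_on_eq_continuous_within by (simp del: restrict_apply)
      show "{t..1} \<subseteq> {0..1}" using that by auto
    qed
    then show ?thesis using that by (simp add: at_within_Icc_at_right)
  qed
  moreover have "\<exists>l. (restrict f {0..1} \<longlongrightarrow> l) (at_left t)" if "t \<in> {0<..1}" for t
  proof -
    have "continuous (at t within {0..t}) (restrict f {0..1})"
    proof (rule continuous_within_subset)
      show "continuous (at t within {0..1}) (restrict f {0..1})"
        using c that unfolding continuous_on_eq_continuous_within by (simp del: restrict_apply)
      show "{0..t} \<subseteq> {0..1}" using that by auto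
    qed
    then have "continuous (at_left t) (restrict f {0..1})" using that by (simp add: at_within_Icc_at_left)
    then show ?thesis by (auto simp: continuous_within)
  qed
  ultimately show ?thesis by (auto simp: skorokhod_paths_def)
qed

text \<open>Strict inequalities make the set open, hence Borel. The offset \<open>\<sigma>\<close>
  excludes windows near 0: in the Gaussian class, where \<open>\<sigma> = 1/2\<close>, the early
  iterates are too large for the Lipschitz estimate. In the oscillation class
  \<open>\<sigma> = 0\<close>.\<close>

definition osc_paths :: "real \<Rightarrow> real \<Rightarrow> real \<Rightarrow> (real \<Rightarrow> real) set" where
  "osc_paths \<sigma> h a = {f \<in> skorokhod_paths.
     \<exists>s t. \<sigma> < s \<and> s < t \<and> t \<le> 1 \<and> t - s < h \<and> a < \<bar>f t - f s\<bar>}"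

lemma osc_paths_sets:
  assumes "0 \<le> \<sigma>"
  shows "osc_paths \<sigma> h a \<in> sets skorokhod_borel"
proof (rule skorokhod_open_sets, unfold skorokhod_open_def, intro conjI ballI)
  show "osc_paths \<sigma> h a \<subseteq> skorokhod_paths" by (auto simp: osc_paths_def)
  fix f assume "f \<in> osc_paths \<sigma> h a"
  then obtain s t where st: "\<sigma> < s" "s < t" "t \<le> 1" "t - s < h" "a < \<bar>f t - f s\<bar>"
    by (auto simp: osc_paths_def)
  \<comment> \<open>As the radius tends to 0, the three quantities that bound the perturbed window
    tend to those of the original one, so the strict inequalities survive for some positive
    radius.\<close>
  have "((\<lambda>r. exp (- r) * s) \<longlongrightarrow> exp (- 0) * s) (at_right 0)"
    "((\<lambda>r. exp r * (t - s)) \<longlongrightarrow> exp 0 * (t - s)) (at_right 0)"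
    "((\<lambda>r. \<bar>f t - f s\<bar> - 2 * r) \<longlongrightarrow> \<bar>f t - f s\<bar> - 2 * 0) (at_right 0)"
    by (rule tendsto_intros)+
  then have "\<forall>\<^sub>F r in at_right 0. \<sigma> < exp (- r) * s" "\<forall>\<^sub>F r in at_right 0. exp r * (t - s) < h"
    "\<forall>\<^sub>F r in at_right 0. a < \<bar>f t - f s\<bar> - 2 * r"
    using st by (auto elim!: order_tendstoD)
  moreover have "\<forall>\<^sub>F r::real in at_right 0. 0 < r" by (simp add: eventually_at_right_less)
  ultimately have "\<forall>\<^sub>F r in at_right 0. \<sigma> < exp (- r) * s \<and> exp r * (t - s) < h \<and>
      a < \<bar>f t - f s\<bar> - 2 * r \<and> 0 < r" by eventually_elim auto
  then obtain r where r: "\<sigma> < exp (- r) * s" "exp r * (t - s) < h" "a < \<bar>f t - f s\<bar> - 2 * r" "0 < r"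
    using eventually_happens'[of "at_right (0::real)"] by auto
  show "\<exists>r>0. \<forall>g\<in>skorokhod_paths. skorokhod_dist f g < ereal r \<longrightarrow> g \<in> osc_paths \<sigma> h a"
  proof (intro exI[of _ r] conjI ballI impI)
    fix g assume g: "g \<in> skorokhod_paths" and d: "skorokhod_dist f g < ereal r"
    show "g \<in> osc_paths \<sigma> h a"
      using d
    proof (rule skorokhod_dist_window[of f g r s t])
      show "0 \<le> s" "s < t" "t \<le> 1" using st assms by auto
      fix s' t' assume "exp (- r) * s \<le> s'" "s' < t'" "t' \<le> 1" "t' - s' \<le> exp r * (t - s)"
        "\<bar>f t - f s\<bar> - 2 * r < \<bar>g t' - g s'\<bar>"
      then show ?thesis using r g unfolding osc_paths_def
        by (intro CollectI conjI exI[of _ s'] exI[of _ t']) auto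
    qed
  qed (use r in auto)
qed

text \<open>Supplies all that is needed about a neighbourhood. With \<open>\<delta> < a / 4\<close>
  and \<open>exp \<delta> \<le> 2\<close>, as in both applications, more than half of the
  oscillation remains, on windows at most twice as long.\<close>

lemma nbhd_osc_paths:
  assumes "0 \<le> \<sigma>" "g \<in> skorokhod_nbhd (osc_paths \<sigma> h a) \<delta>"
  obtains s t where "exp (- \<delta>) * \<sigma> \<le> s" "0 \<le> s" "s < t" "t \<le> 1" "t - s \<le> exp \<delta> * h"
    "a - 2 * \<delta> < \<bar>g t - g s\<bar>"
proof -
  obtain f where f: "f \<in> osc_paths \<sigma> h a" "skorokhod_dist f g < ereal \<delta>"
    using assms(2) by (auto simp: skorokhod_nbhd_def INF_less_iff)
  obtain s t where st: "\<sigma> < s" "s < t" "t \<le> 1" "t - s < h" "a < \<bar>f t - f s\<bar>"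
    using f(1) by (auto simp: osc_paths_def)
  show thesis
    using f(2)
  proof (rule skorokhod_dist_window[of f g \<delta> s t])
    show "0 \<le> s" "s < t" "t \<le> 1" using st assms by auto
    fix s' t' assume *: "exp (- \<delta>) * s \<le> s'" "0 \<le> s'" "s' < t'" "t' \<le> 1" "t' - s' \<le> exp \<delta> * (t - s)"
        "\<bar>f t - f s\<bar> - 2 * \<delta> < \<bar>g t' - g s'\<bar>"
    have "exp (- \<delta>) * \<sigma> \<le> exp (- \<delta>) * s" "exp \<delta> * (t - s) \<le> exp \<delta> * h"
      using st by (auto intro!: mult_left_mono)
    then show thesis using * st that[of s' t'] by linarith
  qed
qed

lemma endpoint_greater_sets: "{f \<in> skorokhod_paths. a < \<bar>f 1\<bar>} \<in> sets skorokhod_borel"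
proof (rule skorokhod_open_sets, unfold skorokhod_open_def, intro conjI ballI)
  fix f assume f: "f \<in> {f \<in> skorokhod_paths. a < \<bar>f 1\<bar>}"
  show "\<exists>r>0. \<forall>g\<in>skorokhod_paths. skorokhod_dist f g < ereal r \<longrightarrow> g \<in> {f \<in> skorokhod_paths. a < \<bar>f 1\<bar>}"
  proof (intro exI[of _ "\<bar>f 1\<bar> - a"] conjI ballI impI)
    fix g assume "g \<in> skorokhod_paths" "skorokhod_dist f g < ereal (\<bar>f 1\<bar> - a)"
    then show "g \<in> {f \<in> skorokhod_paths. a < \<bar>f 1\<bar>}"
      using skorokhod_dist_endpoint[of f g "\<bar>f 1\<bar> - a"] by auto
  qed (use f in auto)
qed auto

lemma endpoint_le_sets: "{f \<in> skorokhod_paths. \<bar>f 1\<bar> \<le> a} \<in> sets skorokhod_borel"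
proof -
  have "{f \<in> skorokhod_paths. \<bar>f 1\<bar> \<le> a} =
      space skorokhod_borel - {f \<in> skorokhod_paths. a < \<bar>f 1\<bar>}" by auto
  moreover have "\<dots> \<in> sets skorokhod_borel"
    using endpoint_greater_sets by (rule sets.compl_sets)
  ultimately show ?thesis by simp
qed

lemma nbhd_endpoint_close:
  assumes "g \<in> skorokhod_nbhd \<Gamma> \<delta>"
  obtains f where "f \<in> \<Gamma>" "\<bar>f 1 - g 1\<bar> < \<delta>"
  using assms by (auto simp: skorokhod_nbhd_def INF_less_iff dest: skorokhod_dist_endpoint)

section \<open>Measurability of continuous processes as random elements of the path space\<close>

lemma continuous_bound_on_rationals:
  fixes \<phi> :: "real \<Rightarrow> real"
  assumes c: "continuous_on {0..1} \<phi>" and b: "\<And>q. q \<in> \<rat> \<inter> {0..1} \<Longrightarrow> \<bar>\<phi> q\<bar> \<le> c" and u: "u \<in> {0..1}"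
  shows "\<bar>\<phi> u\<bar> \<le> c"
proof (rule ccontr)
  assume "\<not> ?thesis"
  then have pos: "0 < \<bar>\<phi> u\<bar> - c" by simp
  obtain d where d: "d > 0" "\<And>v. v \<in> {0..1} \<Longrightarrow> \<bar>v - u\<bar> < d \<Longrightarrow> \<bar>\<phi> v - \<phi> u\<bar> < \<bar>\<phi> u\<bar> - c"
    using c u pos unfolding continuous_on_iff dist_real_def by meson
  have "max 0 (u - d) < min 1 (u + d)" using u d by auto
  then obtain v where v: "v \<in> \<rat>" "max 0 (u - d) < v" "v < min 1 (u + d)"
    using Rats_dense_in_real by blast
  then have "\<bar>\<phi> v - \<phi> u\<bar> < \<bar>\<phi> u\<bar> - c" "\<bar>\<phi> v\<bar> \<le> c" using d(2)[of v] b[of v] by auto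
  then show False by linarith
qed

text \<open>These polynomials form a countable dense set; the coefficients are a list of rationals
  because that type is countable. The Bernstein basis is nonnegative and sums to 1, so rounding
  every coefficient by at most \<open>e / 2\<close> changes the polynomial by at most
  \<open>e / 2\<close>.\<close>

lemma rational_Bernstein_dense:
  fixes f :: "real \<Rightarrow> real"
  assumes c: "continuous_on {0..1} f" and e: "0 < e"
  obtains n and qs :: "rat list" where
    "\<And>u. u \<in> {0..1} \<Longrightarrow> \<bar>f u - (\<Sum>k\<le>n. real_of_rat (qs ! k) * Bernstein n k u)\<bar> \<le> e"
proof -
  obtain n where n: "\<And>u. u \<in> {0..1} \<Longrightarrow> \<bar>f u - (\<Sum>k\<le>n. f (k / n) * Bernstein n k u)\<bar> < e / 2"
    using Bernstein_Weierstrass[OF c, of "e / 2"] e by auto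
  have "\<exists>q. \<bar>f (k / n) - real_of_rat q\<bar> < e / 2" for k :: nat
  proof -
    obtain q where "f (k / n) - e / 2 < real_of_rat q" "real_of_rat q < f (k / n) + e / 2"
      using of_rat_dense[of "f (k / n) - e / 2" "f (k / n) + e / 2"] e by auto
    then have "\<bar>f (k / n) - real_of_rat q\<bar> < e / 2" unfolding abs_less_iff by linarith
    then show ?thesis by blast
  qed
  then obtain q where q: "\<And>k :: nat. \<bar>f (k / n) - real_of_rat (q k)\<bar> < e / 2" by metis
  define qs where "qs = map q [0..<Suc n]"
  have "\<bar>f u - (\<Sum>k\<le>n. real_of_rat (qs ! k) * Bernstein n k u)\<bar> \<le> e" if u: "u \<in> {0..1}" for u
  proof -
    have B: "0 \<le> Bernstein n k u" for k using u by (intro Bernstein_nonneg) auto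
    have "\<bar>(\<Sum>k\<le>n. f (k / n) * Bernstein n k u) - (\<Sum>k\<le>n. real_of_rat (qs ! k) * Bernstein n k u)\<bar>
        = \<bar>\<Sum>k\<le>n. (f (k / n) - real_of_rat (qs ! k)) * Bernstein n k u\<bar>"
      by (simp add: sum_subtractf algebra_simps)
    also have "\<dots> \<le> (\<Sum>k\<le>n. \<bar>(f (k / n) - real_of_rat (qs ! k)) * Bernstein n k u\<bar>)" by (rule sum_abs)
    also have "\<dots> \<le> (\<Sum>k\<le>n. e / 2 * Bernstein n k u)"
    proof (rule sum_mono)
      fix k assume "k \<in> {..n}"
      then have "qs ! k = q k" unfolding qs_def by (subst nth_map) (auto simp del: upt_Suc)
      then show "\<bar>(f (k / n) - real_of_rat (qs ! k)) * Bernstein n k u\<bar> \<le> e / 2 * Bernstein n k u"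
        using mult_right_mono[OF less_imp_le[OF q[of k]] B[of k]] B[of k] by (simp add: abs_mult)
    qed
    also have "\<dots> = e / 2" unfolding sum_distrib_left[symmetric] by simp
    finally show ?thesis using n[OF u] by linarith
  qed
  then show thesis using that by blast
qed

text \<open>The Skorokhod distance is at most the supremum distance, so the continuous paths in an
  open set are covered by supremum balls contained in it. Countably many balls suffice, centred at
  rational Bernstein polynomials, and membership of a continuous path in a ball is decided at
  rational times.\<close>

lemma continuous_process_measurable:
  assumes m: "\<And>t. t \<in> {0..1} \<Longrightarrow> (\<lambda>\<omega>. X \<omega> t) \<in> borel_measurable M"
    and c: "\<And>\<omega>. \<omega> \<in> space M \<Longrightarrow> continuous_on {0..1} (X \<omega>)"
  shows "(\<lambda>\<omega>. restrict (X \<omega>) {0..1}) \<in> measurable M skorokhod_borel"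
  unfolding skorokhod_borel_def
proof (rule measurable_measure_of)
  show "{U. skorokhod_open U} \<subseteq> Pow skorokhod_paths" by (auto simp: skorokhod_open_def)
  show "(\<lambda>\<omega>. restrict (X \<omega>) {0..1}) \<in> space M \<rightarrow> skorokhod_paths"
    using c by (auto intro: continuous_skorokhod_path)
  fix U assume "U \<in> {U. skorokhod_open U}"
  then have U: "skorokhod_open U" by simp
  define g where "g i u = (\<Sum>k\<le>fst i. real_of_rat (snd i ! k) * Bernstein (fst i) k u)"
    for i :: "nat \<times> rat list" and u :: real
  have gc: "continuous_on {0..1} (g i)" for i
    unfolding g_def Bernstein_def by (intro continuous_intros)
  \<comment> \<open>The pairs of a centre and a radius whose closed supremum ball lies in
    \<open>U\<close>. The set is countable because its type is.\<close>
  define S where "S = {(i, m). \<forall>h. h \<in> skorokhod_paths \<longrightarrow>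
    (\<forall>u\<in>{0..1}. \<bar>h u - g i u\<bar> \<le> 1 / real (Suc m)) \<longrightarrow> h \<in> U}"
  define E where "E im = {\<omega>\<in>space M. \<forall>q\<in>\<rat> \<inter> {0..1}. \<bar>X \<omega> q - g (fst im) q\<bar> \<le> 1 / real (Suc (snd im))}" for im
  have "(\<lambda>\<omega>. restrict (X \<omega>) {0..1}) -` U \<inter> space M = (\<Union>im\<in>S. E im)"
  proof (intro set_eqI iffI)
    fix \<omega> assume "\<omega> \<in> (\<lambda>\<omega>. restrict (X \<omega>) {0..1}) -` U \<inter> space M"
    then have \<omega>: "\<omega> \<in> space M" "restrict (X \<omega>) {0..1} \<in> U" by auto
    obtain r where r: "r > 0" "\<And>h. h \<in> skorokhod_paths \<Longrightarrow> skorokhod_dist (restrict (X \<omega>) {0..1}) h < ereal r \<Longrightarrow> h \<in> U"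
      using U \<omega> unfolding skorokhod_open_def by blast
    \<comment> \<open>Path and test function each lie within \<open>1 / real (Suc m)\<close> of the
      centre, hence within \<open>2 / real (Suc m) < r\<close> of each other.\<close>
    obtain m where m: "1 / real (Suc m) < r / 2" using nat_approx_posE[of "r / 2"] r by auto
    obtain n qs where a: "\<And>u. u \<in> {0..1} \<Longrightarrow> \<bar>X \<omega> u - (\<Sum>k\<le>n. real_of_rat (qs ! k) * Bernstein n k u)\<bar> \<le> 1 / real (Suc m)"
      using rational_Bernstein_dense[OF c[OF \<omega>(1)], of "1 / real (Suc m)"] by (metis of_nat_0_less_iff zero_less_Suc zero_less_divide_1_iff)
    then have a: "\<bar>X \<omega> u - g (n, qs) u\<bar> \<le> 1 / real (Suc m)" if "u \<in> {0..1}" for u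
      using that by (simp add: g_def)
    have "((n, qs), m) \<in> S"
      unfolding S_def
    proof (clarsimp simp del: of_nat_Suc)
      fix h assume h: "h \<in> skorokhod_paths" "\<forall>u\<in>{0..1}. \<bar>h u - g (n, qs) u\<bar> \<le> 1 / real (Suc m)"
      have "skorokhod_dist (restrict (X \<omega>) {0..1}) h \<le> ereal (2 / real (Suc m))"
      proof (rule skorokhod_dist_le_sup)
        fix u :: real assume u: "u \<in> {0..1}"
        have "\<bar>h u - g (n, qs) u\<bar> \<le> 1 / real (Suc m)" "\<bar>X \<omega> u - g (n, qs) u\<bar> \<le> 1 / real (Suc m)"
          using h u a by auto
        then have "\<bar>X \<omega> u - h u\<bar> \<le> 1 / real (Suc m) + 1 / real (Suc m)" by linarith
        then show "\<bar>restrict (X \<omega>) {0..1} u - h u\<bar> \<le> 2 / real (Suc m)" using u by simp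
      qed auto
      also have "\<dots> < ereal r" using m by simp
      finally show "h \<in> U" using r(2) h(1) by blast
    qed
    moreover have "\<omega> \<in> E ((n, qs), m)" using a \<omega> by (auto simp: E_def)
    ultimately show "\<omega> \<in> (\<Union>im\<in>S. E im)" by blast
  next
    fix \<omega> assume "\<omega> \<in> (\<Union>im\<in>S. E im)"
    then obtain i m where im: "(i, m) \<in> S" "\<omega> \<in> E (i, m)" by auto
    then have \<omega>: "\<omega> \<in> space M" by (auto simp: E_def)
    have "\<bar>X \<omega> u - g i u\<bar> \<le> 1 / real (Suc m)" if "u \<in> {0..1}" for u
    proof (rule continuous_bound_on_rationals[where \<phi> = "\<lambda>u. X \<omega> u - g i u"])
      show "continuous_on {0..1} (\<lambda>u. X \<omega> u - g i u)"
        using c[OF \<omega>] gc by (rule continuous_on_diff)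
      show "\<bar>X \<omega> q - g i q\<bar> \<le> 1 / real (Suc m)" if "q \<in> \<rat> \<inter> {0..1}" for q
        using im(2) that unfolding E_def by simp
    qed (fact that)
    then show "\<omega> \<in> (\<lambda>\<omega>. restrict (X \<omega>) {0..1}) -` U \<inter> space M"
      using im(1) \<omega> continuous_skorokhod_path[OF c[OF \<omega>]] by (auto simp: S_def)
  qed
  moreover have "E im \<in> sets M" for im
  proof -
    have Eq: "E im = (\<Inter>q\<in>\<rat> \<inter> {0..1}. {\<omega>\<in>space M. \<bar>X \<omega> q - g (fst im) q\<bar> \<le> 1 / real (Suc (snd im))})"
      unfolding E_def using Rats_0 by (force simp: Bex_def)
    have m: "{\<omega>\<in>space M. \<bar>X \<omega> q - g (fst im) q\<bar> \<le> 1 / real (Suc (snd im))} \<in> sets M"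
      if "q \<in> \<rat> \<inter> {0..1}" for q
    proof -
      have [measurable]: "(\<lambda>\<omega>. X \<omega> q) \<in> borel_measurable M" using m that by auto
      show ?thesis by measurable
    qed
    have cnt: "countable (\<rat> \<inter> {0..1::real})" using countable_rat by (rule countable_Int1)
    have ne: "\<rat> \<inter> {0..1::real} \<noteq> {}" using Rats_0 by (metis IntI atLeastAtMost_iff empty_iff order_refl zero_le_one)
    show ?thesis unfolding Eq using m by (intro sets.countable_INT'[OF cnt ne] image_subsetI)
  qed
  moreover have "countable S" by auto
  ultimately show "(\<lambda>\<omega>. restrict (X \<omega>) {0..1}) -` U \<inter> space M \<in> sets M"
    by (auto intro!: sets.countable_UN')
qed

section \<open>Estimates for the Prokhorov distance and for laws of random paths\<close>

lemma measure_distr_le_1: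
  assumes "prob_space P"
  shows "measure (distr P S f) A \<le> 1"
proof -
  interpret prob_space P by fact
  \<comment> \<open>No measurability of \<open>f\<close> is assumed: \<open>distr\<close> yields the
    mass of a preimage or 0, and both are at most 1.\<close>
  have "emeasure (distr P S f) A \<le> 1"
    unfolding distr_def emeasure_measure_of_conv by (auto intro: emeasure_le_1)
  then show ?thesis
    by (simp add: Sigma_Algebra.measure_def enn2real_leI)
qed

text \<open>The radius 1 is always admissible. The bound makes the distances over a class bounded
  above, so that their real supremum really is an upper bound for them.\<close>

lemma prokhorov_dist_le_1:
  assumes "\<And>\<Gamma>. measure \<mu> \<Gamma> \<le> 1" "\<And>\<Gamma>. measure \<nu> \<Gamma> \<le> 1"
  shows "prokhorov_dist \<mu> \<nu> \<le> 1"
  unfolding prokhorov_dist_def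
proof (rule cInf_lower)
  show "1 \<in> {\<delta>. 0 < \<delta> \<and> (\<forall>\<Gamma>\<in>sets skorokhod_borel.
     measure \<mu> \<Gamma> \<le> measure \<nu> (skorokhod_nbhd \<Gamma> \<delta>) + \<delta> \<and>
     measure \<nu> \<Gamma> \<le> measure \<mu> (skorokhod_nbhd \<Gamma> \<delta>) + \<delta>)}"
    using assms by (auto intro: add_increasing)
qed (auto intro!: bdd_belowI[of _ 0])

text \<open>A test set that violates one of the two inequalities excludes the radius. Total mass at
  most 1 makes the set of admissible radii nonempty, as is needed for the infimum of a set of
  reals.\<close>

lemma prokhorov_dist_ge:
  assumes "\<And>\<Gamma>. measure \<mu> \<Gamma> \<le> 1" "\<And>\<Gamma>. measure \<nu> \<Gamma> \<le> 1"
    and "\<And>\<delta>. 0 < \<delta> \<Longrightarrow> \<delta> < r \<Longrightarrow> \<exists>\<Gamma>\<in>sets skorokhod_borel.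
      measure \<nu> (skorokhod_nbhd \<Gamma> \<delta>) + \<delta> < measure \<mu> \<Gamma> \<or>
      measure \<mu> (skorokhod_nbhd \<Gamma> \<delta>) + \<delta> < measure \<nu> \<Gamma>"
  shows "r \<le> prokhorov_dist \<mu> \<nu>"
  unfolding prokhorov_dist_def
proof (rule cInf_greatest)
  have "1 \<in> {\<delta>. 0 < \<delta> \<and> (\<forall>\<Gamma>\<in>sets skorokhod_borel.
     measure \<mu> \<Gamma> \<le> measure \<nu> (skorokhod_nbhd \<Gamma> \<delta>) + \<delta> \<and>
     measure \<nu> \<Gamma> \<le> measure \<mu> (skorokhod_nbhd \<Gamma> \<delta>) + \<delta>)}"
    using assms(1,2) by (auto intro: add_increasing)
  then show "{\<delta>. 0 < \<delta> \<and> (\<forall>\<Gamma>\<in>sets skorokhod_borel.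
     measure \<mu> \<Gamma> \<le> measure \<nu> (skorokhod_nbhd \<Gamma> \<delta>) + \<delta> \<and>
     measure \<nu> \<Gamma> \<le> measure \<mu> (skorokhod_nbhd \<Gamma> \<delta>) + \<delta>)} \<noteq> {}" by blast
qed (use assms(3) in \<open>force simp: not_less[symmetric]\<close>)

lemma worst_dist_ge:
  assumes "M \<in> C" "\<And>M. M \<in> C \<Longrightarrow> prob_space (pmeasure M)" "prob_space Q"
  shows "prokhorov_dist (path_law (pmeasure M) (oracle_path st M T)) (path_law Q (target_path B M))
    \<le> worst_dist st Q B T C"
  unfolding worst_dist_def
  using assms by (intro cSUP_upper bdd_aboveI2[where M = 1] prokhorov_dist_le_1)
    (auto simp: path_law_def intro: measure_distr_le_1)

lemma measure_path_law:
  assumes "\<And>t. t \<in> {0..1} \<Longrightarrow> (\<lambda>\<omega>. X \<omega> t) \<in> borel_measurable P"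
    and "\<And>\<omega>. \<omega> \<in> space P \<Longrightarrow> continuous_on {0..1} (X \<omega>)" and "\<Gamma> \<in> sets skorokhod_borel"
  shows "measure (path_law P X) \<Gamma> = measure P {\<omega>\<in>space P. restrict (X \<omega>) {0..1} \<in> \<Gamma>}"
    and "{\<omega>\<in>space P. restrict (X \<omega>) {0..1} \<in> \<Gamma>} \<in> sets P"
proof -
  have m: "(\<lambda>\<omega>. restrict (X \<omega>) {0..1}) \<in> measurable P skorokhod_borel"
    using assms by (intro continuous_process_measurable)
  have eq: "(\<lambda>\<omega>. restrict (X \<omega>) {0..1}) -` \<Gamma> \<inter> space P = {\<omega>\<in>space P. restrict (X \<omega>) {0..1} \<in> \<Gamma>}"
    by auto
  show "measure (path_law P X) \<Gamma> = measure P {\<omega>\<in>space P. restrict (X \<omega>) {0..1} \<in> \<Gamma>}"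
    using measure_distr[OF m assms(3)] eq by (simp add: path_law_def)
  show "{\<omega>\<in>space P. restrict (X \<omega>) {0..1} \<in> \<Gamma>} \<in> sets P"
    using measurable_sets[OF m assms(3)] eq by simp
qed

text \<open>The neighbourhood of a set need not be known to be measurable here: a measure
  assigns \<open>0\<close> to a non-measurable set.\<close>

lemma measure_path_law_le:
  assumes "prob_space P" "bad \<in> sets P"
    and "\<And>\<omega>. \<omega> \<in> space P \<Longrightarrow> \<omega> \<notin> bad \<Longrightarrow> restrict (X \<omega>) {0..1} \<notin> \<Gamma>"
  shows "measure (path_law P X) \<Gamma> \<le> measure P bad"
proof -
  interpret prob_space P by fact
  let ?f = "\<lambda>\<omega>. restrict (X \<omega>) {0..1}"
  have sub: "?f -` \<Gamma> \<inter> space P \<subseteq> bad" using assms(3) by auto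
  have "emeasure P (?f -` \<Gamma> \<inter> space P) \<le> emeasure P bad"
    using sub assms(2) by (rule emeasure_mono)
  then have "emeasure (path_law P X) \<Gamma> \<le> emeasure P bad"
    unfolding path_law_def distr_def emeasure_measure_of_conv by (simp del: not_gr_zero)
  then show ?thesis
    unfolding Sigma_Algebra.measure_def by (rule enn2real_mono) (simp add: emeasure_eq_measure)
qed

section \<open>Oracle paths and the linear recursion\<close>

declare iterate.simps(2) [simp del]

text \<open>The linear interpolation of partial sums without the floor function: summand
  \<open>k\<close> is switched on linearly while \<open>y\<close> runs from \<open>k\<close> to
  \<open>k + 1\<close>. In this form continuity, measurability and Lipschitz bounds for the path are
  easy to read off.\<close>

lemma ramp_sum:
  fixes a :: "nat \<Rightarrow> real"
  assumes "0 \<le> y" "y \<le> real T"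
  shows "(\<Sum>k<T. a k * max 0 (min 1 (y - real k))) =
    (\<Sum>k<nat \<lfloor>y\<rfloor>. a k) + (y - real (nat \<lfloor>y\<rfloor>)) * a (nat \<lfloor>y\<rfloor>)"
proof -
  define n where "n = nat \<lfloor>y\<rfloor>"
  have n: "real n \<le> y" "y < real n + 1" using assms(1) unfolding n_def by linarith+
  have nT: "n \<le> T" using n assms(2) by linarith
  have "(\<Sum>k<T. a k * max 0 (min 1 (y - real k))) =
      (\<Sum>k<T. (if k < n then a k else 0) + (if k = n then (y - real n) * a n else 0))"
  proof (rule sum.cong[OF refl])
    fix k assume "k \<in> {..<T}"
    consider "k < n" | "k = n" | "n < k" by linarith
    then show "a k * max 0 (min 1 (y - real k)) =
        (if k < n then a k else 0) + (if k = n then (y - real n) * a n else 0)"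
    proof cases
      case 1
      then have "y - real k \<ge> 1" using n by linarith
      then show ?thesis using 1 by simp
    next
      case 3
      then have "y - real k \<le> 0" using n by linarith
      then show ?thesis using 3 by (simp add: max_def min_def)
    qed (use n in \<open>simp add: mult.commute\<close>)
  qed
  also have "\<dots> = (\<Sum>k<T. if k < n then a k else 0) + (\<Sum>k<T. if k = n then (y - real n) * a n else 0)"
    by (rule sum.distrib)
  also have "(\<Sum>k<T. if k < n then a k else 0) = (\<Sum>k<n. a k)"
    using nT by (intro sum.mono_neutral_cong_right) auto
  also have "(\<Sum>k<T. if k = n then (y - real n) * a n else 0) = (y - real n) * a n"
  \<comment> \<open>At \<open>y = real T\<close> the interpolation refers to an increment beyond the
    sum, but with weight 0.\<close>
  proof (cases "n < T")
    case False
    then have "y = real n" using nT n assms by linarith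
    then show ?thesis by simp
  qed simp
  finally show ?thesis unfolding n_def .
qed

lemma scaled_sum_eq: "scaled_sum st M T n \<omega> = (\<Sum>k<n. iterate st M (k + 2) \<omega> / sqrt (real T))"
proof -
  have "(\<Sum>t = 1..n. iterate st M (t + 1) \<omega>) = (\<Sum>k<n. iterate st M (k + 2) \<omega>)"
    by (rule sum.reindex_bij_witness[of _ Suc "\<lambda>t. t - 1"]) auto
  then show ?thesis by (simp add: scaled_sum_def sum_divide_distrib)
qed

lemma oracle_path_ramp:
  assumes "r \<in> {0..1}"
  shows "oracle_path st M T \<omega> r =
    (\<Sum>k<T. iterate st M (k + 2) \<omega> / sqrt (real T) * max 0 (min 1 (real T * r - real k)))"
proof -
  have "0 \<le> real T * r" "real T * r \<le> real T" using assms by (auto simp: mult_left_le)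
  from ramp_sum[OF this, of "\<lambda>k. iterate st M (k + 2) \<omega> / sqrt (real T)"]
  show ?thesis by (simp add: oracle_path_def Let_def scaled_sum_eq)
qed

lemma continuous_oracle_path: "continuous_on {0..1} (oracle_path st M T \<omega>)"
proof -
  have "continuous_on {0..1} (\<lambda>r. \<Sum>k<T. iterate st M (k + 2) \<omega> / sqrt (real T) * max 0 (min 1 (real T * r - real k)))"
    by (intro continuous_intros)
  then show ?thesis
    by (rule continuous_on_eq) (rule oracle_path_ramp[symmetric])
qed

lemma iterate_measurable:
  assumes [measurable]: "drift M \<in> borel_measurable borel"
    and noise: "\<And>t. 1 \<le> t \<Longrightarrow> noise M t \<in> borel_measurable P"
  shows "iterate st M t \<in> borel_measurable P"
proof (induction t)
  case 0
  have "iterate st M 0 = (\<lambda>_. 0)" by auto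
  then show ?case by simp
next
  case (Suc t)
  show ?case
  proof (cases "t = 0")
    case False
    have [measurable]: "noise M t \<in> borel_measurable P" "iterate st M t \<in> borel_measurable P"
      using noise False Suc by auto
    have "iterate st M (Suc t) = (\<lambda>\<omega>. iterate st M t \<omega> - st t * drift M (iterate st M t \<omega>) + st t * noise M t \<omega>)"
      using False by (auto simp: iterate.simps(2))
    then show ?thesis by simp
  next
    case True
    have "iterate st M (Suc 0) = (\<lambda>_. 0)" by (auto simp: iterate.simps(2))
    then show ?thesis using True by simp
  qed
qed

lemma oracle_path_measurable:
  assumes "drift M \<in> borel_measurable borel" "\<And>t. 1 \<le> t \<Longrightarrow> noise M t \<in> borel_measurable P"
    and "r \<in> {0..1}"
  shows "(\<lambda>\<omega>. oracle_path st M T \<omega> r) \<in> borel_measurable P"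
proof -
  have [measurable]: "iterate st M t \<in> borel_measurable P" for t
    using assms(1,2) by (rule iterate_measurable)
  show ?thesis unfolding oracle_path_ramp[OF assms(3)] by measurable
qed

lemma oracle_path_grid:
  assumes "n \<le> T" "0 < T"
  shows "oracle_path st M T \<omega> (real n / real T) = (\<Sum>k<n. iterate st M (k + 2) \<omega>) / sqrt (real T)"
  using assms by (simp add: oracle_path_def scaled_sum_eq sum_divide_distrib)

lemma oracle_path_endpoint:
  assumes "0 < T"
  shows "oracle_path st M T \<omega> 1 = (\<Sum>k<T. iterate st M (k + 2) \<omega>) / sqrt (real T)"
  using oracle_path_grid[of T T] assms by simp

text \<open>Only ramps that are not yet complete at \<open>s\<close> change between \<open>s\<close>
  and \<open>t\<close>, so the iterates need to be bounded only from about time \<open>T * s\<close>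
  on. With all coefficients equal to 1 the ramps add up to \<open>T * u\<close>, which gives the
  total weight \<open>T * (t - s)\<close>, to be divided by \<open>sqrt T\<close>.\<close>

lemma oracle_path_Lipschitz:
  assumes st: "0 \<le> s" "s < t" "t \<le> 1"
    and X: "\<And>k. k < T \<Longrightarrow> real T * s < real k + 1 \<Longrightarrow> \<bar>iterate st M (k + 2) \<omega>\<bar> \<le> X"
  shows "\<bar>oracle_path st M T \<omega> t - oracle_path st M T \<omega> s\<bar> \<le> sqrt (real T) * X * (t - s)"
proof -
  let ?r = "\<lambda>u k. max 0 (min 1 (real T * u - real k))"
  let ?x = "\<lambda>k. iterate st M (k + 2) \<omega>"
  have le: "real T * s \<le> real T * t" using st by (simp add: mult_left_mono)
  have tot: "(\<Sum>k<T. ?r u k) = real T * u" if "0 \<le> u" "u \<le> 1" for u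
    using ramp_sum[of "real T * u" T "\<lambda>_. 1"] that by (simp add: mult_left_le)
  have eq: "oracle_path st M T \<omega> t - oracle_path st M T \<omega> s = (\<Sum>k<T. ?x k / sqrt (real T) * (?r t k - ?r s k))"
    using st by (simp add: oracle_path_ramp sum_subtractf right_diff_distrib)
  have "\<bar>oracle_path st M T \<omega> t - oracle_path st M T \<omega> s\<bar> \<le> (\<Sum>k<T. X / sqrt (real T) * (?r t k - ?r s k))"
    unfolding eq
  proof (rule order_trans[OF sum_abs sum_mono])
    fix k assume k: "k \<in> {..<T}"
    have d: "0 \<le> ?r t k - ?r s k" using le by (simp add: max_def min_def)
    show "\<bar>?x k / sqrt (real T) * (?r t k - ?r s k)\<bar> \<le> X / sqrt (real T) * (?r t k - ?r s k)"
    proof (cases "real T * s < real k + 1")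
      case True
      then have "\<bar>?x k\<bar> / sqrt (real T) \<le> X / sqrt (real T)" using X k by (intro divide_right_mono) auto
      from mult_right_mono[OF this d] show ?thesis using d by (simp add: abs_mult)
    next
      case False
      then have "?r t k - ?r s k = 0" using le by simp
      then show ?thesis by simp
    qed
  qed
  also have "\<dots> = X / sqrt (real T) * (real T * t - real T * s)"
    using st tot[of s] tot[of t] by (simp only: sum_distrib_left[symmetric] sum_subtractf)
  also have "\<dots> = sqrt (real T) * X * (t - s)"
    by (cases "T = 0") (auto simp: field_simps real_sqrt_mult[symmetric])
  finally show ?thesis .
qed

section \<open>Linear recursions with decreasing step size\<close>

lemma step_size_pos: "0 < \<eta> \<Longrightarrow> 1 \<le> t \<Longrightarrow> 0 < step_size \<eta> \<alpha> t"
  by (simp add: step_size_def)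

lemma step_size_antimono:
  assumes "0 \<le> \<eta>" "0 \<le> \<alpha>" "1 \<le> s" "s \<le> t"
  shows "step_size \<eta> \<alpha> t \<le> step_size \<eta> \<alpha> s"
  unfolding step_size_def using assms by (intro mult_left_mono powr_mono2') auto

lemma powr_minus_pred_le:
  fixes \<alpha> :: real
  assumes "0 \<le> \<alpha>" "\<alpha> \<le> 1" "2 \<le> (j::nat)"
  shows "real (j - 1) powr (- \<alpha>) \<le> real j powr (- \<alpha>) * (1 + 1 / (real j - 1))"
proof -
  have j: "real (j - 1) = real j - 1" "1 \<le> real j - 1" using assms by (auto simp: of_nat_diff)
  have "(real j / (real j - 1)) powr \<alpha> \<le> (real j / (real j - 1)) powr 1"
    using assms j by (intro powr_mono) (auto simp: field_simps)
  moreover have "real (j - 1) powr (- \<alpha>) = real j powr (- \<alpha>) * (real j / (real j - 1)) powr \<alpha>"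
    using j by (simp add: powr_divide powr_minus field_simps)
  moreover have "(real j / (real j - 1)) powr 1 = 1 + 1 / (real j - 1)" using j by (simp add: field_simps)
  ultimately show ?thesis by (simp add: mult_left_mono)
qed

text \<open>The reference value \<open>B m\<close> is subtracted so that only increments of \<open>B\<close> over the
  window enter; \<open>x (Suc j) - st j * (B j - B m)\<close> then satisfies a recursion whose
  inhomogeneity is of second order in the step size.\<close>

lemma recursion_window:
  fixes x B st :: "nat \<Rightarrow> real"
  assumes rec: "\<And>t. m < t \<Longrightarrow> t \<le> n \<Longrightarrow> x (Suc t) = (1 - st t) * x t + st t * (B t - B (t - 1))"
    and st: "\<And>t. m \<le> t \<Longrightarrow> t \<le> n \<Longrightarrow> 0 \<le> st t \<and> st t \<le> 1"
    and anti: "\<And>s t. m \<le> s \<Longrightarrow> s \<le> t \<Longrightarrow> t \<le> n \<Longrightarrow> st t \<le> st s"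
    and st2: "\<And>t. m < t \<Longrightarrow> t \<le> n \<Longrightarrow> \<bar>st (t - 1) - st t - st t * st (t - 1)\<bar> \<le> 2 * (st t)\<^sup>2"
    and D: "\<And>t. m \<le> t \<Longrightarrow> t \<le> n \<Longrightarrow> \<bar>B t - B m\<bar> \<le> D"
    and mn: "m \<le> n"
  shows "\<bar>x (Suc n)\<bar> \<le> (1 - st n) ^ (n - m) * \<bar>x (Suc m)\<bar> + 3 * st m * D"
proof -
  have D0: "0 \<le> D" using D[of m] mn by auto
  define z where "z j = x (Suc j) - st j * (B j - B m)" for j
  have "\<bar>z j\<bar> \<le> (1 - st n) ^ (j - m) * \<bar>x (Suc m)\<bar> + 2 * st m * D" if "m \<le> j" "j \<le> n" for j
    using that
  proof (induction j rule: dec_induct)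
    case base
    then show ?case using st[of m] mn D0 by (simp add: z_def)
  next
    case (step j)
    let ?s = "st (Suc j)"
    have s: "0 \<le> ?s" "?s \<le> 1" "?s \<le> st m" "st n \<le> ?s" "0 \<le> st m" "st n \<le> 1"
      using st[of "Suc j"] st[of m] st[of n] anti[of m "Suc j"] anti[of "Suc j" n] step mn by auto
    have "z (Suc j) = (1 - ?s) * z j + (st j - ?s - ?s * st j) * (B j - B m)"
      using rec[of "Suc j"] step by (simp add: z_def algebra_simps)
    then have "\<bar>z (Suc j)\<bar> \<le> \<bar>(1 - ?s) * z j\<bar> + \<bar>(st j - ?s - ?s * st j) * (B j - B m)\<bar>"
      by linarith
    also have "\<dots> = (1 - ?s) * \<bar>z j\<bar> + \<bar>st j - ?s - ?s * st j\<bar> * \<bar>B j - B m\<bar>"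
      using s by (simp add: abs_mult)
    also have "\<dots> \<le> (1 - ?s) * ((1 - st n) ^ (j - m) * \<bar>x (Suc m)\<bar> + 2 * st m * D) + (2 * ?s\<^sup>2) * D"
      using step s D[of j] st2[of "Suc j"] D0 by (intro add_mono mult_mono mult_left_mono) auto
    \<comment> \<open>The contraction frees \<open>2 * ?s * st m * D\<close>, which absorbs the new
      term \<open>2 * ?s * ?s * D\<close> because \<open>?s \<le> st m\<close>.\<close>
    also have "\<dots> \<le> (1 - st n) * (1 - st n) ^ (j - m) * \<bar>x (Suc m)\<bar> + 2 * st m * D"
    proof -
      have "(1 - ?s) * ((1 - st n) ^ (j - m) * \<bar>x (Suc m)\<bar>) \<le> (1 - st n) * ((1 - st n) ^ (j - m) * \<bar>x (Suc m)\<bar>)"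
        using s by (intro mult_right_mono) auto
      moreover have "?s * ?s * D \<le> ?s * st m * D"
        using s D0 by (intro mult_right_mono mult_left_mono) auto
      ultimately show ?thesis by (simp add: algebra_simps power2_eq_square)
    qed
    also have "(1 - st n) * (1 - st n) ^ (j - m) = (1 - st n) ^ (Suc j - m)"
      using step by (simp add: Suc_diff_le)
    finally show ?case .
  qed
  from this[of n] have "\<bar>z n\<bar> \<le> (1 - st n) ^ (n - m) * \<bar>x (Suc m)\<bar> + 2 * st m * D" using mn by simp
  moreover have "\<bar>st n * (B n - B m)\<bar> \<le> st m * D"
    using st[of n] st[of m] anti[of m n] mn D[of n] by (auto simp: abs_mult intro!: mult_mono)
  ultimately show ?thesis unfolding z_def by (simp add: algebra_simps)
qed

text \<open>Early step sizes may exceed 1, so there is no contraction. The exponential bound is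
  harmless because it serves only a fixed number of initial steps.\<close>

lemma recursion_crude_bound:
  fixes x B st :: "nat \<Rightarrow> real"
  assumes rec: "\<And>t. 1 \<le> t \<Longrightarrow> t \<le> N \<Longrightarrow> x (Suc t) = (1 - st t) * x t + st t * (B t - B (t - 1))"
    and st: "\<And>t. 1 \<le> t \<Longrightarrow> t \<le> N \<Longrightarrow> 0 \<le> st t \<and> st t \<le> \<eta>"
    and D: "\<And>t. 1 \<le> t \<Longrightarrow> t \<le> N \<Longrightarrow> \<bar>B t - B (t - 1)\<bar> \<le> H"
    and x: "x 1 = 0" and n: "n \<le> N" and H: "0 \<le> H" and \<eta>: "0 \<le> \<eta>"
  shows "\<bar>x (Suc n)\<bar> \<le> H * ((1 + \<eta>) ^ n - 1)"
  using n
proof (induction n)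
  case 0
  then show ?case using x by simp
next
  case (Suc n)
  let ?s = "st (Suc n)"
  have s: "0 \<le> ?s" "?s \<le> \<eta>" using st[of "Suc n"] Suc by auto
  have "\<bar>x (Suc (Suc n))\<bar> \<le> \<bar>1 - ?s\<bar> * \<bar>x (Suc n)\<bar> + ?s * \<bar>B (Suc n) - B n\<bar>"
    using rec[of "Suc n"] Suc s abs_triangle_ineq[of "(1 - ?s) * x (Suc n)" "?s * (B (Suc n) - B n)"]
    by (simp add: abs_mult)
  also have "\<dots> \<le> (1 + \<eta>) * (H * ((1 + \<eta>) ^ n - 1)) + \<eta> * H"
    using s Suc D[of "Suc n"] \<eta> H by (intro add_mono mult_mono) auto
  finally show ?case by (simp add: algebra_simps)
qed

text \<open>Induction over \<open>n\<close> with a look back of \<open>L\<close> steps,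
  \<open>L\<close> of order \<open>n powr \<alpha>\<close>, the relaxation time. Over this window
  the old iterate is damped by \<open>exp (- 2) \<le> 1/4\<close>, while its inductive bound at
  \<open>m \<ge> n / 2\<close> is at most twice the one wanted at \<open>n\<close>; half of
  \<open>A\<close> pays for it. The walk moves by at most \<open>H * real L powr \<beta>\<close>,
  which a step size of order \<open>n powr (- \<alpha>)\<close> turns into order
  \<open>n powr (- (\<alpha> * (1 - \<beta>)))\<close>. The constant \<open>A\<close> depends
  neither on the walk nor on \<open>H\<close>, so the bound applies path by path, with the Hoelder
  constant of the path at hand.\<close>

lemma recursion_Holder_bound:
  fixes \<eta> \<alpha> \<beta> :: real
  assumes \<eta>: "0 < \<eta>" and \<alpha>: "0 < \<alpha>" "\<alpha> < 1" and \<beta>: "0 < \<beta>" "\<beta> < 1"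
  obtains A where "A \<ge> 1" and "\<And>x B H N n. x (1::nat) = (0::real) \<Longrightarrow> 0 \<le> H \<Longrightarrow>
     (\<And>t. 1 \<le> t \<Longrightarrow> t \<le> N \<Longrightarrow>
        x (Suc t) = (1 - step_size \<eta> \<alpha> t) * x t + step_size \<eta> \<alpha> t * (B t - B (t - 1))) \<Longrightarrow>
     (\<And>i j. i \<le> j \<Longrightarrow> j \<le> N \<Longrightarrow> \<bar>B j - B i\<bar> \<le> H * real (j - i) powr \<beta>) \<Longrightarrow>
     1 \<le> n \<Longrightarrow> n \<le> N \<Longrightarrow> \<bar>x (Suc n)\<bar> \<le> A * H * real n powr (- (\<alpha> * (1 - \<beta>)))"
proof -
  let ?st = "step_size \<eta> \<alpha>"
  define bb where "bb = \<alpha> * (1 - \<beta>)"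
  have bb: "0 < bb" "bb \<le> 1" using \<alpha> \<beta> by (auto simp: bb_def mult_le_one)
  \<comment> \<open>From \<open>j0\<close> on the steps are at most 1, and since
    \<open>\<alpha> < 1\<close> their relative decrease, at most \<open>1 / (j - 1)\<close>, is
    below twice the step size.\<close>
  have "\<forall>\<^sub>F j::nat in sequentially. \<eta> * real j powr (- \<alpha>) \<le> 1 \<and> 1 / (real j - 1) \<le> 2 * \<eta> * real j powr (- \<alpha>) \<and> 2 \<le> j"
    using \<eta> \<alpha> by (intro eventually_conj eventually_ge_at_top; real_asymp)
  then obtain j0 where j0: "\<And>j::nat. j0 \<le> j \<Longrightarrow> \<eta> * real j powr (- \<alpha>) \<le> 1 \<and> 1 / (real j - 1) \<le> 2 * \<eta> * real j powr (- \<alpha>) \<and> 2 \<le> j"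
    unfolding eventually_sequentially by blast
  have "\<forall>\<^sub>F n::nat in sequentially. 2 / \<eta> * real n powr \<alpha> + 1 \<le> real n / 2"
    using \<eta> \<alpha> by real_asymp
  then obtain n1 where n1: "\<And>n::nat. n1 \<le> n \<Longrightarrow> 2 / \<eta> * real n powr \<alpha> + 1 \<le> real n / 2"
    unfolding eventually_sequentially by blast
  define n0 where "n0 = max n1 (2 * j0 + 2)"
  \<comment> \<open>The first value makes the noise term \<open>6 * (2 + \<eta>) * H\<close> at most
    \<open>A / 2 * H\<close>. The second covers \<open>n \<le> n0\<close>, where
    \<open>real n powr (- bb) \<ge> 1 / real n0\<close>.\<close>
  define A where "A = max (12 * (2 + \<eta>)) ((1 + \<eta>) ^ n0 * real n0)"
  show thesis
  proof (rule that[of A])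
    show "A \<ge> 1" using \<eta> by (simp add: A_def le_max_iff_disj)
    fix x B :: "nat \<Rightarrow> real" and H :: real and N n :: nat
    assume x1: "x 1 = 0" and H: "0 \<le> H"
      and rec: "\<And>t. 1 \<le> t \<Longrightarrow> t \<le> N \<Longrightarrow> x (Suc t) = (1 - ?st t) * x t + ?st t * (B t - B (t - 1))"
      and B: "\<And>i j. i \<le> j \<Longrightarrow> j \<le> N \<Longrightarrow> \<bar>B j - B i\<bar> \<le> H * real (j - i) powr \<beta>"
      and n: "1 \<le> n" "n \<le> N"
    show "\<bar>x (Suc n)\<bar> \<le> A * H * real n powr (- (\<alpha> * (1 - \<beta>)))"
      using n
    proof (induction n rule: less_induct)
      case (less n)
      show ?case
      proof (cases "n \<le> n0")
        case True
        have "\<bar>x (Suc n)\<bar> \<le> H * ((1 + \<eta>) ^ n - 1)"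
        proof (rule recursion_crude_bound[where st = ?st and B = B])
          show "0 \<le> ?st t \<and> ?st t \<le> \<eta>" if "1 \<le> t" "t \<le> N" for t
            using step_size_pos[OF \<eta>, of t] step_size_antimono[of \<eta> \<alpha> 1 t] that \<eta> \<alpha>
            by (auto simp: step_size_def)
          show "\<bar>B t - B (t - 1)\<bar> \<le> H" if "1 \<le> t" "t \<le> N" for t
            using B[of "t - 1" t] that by auto
        qed (use rec x1 less.prems H \<eta> in auto)
        also have "\<dots> \<le> H * (A * real n powr (- bb))"
        proof (rule mult_left_mono[OF _ H])
          have "(1 + \<eta>) ^ n - 1 \<le> (1 + \<eta>) ^ n0" using True \<eta> power_increasing[of n n0 "1 + \<eta>"] by linarith
          also have "\<dots> = (1 + \<eta>) ^ n0 * 1" by simp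
          also have "\<dots> \<le> (1 + \<eta>) ^ n0 * (real n0 * real n powr (- bb))"
          proof (rule mult_left_mono)
            have "real n powr bb \<le> real n powr 1" using bb less.prems by (intro powr_mono) auto
            then have "real n powr bb \<le> real n0" using True by simp
            then show "1 \<le> real n0 * real n powr (- bb)"
              using less.prems by (simp add: powr_minus field_simps)
          qed (use \<eta> in auto)
          also have "\<dots> = ((1 + \<eta>) ^ n0 * real n0) * real n powr (- bb)" by simp
          also have "\<dots> \<le> A * real n powr (- bb)" unfolding A_def by (intro mult_right_mono) auto
          finally show "(1 + \<eta>) ^ n - 1 \<le> A * real n powr (- bb)" .
        qed
        finally show ?thesis by (simp add: bb_def mult_ac)
      next
        case False
        then have nn: "n1 \<le> n" "2 * j0 + 2 \<le> n" by (auto simp: n0_def)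
        have pn: "0 < real n" "1 \<le> real n" using nn by auto
        \<comment> \<open>Chosen so that \<open>L\<close> steps of size at least
          \<open>?st n\<close> add up to at least 2.\<close>
        define L where "L = nat \<lceil>2 / \<eta> * real n powr \<alpha>\<rceil>"
        have L: "2 / \<eta> * real n powr \<alpha> \<le> real L" "real L \<le> 2 / \<eta> * real n powr \<alpha> + 1"
          unfolding L_def using \<eta> by (auto simp: of_nat_ceiling ceiling_correct le_of_int_ceiling intro: less_imp_le)
        have Lpos: "1 \<le> L" using L(1) \<eta> pn by (cases L) (auto simp: not_le[symmetric] field_simps)
        define m where "m = n - L"
        have Ln: "real L \<le> real n / 2" using L(2) n1[OF nn(1)] by linarith
        then have m: "real n / 2 \<le> real m" "m < n" "n - m = L" using Lpos nn by (auto simp: m_def)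
        have mj: "j0 \<le> m" "1 \<le> m" using m(1) nn by linarith+
        define D where "D = H * real L powr \<beta>"
        have jm: "\<eta> * real j powr (- \<alpha>) \<le> 1" "1 / (real j - 1) \<le> 2 * \<eta> * real j powr (- \<alpha>)" "2 \<le> j"
          if "m \<le> j" for j using j0[of j] mj that by auto
        have "\<bar>x (Suc n)\<bar> \<le> (1 - ?st n) ^ (n - m) * \<bar>x (Suc m)\<bar> + 3 * ?st m * D"
        proof (rule recursion_window[where B = B])
          fix t assume t: "m < t" "t \<le> n"
          show "x (Suc t) = (1 - ?st t) * x t + ?st t * (B t - B (t - 1))"
            using rec[of t] t mj less.prems by auto
          have "real (t - 1) powr (- \<alpha>) \<le> real t powr (- \<alpha>) * (1 + 1 / (real t - 1))"
            using powr_minus_pred_le[of \<alpha> t] \<alpha> jm[of t] t by auto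
          then have 1: "?st (t - 1) \<le> ?st t * (1 + 1 / (real t - 1))"
            using \<eta> by (simp add: step_size_def mult.assoc)
          have s: "0 < ?st t" "?st t \<le> ?st (t - 1)"
            using step_size_pos[OF \<eta>, of t] step_size_antimono[of \<eta> \<alpha> "t - 1" t] t mj \<eta> \<alpha> by auto
          have t2: "2 \<le> t" using jm[of t] t by auto
          have inv: "1 / (real t - 1) \<le> 1" using t2 by auto
          have "?st t * (1 / (real t - 1)) \<le> ?st t * (2 * ?st t)"
            using jm(2)[of t] t s by (intro mult_left_mono) (auto simp: step_size_def mult.assoc)
          then have 2: "?st (t - 1) - ?st t \<le> 2 * (?st t)\<^sup>2"
            using 1 by (simp add: algebra_simps power2_eq_square)
          have "?st t * (1 + 1 / (real t - 1)) \<le> ?st t * 2"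
            using inv s by (intro mult_left_mono) auto
          then have "?st (t - 1) \<le> 2 * ?st t" using 1 by linarith
          then have "?st t * ?st (t - 1) \<le> ?st t * (2 * ?st t)"
            using s by (intro mult_left_mono) auto
          then have 3: "?st t * ?st (t - 1) \<le> 2 * (?st t)\<^sup>2"
            by (simp add: power2_eq_square)
          have "0 \<le> ?st t * ?st (t - 1)" using s by simp
          then show "\<bar>?st (t - 1) - ?st t - ?st t * ?st (t - 1)\<bar> \<le> 2 * (?st t)\<^sup>2"
            using 2 3 s by linarith
        next
          fix t assume t: "m \<le> t" "t \<le> n"
          show "0 \<le> ?st t \<and> ?st t \<le> 1"
            using jm(1)[OF t(1)] \<eta> by (auto simp: step_size_def)
          have "\<bar>B t - B m\<bar> \<le> H * real (t - m) powr \<beta>" using B[of m t] t less.prems by auto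
          also have "\<dots> \<le> D"
            unfolding D_def using t m H \<beta> by (intro mult_left_mono powr_mono2) auto
          finally show "\<bar>B t - B m\<bar> \<le> D" .
        next
          fix s t assume "m \<le> s" "s \<le> t" "t \<le> n"
          then show "?st t \<le> ?st s" using step_size_antimono[of \<eta> \<alpha> s t] \<eta> \<alpha> mj by auto
        qed (use m in auto)
        also have "(1 - ?st n) ^ (n - m) * \<bar>x (Suc m)\<bar> \<le> 1 / 4 * (A * H * (2 * real n powr (- bb)))"
        proof (rule mult_mono)
          have "(1 - ?st n) ^ L \<le> exp (- ?st n) ^ L"
            using jm(1)[of n] m exp_ge_add_one_self[of "- ?st n"]
            by (intro power_mono) (auto simp: step_size_def)
          also have "\<dots> = exp (- (real L * ?st n))" by (simp add: exp_of_nat_mult[symmetric])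
          also have "\<dots> \<le> exp (- 2)"
          proof -
            have "2 / \<eta> * real n powr \<alpha> * ?st n \<le> real L * ?st n"
              using L(1) less_imp_le[OF step_size_pos[OF \<eta>, of n]] less.prems by (intro mult_right_mono) auto
            moreover have "2 / \<eta> * real n powr \<alpha> * ?st n = 2"
              using pn \<eta> by (simp add: step_size_def powr_minus field_simps)
            ultimately show ?thesis by simp
          qed
          also have "exp (- 2 :: real) \<le> 1 / 4"
          proof -
            have "2 \<le> exp (1::real)" using exp_ge_add_one_self[of 1] by simp
            then have "2 * 2 \<le> exp (1::real) * exp 1" by (intro mult_mono) auto
            also have "\<dots> = exp 2" by (simp add: exp_add[symmetric])
            finally show ?thesis by (simp add: exp_minus field_simps)
          qed
          finally show "(1 - ?st n) ^ (n - m) \<le> 1 / 4" using m by simp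
          have "\<bar>x (Suc m)\<bar> \<le> A * H * real m powr (- bb)"
            using less.IH[of m] m mj less.prems by (simp add: bb_def)
          also have "real m powr (- bb) \<le> (real n / 2) powr (- bb)"
            using m bb pn by (intro powr_mono2') auto
          also have "\<dots> = 2 powr bb * real n powr (- bb)"
            using pn by (simp add: powr_divide powr_minus field_simps)
          also have "\<dots> \<le> 2 powr 1 * real n powr (- bb)"
            using bb by (intro mult_right_mono powr_mono) auto
          finally show "\<bar>x (Suc m)\<bar> \<le> A * H * (2 * real n powr (- bb))"
            using H \<open>A \<ge> 1\<close> by (simp add: mult_left_mono)
        qed auto
        also have "3 * ?st m * D \<le> 3 * (2 * \<eta> * real n powr (- \<alpha>)) * (H * ((2 / \<eta> + 1) * real n powr (\<alpha> * \<beta>)))"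
        proof (intro mult_mono)
          have "real m powr (- \<alpha>) \<le> (real n / 2) powr (- \<alpha>)"
            using m \<alpha> pn by (intro powr_mono2') auto
          also have "\<dots> = 2 powr \<alpha> * real n powr (- \<alpha>)"
            using pn by (simp add: powr_divide powr_minus field_simps)
          also have "\<dots> \<le> 2 powr 1 * real n powr (- \<alpha>)"
            using \<alpha> by (intro mult_right_mono powr_mono) auto
          finally show "?st m \<le> 2 * \<eta> * real n powr (- \<alpha>)" using \<eta> by (simp add: step_size_def)
          have "real L \<le> (2 / \<eta> + 1) * real n powr \<alpha>"
            using L(2) pn \<alpha> ge_one_powr_ge_zero[of "real n" \<alpha>] by (simp add: algebra_simps)
          then have "real L powr \<beta> \<le> ((2 / \<eta> + 1) * real n powr \<alpha>) powr \<beta>"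
            using \<beta> by (intro powr_mono2) auto
          also have "\<dots> = (2 / \<eta> + 1) powr \<beta> * real n powr (\<alpha> * \<beta>)"
            using \<eta> by (simp add: powr_mult powr_powr)
          also have "\<dots> \<le> (2 / \<eta> + 1) powr 1 * real n powr (\<alpha> * \<beta>)"
            using \<beta> \<eta> by (intro mult_right_mono powr_mono) auto
          finally have "real L powr \<beta> \<le> (2 / \<eta> + 1) * real n powr (\<alpha> * \<beta>)" using \<eta> by simp
          then show "D \<le> H * ((2 / \<eta> + 1) * real n powr (\<alpha> * \<beta>))"
            unfolding D_def by (rule mult_left_mono[OF _ H])
        qed (use H \<eta> in \<open>auto simp: D_def step_size_def\<close>)
        also have "\<dots> = 6 * (2 + \<eta>) * H * real n powr (- bb)"
        proof -
          have "real n powr (- bb) = real n powr (- \<alpha>) * real n powr (\<alpha> * \<beta>)"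
            by (simp add: bb_def powr_add[symmetric] algebra_simps)
          then show ?thesis using \<eta> by (simp add: field_simps)
        qed
        also have "\<dots> \<le> (A / 2) * H * real n powr (- bb)"
          using H by (intro mult_right_mono) (auto simp: A_def)
        finally show ?thesis by (simp add: bb_def)
      qed
    qed
  qed
qed

text \<open>Summation by parts: dividing the recursion by \<open>st t\<close> writes
  \<open>x t\<close> as the noise increment plus \<open>(x t - x (Suc t)) / st t\<close>. The sum on
  the left runs from \<open>x 2\<close> to \<open>x (Suc n)\<close>; as \<open>x 1 = 0\<close>, this
  shift of the index only adds the term \<open>x (Suc n)\<close>.\<close>

lemma recursion_sum_eq:
  fixes x B st :: "nat \<Rightarrow> real"
  assumes rec: "\<And>t. 1 \<le> t \<Longrightarrow> t \<le> N \<Longrightarrow> x (Suc t) = (1 - st t) * x t + st t * (B t - B (t - 1))"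
    and st: "\<And>t. 1 \<le> t \<Longrightarrow> 0 < st t" and x: "x 1 = 0" and n: "1 \<le> n" "n \<le> N"
  shows "(\<Sum>k<n. x (k + 2)) = B n - B 0 + x (Suc n) - x (Suc n) / st n +
    (\<Sum>k = 1..<n. x (Suc k) * (1 / st (Suc k) - 1 / st k))"
  using n
proof (induction n rule: dec_induct)
  case base
  then show ?case using rec[of 1] st[of 1] x by (simp add: numeral_2_eq_2)
next
  case (step n)
  have "(x (Suc n) - x (Suc (Suc n))) / st (Suc n) = x (Suc n) - (B (Suc n) - B n)"
    using rec[of "Suc n"] step st[of "Suc n"] by (simp add: field_simps)
  then show ?case using step by (simp add: algebra_simps diff_divide_distrib)
qed

text \<open>The boundary term is \<open>x (Suc N)\<close> over a step of order
  \<open>N powr (- \<alpha>)\<close>. In the remaining sum the reciprocal step size grows by at most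
  order \<open>k powr (\<alpha> - 1)\<close>, so the terms are at most of order
  \<open>N powr (\<alpha> - bb) / k\<close>, where \<open>bb \<le> \<alpha>\<close> allows
  \<open>k\<close> to be replaced by \<open>N\<close> in the power; the harmonic sum gives the
  logarithm.\<close>

lemma recursion_sum_error:
  fixes x B :: "nat \<Rightarrow> real"
  assumes \<eta>: "0 < \<eta>" and \<alpha>: "0 < \<alpha>" "\<alpha> < 1" and bb: "bb \<le> \<alpha>" and Y: "0 \<le> Y"
    and rec: "\<And>t. 1 \<le> t \<Longrightarrow> t \<le> N \<Longrightarrow>
        x (Suc t) = (1 - step_size \<eta> \<alpha> t) * x t + step_size \<eta> \<alpha> t * (B t - B (t - 1))"
    and x: "x 1 = 0" and N: "1 \<le> N"
    and bd: "\<And>n. 1 \<le> n \<Longrightarrow> n \<le> N \<Longrightarrow> \<bar>x (Suc n)\<bar> \<le> Y * real n powr (- bb)"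
  shows "\<bar>(\<Sum>k<N. x (k + 2)) - (B N - B 0)\<bar> \<le> Y * (1 + 1 / \<eta>) * real N powr (\<alpha> - bb) * (2 + ln (real N))"
proof -
  let ?st = "step_size \<eta> \<alpha>"
  have pos: "0 < ?st t" if "1 \<le> t" for t using step_size_pos[OF \<eta>, of t] that by simp
  have inv: "1 / ?st t = real t powr \<alpha> / \<eta>" if "1 \<le> t" for t
    using that \<eta> by (simp add: step_size_def powr_minus field_simps)
  have eq: "(\<Sum>k<N. x (k + 2)) - (B N - B 0) = x (Suc N) - x (Suc N) / ?st N +
    (\<Sum>k = 1..<N. x (Suc k) * (1 / ?st (Suc k) - 1 / ?st k))"
    using recursion_sum_eq[where st = ?st and B = B and x = x and N = N and n = N] rec pos x N by auto
  have N1: "1 \<le> real N powr \<alpha>" using N \<alpha> by (intro ge_one_powr_ge_zero) auto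
  have 1: "\<bar>x (Suc N) - x (Suc N) / ?st N\<bar> \<le> Y * (1 + 1 / \<eta>) * real N powr (\<alpha> - bb)"
  proof -
    have "\<bar>x (Suc N) - x (Suc N) / ?st N\<bar> \<le> \<bar>x (Suc N)\<bar> + \<bar>x (Suc N)\<bar> * (1 / ?st N)"
      using abs_triangle_ineq4[of "x (Suc N)" "x (Suc N) / ?st N"] pos[OF N] by (simp add: abs_divide)
    also have "\<dots> = \<bar>x (Suc N)\<bar> * (1 + real N powr \<alpha> / \<eta>)" using inv[OF N] by (simp add: algebra_simps)
    also have "\<dots> \<le> (Y * real N powr (- bb)) * (real N powr \<alpha> + real N powr \<alpha> / \<eta>)"
      using bd[of N] N N1 \<eta> Y by (intro mult_mono) auto
    also have "\<dots> = Y * (1 + 1 / \<eta>) * real N powr (\<alpha> - bb)"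
      using N by (simp add: powr_diff powr_minus field_simps)
    finally show ?thesis .
  qed
  have "\<bar>\<Sum>k = 1..<N. x (Suc k) * (1 / ?st (Suc k) - 1 / ?st k)\<bar> \<le>
      (\<Sum>k = 1..<N. Y * (1 / \<eta>) * real N powr (\<alpha> - bb) * (1 / real k))"
  proof (rule order_trans[OF sum_abs sum_mono])
    fix k assume k: "k \<in> {1..<N}"
    have k1: "1 \<le> k" and k2: "1 \<le> Suc k" using k by auto
    have "real (Suc k) powr \<alpha> \<le> real k powr \<alpha> * (1 + 1 / real k)"
    proof -
      have "(real (Suc k) / real k) powr \<alpha> \<le> (real (Suc k) / real k) powr 1"
        using k \<alpha> by (intro powr_mono) auto
      then show ?thesis using k by (simp add: powr_divide field_simps)
    qed
    then have d: "0 \<le> 1 / ?st (Suc k) - 1 / ?st k" "1 / ?st (Suc k) - 1 / ?st k \<le> real k powr \<alpha> / real k / \<eta>"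
      unfolding inv[OF k1] inv[OF k2] diff_divide_distrib[symmetric]
    proof -
      have "real k powr \<alpha> \<le> real (Suc k) powr \<alpha>" using \<alpha> by (intro powr_mono2) auto
      then show "0 \<le> (real (Suc k) powr \<alpha> - real k powr \<alpha>) / \<eta>" using \<eta> by (intro divide_nonneg_pos) auto
      show "(real (Suc k) powr \<alpha> - real k powr \<alpha>) / \<eta> \<le> real k powr \<alpha> / real k / \<eta>"
        using \<open>real (Suc k) powr \<alpha> \<le> real k powr \<alpha> * (1 + 1 / real k)\<close> \<eta>
        by (intro divide_right_mono) (auto simp: distrib_left)
    qed
    have "\<bar>x (Suc k) * (1 / ?st (Suc k) - 1 / ?st k)\<bar> \<le> (Y * real k powr (- bb)) * (real k powr \<alpha> / real k / \<eta>)"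
      unfolding abs_mult using d bd[of k] k Y by (intro mult_mono) auto
    also have "\<dots> = Y * (1 / \<eta>) * real k powr (\<alpha> - bb) * (1 / real k)"
      using k by (simp add: powr_diff powr_minus field_simps)
    also have "\<dots> \<le> Y * (1 / \<eta>) * real N powr (\<alpha> - bb) * (1 / real k)"
      using k bb Y \<eta> by (intro mult_right_mono mult_left_mono powr_mono2) auto
    finally show "\<bar>x (Suc k) * (1 / ?st (Suc k) - 1 / ?st k)\<bar> \<le> Y * (1 / \<eta>) * real N powr (\<alpha> - bb) * (1 / real k)" .
  qed
  also have "\<dots> = Y * (1 / \<eta>) * real N powr (\<alpha> - bb) * (\<Sum>k = 1..<N. 1 / real k)"
    by (simp add: sum_distrib_left)
  also have "\<dots> \<le> Y * (1 + 1 / \<eta>) * real N powr (\<alpha> - bb) * (1 + ln (real N))"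
  proof (rule mult_mono)
    have "(\<Sum>k = 1..<N. 1 / real k) \<le> (\<Sum>k = 1..N. 1 / real k)"
      by (rule sum_mono2) auto
    also have "\<dots> = harm N" by (simp add: harm_def inverse_eq_divide)
    also have "\<dots> \<le> 1 + ln (real N)"
      using euler_mascheroni_sequence_decreasing[of 1 N] N by (simp add: harm_def)
    finally show "(\<Sum>k = 1..<N. 1 / real k) \<le> 1 + ln (real N)" .
    show "Y * (1 / \<eta>) * real N powr (\<alpha> - bb) \<le> Y * (1 + 1 / \<eta>) * real N powr (\<alpha> - bb)"
      using Y by (intro mult_right_mono mult_left_mono) auto
  qed (use Y \<eta> in \<open>auto intro!: sum_nonneg\<close>)
  finally have "\<bar>\<Sum>k = 1..<N. x (Suc k) * (1 / ?st (Suc k) - 1 / ?st k)\<bar> \<le>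
     Y * (1 + 1 / \<eta>) * real N powr (\<alpha> - bb) * (1 + ln (real N))" .
  from order_trans[OF abs_triangle_ineq add_mono[OF 1 this]] show ?thesis
    unfolding eq by (rule order_trans) (simp add: algebra_simps add_divide_distrib)
qed

text \<open>By linearity the two solutions differ by \<open>2 * e j * st j\<close> times a product
  of contraction factors, whatever the other noise does. Over \<open>L + 1\<close> steps, at least
  one relaxation time, these differences sum to at least
  \<open>2 * \<bar>e j\<bar> * (1 - exp (- 1)) \<ge> \<bar>e j\<bar>\<close> in absolute
  value.\<close>

lemma recursion_flip_response:
  fixes x x' e e' st :: "nat \<Rightarrow> real"
  assumes rec: "\<And>t. 1 \<le> t \<Longrightarrow> x (Suc t) = (1 - st t) * x t + st t * e t"
    and rec': "\<And>t. 1 \<le> t \<Longrightarrow> x' (Suc t) = (1 - st t) * x' t + st t * e' t"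
    and x: "x 1 = x' 1" and e: "\<And>t. t \<noteq> j \<Longrightarrow> e' t = e t" "e' j = - e j"
    and j: "1 \<le> j" and st: "st j \<le> 1" "\<And>t. j \<le> t \<Longrightarrow> 0 \<le> st t \<and> st t \<le> st j"
    and L: "1 \<le> real (Suc L) * st j"
  shows "\<bar>e j\<bar> \<le> \<bar>\<Sum>i\<le>L. x (Suc (j + i)) - x' (Suc (j + i))\<bar>"
proof -
  have before: "x t = x' t" if "1 \<le> t" "t \<le> j" for t
    using that
  proof (induction t rule: dec_induct)
    case base
    then show ?case using x by simp
  next
    case (step t)
    then show ?case using rec[of t] rec'[of t] e(1)[of t] by simp
  qed
  \<comment> \<open>The share of the flip that remains after \<open>i\<close> further steps. Later
    steps are smaller, so it is at least the geometric share \<open>(1 - st j) ^ i\<close>.\<close>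
  define w where "w i = (\<Prod>k<i. 1 - st (j + Suc k))" for i
  have diff: "x (Suc (j + i)) - x' (Suc (j + i)) = 2 * e j * st j * w i" for i
  proof (induction i)
    case 0
    then show ?case using rec[of j] rec'[of j] before[of j] e j by (simp add: w_def algebra_simps)
  next
    case (Suc i)
    have "x (Suc (j + Suc i)) - x' (Suc (j + Suc i)) = (1 - st (j + Suc i)) * (x (Suc (j + i)) - x' (Suc (j + i)))"
      using rec[of "j + Suc i"] rec'[of "j + Suc i"] e(1)[of "j + Suc i"] j by (simp add: algebra_simps)
    then show ?case using Suc by (simp add: w_def)
  qed
  have w: "(1 - st j) ^ i \<le> w i" for i
  proof (induction i)
    case (Suc i)
    have "0 \<le> 1 - st j" "1 - st j \<le> 1 - st (j + Suc i)" using st by auto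
    then have "(1 - st j) ^ i * (1 - st j) \<le> w i * (1 - st (j + Suc i))"
      using Suc st by (intro mult_mono order_trans[OF zero_le_power Suc]) auto
    then show ?case by (simp add: w_def mult.commute)
  qed (simp add: w_def)
  have s0: "0 < st j" using L st(2)[of j] by (cases "st j = 0") auto
  have "1 / 2 \<le> 1 - (1 - st j) ^ Suc L"
  proof -
    have "(1 - st j) ^ Suc L \<le> exp (- st j) ^ Suc L"
      using st exp_ge_add_one_self[of "- st j"] by (intro power_mono) auto
    also have "\<dots> = exp (- (real (Suc L) * st j))" by (simp only: exp_of_nat_mult[symmetric] mult_minus_right)
    also have "\<dots> \<le> exp (- 1)" using L by simp
    also have "\<dots> \<le> 1 / 2" using exp_ge_add_one_self[of 1] by (simp add: exp_minus field_simps)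
    finally show ?thesis by simp
  qed
  also have "\<dots> = (\<Sum>i\<le>L. st j * (1 - st j) ^ i)"
    using s0 by (simp add: sum_distrib_left[symmetric] sum_gp0)
  also have "\<dots> \<le> (\<Sum>i\<le>L. st j * w i)"
    using w s0 by (intro sum_mono mult_left_mono) auto
  finally have "2 * \<bar>e j\<bar> * (1 / 2) \<le> 2 * \<bar>e j\<bar> * (\<Sum>i\<le>L. st j * w i)"
    by (intro mult_left_mono) auto
  moreover have "0 \<le> (\<Sum>i\<le>L. st j * w i)"
    using s0 w st by (intro sum_nonneg mult_nonneg_nonneg order_trans[OF _ w]) auto
  moreover have "(\<Sum>i\<le>L. x (Suc (j + i)) - x' (Suc (j + i))) = 2 * e j * (\<Sum>i\<le>L. st j * w i)"
    by (simp add: diff sum_distrib_left mult.assoc)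
  ultimately show ?thesis by (simp add: abs_mult)
qed

section \<open>Gaussian estimates and moduli of continuity\<close>

text \<open>On either tail the density is at most \<open>exp (- y\<^sup>2 / 2)\<close> times the
  normal density recentred at the threshold, and the latter integrates to 1.\<close>

lemma normal_tail:
  assumes P: "prob_space P" and X: "distributed P lborel X (normal_density 0 \<sigma>)"
    and \<sigma>: "0 < \<sigma>" and y: "0 \<le> y"
  shows "measure P {\<omega>\<in>space P. y * \<sigma> < \<bar>X \<omega>\<bar>} \<le> 2 * exp (- y\<^sup>2 / 2)"
proof -
  interpret prob_space P by fact
  have Xm [measurable]: "X \<in> borel_measurable P"
    using distributed_measurable[OF X] by simp
  have one: "measure P (X -` A \<inter> space P) \<le> exp (- y\<^sup>2 / 2)"
    if A: "A \<in> sets borel" and s: "s = 1 \<or> s = - 1" and sA: "\<And>x. x \<in> A \<Longrightarrow> y * \<sigma> \<le> s * x" for A and s :: real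
  proof -
    have "emeasure P (X -` A \<inter> space P) = (\<integral>\<^sup>+x. ennreal (normal_density 0 \<sigma> x) * indicator A x \<partial>lborel)"
      using distributed_emeasure[OF X] A by simp
    also have "\<dots> \<le> (\<integral>\<^sup>+x. ennreal (exp (- y\<^sup>2 / 2)) * ennreal (normal_density (s * y * \<sigma>) \<sigma> x) \<partial>lborel)"
    proof (rule nn_integral_mono)
      fix x
      show "ennreal (normal_density 0 \<sigma> x) * indicator A x \<le> ennreal (exp (- y\<^sup>2 / 2)) * ennreal (normal_density (s * y * \<sigma>) \<sigma> x)"
      proof (cases "x \<in> A")
        case True
        have "0 \<le> 2 * (y * \<sigma>) * (s * x - y * \<sigma>)" using sA[OF True] y \<sigma> by (intro mult_nonneg_nonneg) auto
        moreover have "s * s = 1" using s by auto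
        then have "(x - s * y * \<sigma>)\<^sup>2 + (y * \<sigma>)\<^sup>2 = x\<^sup>2 - 2 * (y * \<sigma>) * (s * x - y * \<sigma>)"
          by (simp add: power2_eq_square algebra_simps)
        ultimately have "(y * \<sigma>)\<^sup>2 + (x - s * y * \<sigma>)\<^sup>2 \<le> x\<^sup>2" by linarith
        then have "((y * \<sigma>)\<^sup>2 + (x - s * y * \<sigma>)\<^sup>2) / (2 * \<sigma>\<^sup>2) \<le> x\<^sup>2 / (2 * \<sigma>\<^sup>2)"
          by (intro divide_right_mono) auto
        then have "y\<^sup>2 / 2 + (x - s * y * \<sigma>)\<^sup>2 / (2 * \<sigma>\<^sup>2) \<le> x\<^sup>2 / (2 * \<sigma>\<^sup>2)"
          using \<sigma> by (simp add: add_divide_distrib power_mult_distrib)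
        then have "exp (- x\<^sup>2 / (2 * \<sigma>\<^sup>2)) \<le> exp (- y\<^sup>2 / 2 + - (x - s * y * \<sigma>)\<^sup>2 / (2 * \<sigma>\<^sup>2))" by simp
        also have "\<dots> = exp (- y\<^sup>2 / 2) * exp (- (x - s * y * \<sigma>)\<^sup>2 / (2 * \<sigma>\<^sup>2))" by (rule exp_add)
        finally have "normal_density 0 \<sigma> x \<le> exp (- y\<^sup>2 / 2) * normal_density (s * y * \<sigma>) \<sigma> x"
          unfolding normal_density_def by (simp add: divide_right_mono)
        then show ?thesis using True by (simp add: ennreal_mult'[symmetric] ennreal_leI)
      qed simp
    qed
    also have "\<dots> = ennreal (exp (- y\<^sup>2 / 2)) * (\<integral>\<^sup>+x. ennreal (normal_density (s * y * \<sigma>) \<sigma> x) \<partial>lborel)"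
      by (rule nn_integral_cmult) simp
    also have "(\<integral>\<^sup>+x. ennreal (normal_density (s * y * \<sigma>) \<sigma> x) \<partial>lborel) = 1"
      using \<sigma> by (subst nn_integral_eq_integral) auto
    finally show ?thesis by (simp add: emeasure_eq_measure)
  qed
  have "{\<omega>\<in>space P. y * \<sigma> < \<bar>X \<omega>\<bar>} = (X -` {y * \<sigma><..} \<inter> space P) \<union> (X -` {..<- (y * \<sigma>)} \<inter> space P)"
    by (auto simp: abs_less_iff not_less abs_real_def)
  also have "measure P \<dots> \<le> measure P (X -` {y * \<sigma><..} \<inter> space P) + measure P (X -` {..<- (y * \<sigma>)} \<inter> space P)"
    by (rule measure_Un_le) measurable
  also have "\<dots> \<le> exp (- y\<^sup>2 / 2) + exp (- y\<^sup>2 / 2)"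
    using one[of "{y * \<sigma><..}" 1] one[of "{..<- (y * \<sigma>)}" "- 1"] by (intro add_mono) auto
  finally show ?thesis by simp
qed

lemma distributed_interval_ge:
  assumes P: "prob_space P" and X: "distributed P lborel X (\<lambda>x. ennreal (f x))"
    and ab: "a \<le> b" and c: "\<And>x. a \<le> x \<Longrightarrow> x \<le> b \<Longrightarrow> c \<le> f x" "0 \<le> c"
  shows "c * (b - a) \<le> measure P {\<omega>\<in>space P. a \<le> X \<omega> \<and> X \<omega> \<le> b}"
proof -
  interpret prob_space P by fact
  have eq: "{\<omega>\<in>space P. a \<le> X \<omega> \<and> X \<omega> \<le> b} = X -` {a..b} \<inter> space P" by auto
  have "ennreal (c * (b - a)) = (\<integral>\<^sup>+x. ennreal c * indicator {a..b} x \<partial>lborel)"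
    using ab c by (simp add: nn_integral_cmult_indicator ennreal_mult')
  also have "\<dots> \<le> (\<integral>\<^sup>+x. ennreal (f x) * indicator {a..b} x \<partial>lborel)"
    using c by (intro nn_integral_mono) (auto split: split_indicator intro!: ennreal_leI)
  also have "\<dots> = emeasure P (X -` {a..b} \<inter> space P)"
    using distributed_emeasure[OF X, of "{a..b}"] by simp
  finally show ?thesis unfolding eq by (simp add: emeasure_eq_measure)
qed

lemma distributed_interval_le:
  assumes P: "prob_space P" and X: "distributed P lborel X (\<lambda>x. ennreal (f x))"
    and ab: "a \<le> b" and c: "\<And>x. a \<le> x \<Longrightarrow> x \<le> b \<Longrightarrow> f x \<le> c" "0 \<le> c"
  shows "measure P {\<omega>\<in>space P. a \<le> X \<omega> \<and> X \<omega> \<le> b} \<le> c * (b - a)"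
proof -
  interpret prob_space P by fact
  have eq: "{\<omega>\<in>space P. a \<le> X \<omega> \<and> X \<omega> \<le> b} = X -` {a..b} \<inter> space P" by auto
  have "emeasure P (X -` {a..b} \<inter> space P) = (\<integral>\<^sup>+x. ennreal (f x) * indicator {a..b} x \<partial>lborel)"
    using distributed_emeasure[OF X, of "{a..b}"] by simp
  also have "\<dots> \<le> (\<integral>\<^sup>+x. ennreal c * indicator {a..b} x \<partial>lborel)"
    using c by (intro nn_integral_mono) (auto split: split_indicator intro!: ennreal_leI)
  also have "\<dots> = ennreal (c * (b - a))"
    using ab c by (simp add: nn_integral_cmult_indicator ennreal_mult')
  finally show ?thesis unfolding eq using ab c by (simp add: emeasure_eq_measure)
qed

lemma normal_density_ge:
  assumes "\<bar>x\<bar> \<le> y" "0 < \<sigma>"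
  shows "normal_density 0 \<sigma> y \<le> normal_density 0 \<sigma> x"
proof -
  have "x\<^sup>2 \<le> y\<^sup>2" using assms(1) by (metis abs_ge_zero order_trans power2_abs power_mono)
  then show ?thesis using assms(2) by (simp add: normal_density_def divide_right_mono)
qed

lemma normal_density_le:
  assumes "0 < \<sigma>"
  shows "normal_density 0 \<sigma> x \<le> 1 / (2 * \<sigma>)"
proof -
  have "2 * \<sigma> = sqrt (4 * \<sigma>\<^sup>2)" using assms by (simp add: real_sqrt_mult)
  also have "\<dots> \<le> sqrt (2 * pi * \<sigma>\<^sup>2)" using pi_gt3 by (intro real_sqrt_le_mono mult_right_mono) auto
  finally have 1: "2 * \<sigma> \<le> sqrt (2 * pi * \<sigma>\<^sup>2)" .
  have "normal_density 0 \<sigma> x \<le> 1 / sqrt (2 * pi * \<sigma>\<^sup>2) * 1"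
    unfolding normal_density_def using assms by (intro mult_left_mono) (auto simp: divide_nonpos_nonneg)
  also have "\<dots> \<le> 1 / (2 * \<sigma>)" using 1 assms by (simp add: frac_le)
  finally show ?thesis .
qed

lemma normal_even_moment:
  assumes "prob_space P" "distributed P lborel X (normal_density 0 \<sigma>)" "0 < \<sigma>"
  shows "integrable P (\<lambda>\<omega>. X \<omega> ^ (2 * l))"
    "(\<integral>\<omega>. X \<omega> ^ (2 * l) \<partial>P) = fact (2 * l) / (2 ^ l * fact l) * (\<sigma>\<^sup>2) ^ l"
proof -
  interpret prob_space P by fact
  have "integrable lborel (\<lambda>x. normal_density 0 \<sigma> x * x ^ (2 * l))"
    using integrable_normal_moment[OF assms(3), of 0 "2 * l"] by simp
  then show "integrable P (\<lambda>\<omega>. X \<omega> ^ (2 * l))"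
    using distributed_integrable[OF assms(2), of "\<lambda>x. x ^ (2 * l)"] by simp
  have "(\<integral>\<omega>. X \<omega> ^ (2 * l) \<partial>P) = (\<integral>x. normal_density 0 \<sigma> x * x ^ (2 * l) \<partial>lborel)"
    using distributed_integral[OF assms(2), of "\<lambda>x. x ^ (2 * l)"] by simp
  also have "\<dots> = fact (2 * l) / ((2 / \<sigma>\<^sup>2) ^ l * fact l)"
    using integral_normal_moment_even[OF assms(3), of 0 l] by simp
  finally show "(\<integral>\<omega>. X \<omega> ^ (2 * l) \<partial>P) = fact (2 * l) / (2 ^ l * fact l) * (\<sigma>\<^sup>2) ^ l"
    by (simp add: power_divide)
qed

text \<open>The chaining constant: one step of level \<open>n\<close> between dyadic neighbours, and
  two geometric series of ratio \<open>2 powr (- \<beta>)\<close> leading to the two end points. The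
  factor \<open>2 powr \<beta>\<close> comes from
  \<open>\<bar>t - s\<bar> > 1 / 2 ^ Suc n\<close>.\<close>

definition Holder_const :: "real \<Rightarrow> real" where
  "Holder_const \<beta> = 2 powr \<beta> * (1 + 2 / (1 - 2 powr (- \<beta>)))"

lemma Holder_const_pos: "0 < \<beta> \<Longrightarrow> 0 < Holder_const \<beta>"
  using powr_less_mono[of "- \<beta>" 0 2]
  by (auto simp: Holder_const_def intro!: mult_pos_pos add_pos_nonneg)

text \<open>Chaining: each point is the limit of its dyadic approximations from below, and
  consecutive approximations are equal or adjacent points of the finer grid. At the level
  \<open>n\<close> with \<open>1 / 2 ^ Suc n < t - s \<le> 1 / 2 ^ n\<close> the approximations of
  \<open>s\<close> and \<open>t\<close> coincide or are adjacent.\<close>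

lemma dyadic_Holder:
  fixes f :: "real \<Rightarrow> real"
  assumes c: "continuous_on {0..1} f" and \<beta>: "0 < \<beta>" and D: "0 \<le> D"
    and dy: "\<And>n k. k < 2 ^ n \<Longrightarrow> \<bar>f (real (Suc k) / 2 ^ n) - f (real k / 2 ^ n)\<bar> \<le> D * (2 powr (- \<beta>)) ^ n"
    and s: "s \<in> {0..1}" and t: "t \<in> {0..1}"
  shows "\<bar>f t - f s\<bar> \<le> D * Holder_const \<beta> * \<bar>t - s\<bar> powr \<beta>"
proof -
  define r :: real where "r = 2 powr (- \<beta>)"
  have r: "0 < r" "r < 1" using \<beta> by (auto simp: r_def powr_minus field_simps)
  define fl where "fl u n = nat \<lfloor>2 ^ n * u\<rfloor>" for u :: real and n :: nat
  define ap where "ap u n = real (fl u n) / 2 ^ n" for u n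
  have fl: "real (fl u n) \<le> 2 ^ n * u" "2 ^ n * u < real (fl u n) + 1" if "u \<in> {0..1}" for u n
    using that by (auto simp: fl_def)
  have ap: "ap u n \<le> u" "u - ap u n \<le> 1 / 2 ^ n" "ap u n \<in> {0..1}" if "u \<in> {0..1}" for u n
  proof -
    show 1: "ap u n \<le> u" using fl[OF that, of n] by (simp add: ap_def field_simps)
    have "(2 ^ n * u - real (fl u n)) / 2 ^ n \<le> 1 / 2 ^ n"
      using fl[OF that, of n] by (intro divide_right_mono) auto
    then show "u - ap u n \<le> 1 / 2 ^ n" by (simp add: ap_def diff_divide_distrib)
    have "0 \<le> ap u n" by (simp add: ap_def)
    then show "ap u n \<in> {0..1}" using 1 that by auto
  qed
  have step: "\<bar>f (ap u (Suc n)) - f (ap u n)\<bar> \<le> D * r ^ n" if u: "u \<in> {0..1}" for u n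
  proof -
    have "fl u (Suc n) = 2 * fl u n \<or> fl u (Suc n) = 2 * fl u n + 1"
      using fl[OF u, of n] fl[OF u, of "Suc n"] by simp linarith
    then show ?thesis
    proof
      assume "fl u (Suc n) = 2 * fl u n"
      then have "ap u (Suc n) = ap u n" by (simp add: ap_def)
      then show ?thesis using D r by simp
    next
      assume 1: "fl u (Suc n) = 2 * fl u n + 1"
      have "real (fl u (Suc n)) \<le> 2 ^ Suc n * u" using fl[OF u, of "Suc n"] by simp
      also have "\<dots> \<le> 2 ^ Suc n" using u by (simp add: mult_left_le)
      finally have "fl u (Suc n) \<le> 2 ^ Suc n" by (metis of_nat_le_iff of_nat_numeral of_nat_power)
      then have lt: "2 * fl u n < 2 ^ Suc n" using 1 by linarith
      have "ap u (Suc n) = real (Suc (2 * fl u n)) / 2 ^ Suc n" "ap u n = real (2 * fl u n) / 2 ^ Suc n"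
        using 1 by (auto simp: ap_def)
      then have "\<bar>f (ap u (Suc n)) - f (ap u n)\<bar> \<le> D * r ^ Suc n"
        using dy[OF lt] by (simp add: r_def)
      also have "\<dots> \<le> D * r ^ n" using r D by (intro mult_left_mono power_decreasing) auto
      finally show ?thesis .
    qed
  qed
  have chain: "\<bar>f (ap u (n + k)) - f (ap u n)\<bar> \<le> D * (r ^ n - r ^ (n + k)) / (1 - r)" if u: "u \<in> {0..1}" for u n k
  proof (induction k)
    case (Suc k)
    have "\<bar>f (ap u (n + Suc k)) - f (ap u n)\<bar> \<le> D * r ^ (n + k) + D * (r ^ n - r ^ (n + k)) / (1 - r)"
      using Suc step[OF u, of "n + k"] by simp
    also have "\<dots> = D * (r ^ n - r ^ (n + Suc k)) / (1 - r)" using r by (simp add: field_simps)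
    finally show ?case .
  qed simp
  have lim: "\<bar>f u - f (ap u n)\<bar> \<le> D * r ^ n / (1 - r)" if u: "u \<in> {0..1}" for u n
  proof (rule LIMSEQ_le_const2)
    have "(\<lambda>k. ap u (n + k)) \<longlonglongrightarrow> u"
    proof (rule LIMSEQ_I)
      fix e :: real assume "0 < e"
      then obtain k0 where k0: "(1 / 2) ^ k0 < e" using real_arch_pow_inv[of e "1 / 2"] by auto
      show "\<exists>no. \<forall>k\<ge>no. norm (ap u (n + k) - u) < e"
      proof (intro exI[of _ k0] allI impI)
        fix k assume "k0 \<le> k"
        then have "(1 / 2 :: real) ^ (n + k) \<le> (1 / 2) ^ k0" by (intro power_decreasing) auto
        then show "norm (ap u (n + k) - u) < e"
          using ap[OF u, of "n + k"] k0 by (simp add: power_one_over)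
      qed
    qed
    then have "(\<lambda>k. f (ap u (n + k))) \<longlonglongrightarrow> f u"
      by (rule continuous_on_tendsto_compose[OF c]) (use u ap(3)[OF u] in auto)
    then show "(\<lambda>k. \<bar>f (ap u (n + k)) - f (ap u n)\<bar>) \<longlonglongrightarrow> \<bar>f u - f (ap u n)\<bar>"
      by (intro tendsto_intros)
    have "D * (r ^ n - r ^ (n + k)) / (1 - r) \<le> D * r ^ n / (1 - r)" for k
      using r D by (intro divide_right_mono mult_left_mono) auto
    then show "\<exists>N. \<forall>k\<ge>N. \<bar>f (ap u (n + k)) - f (ap u n)\<bar> \<le> D * r ^ n / (1 - r)"
      using chain[OF u, of n] order_trans by blast
  qed
  have main: "\<bar>f t - f s\<bar> \<le> D * Holder_const \<beta> * \<bar>t - s\<bar> powr \<beta>"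
    if s: "s \<in> {0..1}" and t: "t \<in> {0..1}" and st: "s < t" for s t
  proof -
    have "\<exists>n. 1 / 2 ^ Suc n < t - s"
    proof -
      obtain k where k: "(1 / 2) ^ k < t - s" using real_arch_pow_inv[of "t - s" "1 / 2"] st by auto
      have "(1 / 2 :: real) ^ Suc k \<le> (1 / 2) ^ k" by (intro power_decreasing) auto
      then have "1 / 2 ^ Suc k < t - s" using k by (simp only: power_one_over)
      then show ?thesis by blast
    qed
    then obtain n where n: "1 / 2 ^ Suc n < t - s" "\<And>k. k < n \<Longrightarrow> \<not> 1 / 2 ^ Suc k < t - s"
      using exists_least_iff[of "\<lambda>n. 1 / 2 ^ Suc n < t - s"] by blast
    have up: "t - s \<le> 1 / 2 ^ n"
    proof (cases n)
      case 0
      then show ?thesis using s t by simp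
    next
      case (Suc m)
      then show ?thesis using n(2)[of m] by simp
    qed
    then have "2 ^ n * t - 2 ^ n * s \<le> 1" by (simp add: field_simps)
    moreover have "2 ^ n * s \<le> 2 ^ n * t" using st by simp
    ultimately have "fl t n = fl s n \<or> fl t n = Suc (fl s n)"
      using fl[OF s, of n] fl[OF t, of n] by linarith
    then have mid: "\<bar>f (ap t n) - f (ap s n)\<bar> \<le> D * r ^ n"
    proof
      assume "fl t n = fl s n"
      then show ?thesis using D r by (simp add: ap_def)
    next
      assume 1: "fl t n = Suc (fl s n)"
      have "real (fl t n) \<le> 2 ^ n * t" using fl[OF t, of n] by simp
      also have "\<dots> \<le> 2 ^ n" using t by (simp add: mult_left_le)
      finally have "fl t n \<le> 2 ^ n" by (metis of_nat_le_iff of_nat_numeral of_nat_power)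
      then have "fl s n < 2 ^ n" using 1 by simp
      from dy[OF this] show ?thesis using 1 by (simp add: ap_def r_def)
    qed
    have "\<bar>f t - f s\<bar> \<le> D * r ^ n / (1 - r) + D * r ^ n + D * r ^ n / (1 - r)"
      using lim[OF s, of n] lim[OF t, of n] mid by linarith
    also have "\<dots> = D * (1 + 2 / (1 - r)) * r ^ n" by (simp add: algebra_simps)
    also have "\<dots> \<le> D * (1 + 2 / (1 - r)) * (2 powr \<beta> * (t - s) powr \<beta>)"
    proof (rule mult_left_mono)
      have "2 * (1 / 2 ^ Suc n) = (2::real) powr (- real n)"
        by (simp add: inverse_eq_divide powr_minus powr_realpow)
      moreover have "r ^ n = r powr real n" using r by (simp add: powr_realpow)
      ultimately have "r ^ n = (2 * (1 / 2 ^ Suc n)) powr \<beta>"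
        by (simp add: r_def powr_powr mult.commute)
      also have "\<dots> = 2 powr \<beta> * (1 / 2 ^ Suc n) powr \<beta>" by (rule powr_mult) 
      also have "\<dots> \<le> 2 powr \<beta> * (t - s) powr \<beta>"
        using n(1) \<beta> by (intro mult_left_mono powr_mono2) auto
      finally show "r ^ n \<le> 2 powr \<beta> * (t - s) powr \<beta>" .
    qed (use r D in auto)
    finally show ?thesis using st by (simp add: Holder_const_def r_def mult_ac)
  qed
  consider "s < t" | "s = t" | "t < s" by linarith
  then show ?thesis
  proof cases
    case 1 then show ?thesis using main s t by blast
  next
    case 2 then show ?thesis by simp
  next
    case 3 then show ?thesis using main[of t s] s t by (simp add: abs_minus_commute)
  qed
qed

text \<open>Markov's inequality for the moment of order \<open>2 * l\<close> and a union bound over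
  the \<open>2 ^ n\<close> dyadic increments give a geometric series in \<open>n\<close>; the
  condition on \<open>l\<close> makes its ratio less than 1. The exceptional set is delivered as one
  measurable event, so no supremum of the process has to be shown measurable. The power of
  \<open>D\<close> in its probability is explicit because \<open>D\<close> will depend on
  \<open>T\<close>.\<close>

lemma Kolmogorov_Chentsov:
  fixes X :: "real \<Rightarrow> 'w \<Rightarrow> real"
  assumes P: "prob_space P" and c: "\<And>\<omega>. \<omega> \<in> space P \<Longrightarrow> continuous_on {0..1} (\<lambda>t. X t \<omega>)"
    and m: "\<And>t. t \<in> {0..1} \<Longrightarrow> X t \<in> borel_measurable P"
    and mom: "\<And>s t. 0 \<le> s \<Longrightarrow> s < t \<Longrightarrow> t \<le> 1 \<Longrightarrow> integrable P (\<lambda>\<omega>. (X t \<omega> - X s \<omega>) ^ (2 * l))"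
      "\<And>s t. 0 \<le> s \<Longrightarrow> s < t \<Longrightarrow> t \<le> 1 \<Longrightarrow> (\<integral>\<omega>. (X t \<omega> - X s \<omega>) ^ (2 * l) \<partial>P) \<le> K * (t - s) ^ l"
    and \<beta>: "0 < \<beta>" and l: "1 < real l * (1 - 2 * \<beta>)" and D: "0 < D"
  obtains bad where "bad \<in> sets P"
    "measure P bad \<le> K / (1 - 2 powr (1 - real l * (1 - 2 * \<beta>))) / D ^ (2 * l)"
    "\<And>\<omega> s t. \<omega> \<in> space P \<Longrightarrow> \<omega> \<notin> bad \<Longrightarrow> s \<in> {0..1} \<Longrightarrow> t \<in> {0..1} \<Longrightarrow>
       \<bar>X t \<omega> - X s \<omega>\<bar> \<le> D * Holder_const \<beta> * \<bar>t - s\<bar> powr \<beta>"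
proof -
  interpret prob_space P by fact
  define r :: real where "r = 2 powr (- \<beta>)"
  have r: "0 < r" by (auto simp: r_def)
  define g :: real where "g = 2 powr (1 - real l * (1 - 2 * \<beta>))"
  have g: "0 < g" "g < 1" using l powr_less_mono[of "1 - real l * (1 - 2 * \<beta>)" 0 2] by (auto simp: g_def)
  define E where "E n k = {\<omega>\<in>space P. D * r ^ n < \<bar>X (real (Suc k) / 2 ^ n) \<omega> - X (real k / 2 ^ n) \<omega>\<bar>}" for n k
  define F where "F n = (\<Union>k<2 ^ n. E n k)" for n :: nat
  have E: "E n k \<in> sets P \<and> measure P (E n k) \<le> K * (1 / 2 ^ n) ^ l / (D * r ^ n) ^ (2 * l)" if k: "k < 2 ^ n" for n k
  proof -
    let ?s = "real k / 2 ^ n" and ?t = "real (Suc k) / 2 ^ n"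
    have "real (Suc k) \<le> real (2 ^ n)" using k by (simp only: of_nat_le_iff Suc_le_eq)
    then have "real (Suc k) \<le> 2 ^ n" by simp
    then have st: "0 \<le> ?s" "?s < ?t" "?t \<le> 1" by (auto simp: divide_less_cancel divide_le_eq_1)
    have "?s \<in> {0..1}" "?t \<in> {0..1}" unfolding atLeastAtMost_iff using st by linarith+
    then have [measurable]: "X ?s \<in> borel_measurable P" "X ?t \<in> borel_measurable P" by (simp_all only: m)
    have sets: "E n k \<in> sets P" unfolding E_def by measurable
    have pos: "0 < D * r ^ n" using D r by simp
    have "measure P (E n k) \<le> measure P {\<omega>\<in>space P. (D * r ^ n) ^ (2 * l) \<le> (X ?t \<omega> - X ?s \<omega>) ^ (2 * l)}"
    proof (rule finite_measure_mono)
      show "E n k \<subseteq> {\<omega>\<in>space P. (D * r ^ n) ^ (2 * l) \<le> (X ?t \<omega> - X ?s \<omega>) ^ (2 * l)}"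
      proof
        fix \<omega> assume \<omega>: "\<omega> \<in> E n k"
        then have "(D * r ^ n) ^ (2 * l) \<le> \<bar>X ?t \<omega> - X ?s \<omega>\<bar> ^ (2 * l)"
          using pos by (intro power_mono) (auto simp: E_def)
        then show "\<omega> \<in> {\<omega>\<in>space P. (D * r ^ n) ^ (2 * l) \<le> (X ?t \<omega> - X ?s \<omega>) ^ (2 * l)}"
          using \<omega> by (simp add: E_def power_even_abs)
      qed
    qed measurable
    also have "\<dots> \<le> (\<integral>\<omega>. (X ?t \<omega> - X ?s \<omega>) ^ (2 * l) \<partial>P) / (D * r ^ n) ^ (2 * l)"
      using mom(1)[OF st] pos by (intro integral_Markov_inequality_measure[where A = "{}"]) auto
    also have "\<dots> \<le> K * (?t - ?s) ^ l / (D * r ^ n) ^ (2 * l)"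
      using mom(2)[OF st] pos by (intro divide_right_mono) auto
    also have "?t - ?s = 1 / 2 ^ n" by (simp add: field_simps)
    finally show ?thesis using sets by simp
  qed
  have gn: "2 ^ n * (K * (1 / 2 ^ n) ^ l / (D * r ^ n) ^ (2 * l)) = K / D ^ (2 * l) * g ^ n" for n
  proof -
    have "g = 2 * (1 / 2) ^ l / r ^ (2 * l)"
    proof -
      have "2 * (1 / 2) ^ l / r ^ (2 * l) = 2 powr 1 * 2 powr (- real l) / 2 powr (- (\<beta> * real (2 * l)))"
        by (simp add: r_def powr_minus powr_realpow[symmetric] powr_powr power_one_over inverse_eq_divide)
      also have "\<dots> = 2 powr (1 + - real l - - (\<beta> * real (2 * l)))"
        by (simp only: powr_add[symmetric] powr_diff[symmetric])
      also have "\<dots> = g" unfolding g_def by (simp add: algebra_simps)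
      finally show ?thesis by simp
    qed
    then show ?thesis
      by (simp add: power_mult_distrib power_divide power_mult[symmetric] mult.commute mult.left_commute)
  qed
  have F: "F n \<in> sets P" "measure P (F n) \<le> K / D ^ (2 * l) * g ^ n" for n
  proof -
    show "F n \<in> sets P" unfolding F_def using E by (intro sets.finite_UN) auto
    have "measure P (F n) \<le> (\<Sum>k<2 ^ n. measure P (E n k))"
      unfolding F_def using E by (intro finite_measure_subadditive_finite) auto
    also have "\<dots> \<le> (\<Sum>k<(2::nat) ^ n. K * (1 / 2 ^ n) ^ l / (D * r ^ n) ^ (2 * l))"
      using E by (intro sum_mono) auto
    also have "\<dots> = K / D ^ (2 * l) * g ^ n" using gn[of n] by simp
    finally show "measure P (F n) \<le> K / D ^ (2 * l) * g ^ n" .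
  qed
  have sg: "summable (\<lambda>n. K / D ^ (2 * l) * g ^ n)"
    using g by (intro summable_mult summable_geometric) auto
  have sF: "summable (\<lambda>n. measure P (F n))"
    by (rule summable_comparison_test'[OF sg, of 0]) (use F in auto)
  show thesis
  proof (rule that[of "\<Union>n. F n"])
    show "(\<Union>n. F n) \<in> sets P" using F by auto
    have "measure P (\<Union>n. F n) \<le> (\<Sum>n. measure P (F n))"
      using F sF by (intro finite_measure_subadditive_countably) auto
    also have "\<dots> \<le> (\<Sum>n. K / D ^ (2 * l) * g ^ n)"
      using F sF sg by (intro suminf_le) auto
    also have "\<dots> = K / D ^ (2 * l) * (1 / (1 - g))"
      using g by (subst suminf_mult) (auto simp: suminf_geometric intro: summable_geometric)
    finally show "measure P (\<Union>n. F n) \<le> K / (1 - 2 powr (1 - real l * (1 - 2 * \<beta>))) / D ^ (2 * l)"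
      by (simp add: g_def mult.commute)
    fix \<omega> and s t :: real assume \<omega>: "\<omega> \<in> space P" "\<omega> \<notin> (\<Union>n. F n)" and st: "s \<in> {0..1}" "t \<in> {0..1}"
    show "\<bar>X t \<omega> - X s \<omega>\<bar> \<le> D * Holder_const \<beta> * \<bar>t - s\<bar> powr \<beta>"
    proof (rule dyadic_Holder[OF c[OF \<omega>(1)] \<beta> _ _ st])
      fix n k :: nat assume "k < 2 ^ n"
      then show "\<bar>X (real (Suc k) / 2 ^ n) \<omega> - X (real k / 2 ^ n) \<omega>\<bar> \<le> D * (2 powr (- \<beta>)) ^ n"
        using \<omega> by (auto simp: F_def E_def r_def not_less)
    qed (use D in auto)
  qed
qed

definition Brownian_tail_const :: "real \<Rightarrow> nat \<Rightarrow> real" where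
  "Brownian_tail_const \<beta> l = fact (2 * l) / (2 ^ l * fact l) / (1 - 2 powr (1 - real l * (1 - 2 * \<beta>)))"

lemma Brownian_tail_const_pos: "1 < real l * (1 - 2 * \<beta>) \<Longrightarrow> 0 < Brownian_tail_const \<beta> l"
  using powr_less_mono[of "1 - real l * (1 - 2 * \<beta>)" 0 2] by (auto simp: Brownian_tail_const_def)

text \<open>Brownian scaling reduces \<open>[0, N]\<close> to \<open>[0, 1]\<close> and produces the
  factor \<open>N powr (1/2 - \<beta>)\<close>. Letting \<open>D\<close> grow like a small power of
  \<open>T\<close> makes the exceptional probability smaller than any given power of
  \<open>T\<close> once \<open>l\<close> is large.\<close>

lemma Brownian_Holder:
  assumes W: "standard_brownian_motion_on I P W" and N: "0 < (N::real)" "{0..N} \<subseteq> I"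
    and \<beta>: "0 < \<beta>" and l: "1 < real l * (1 - 2 * \<beta>)" and D: "0 < D"
  obtains bad where "bad \<in> sets P"
    "measure P bad \<le> Brownian_tail_const \<beta> l / D ^ (2 * l)"
    "\<And>\<omega> s t. \<omega> \<in> space P \<Longrightarrow> \<omega> \<notin> bad \<Longrightarrow> s \<in> {0..N} \<Longrightarrow> t \<in> {0..N} \<Longrightarrow>
       \<bar>W t \<omega> - W s \<omega>\<bar> \<le> D * Holder_const \<beta> * N powr (1/2 - \<beta>) * \<bar>t - s\<bar> powr \<beta>"
proof -
  have P: "prob_space P" and m: "\<And>t. t \<in> I \<Longrightarrow> W t \<in> borel_measurable P"
    and c: "\<And>\<omega>. \<omega> \<in> space P \<Longrightarrow> continuous_on I (\<lambda>t. W t \<omega>)"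
    and d: "\<And>s t. s \<in> I \<Longrightarrow> t \<in> I \<Longrightarrow> s < t \<Longrightarrow>
      distributed P lborel (\<lambda>\<omega>. W t \<omega> - W s \<omega>) (normal_density 0 (sqrt (t - s)))"
    using W by (auto simp: standard_brownian_motion_on_def)
  interpret prob_space P by fact
  have I: "N * t \<in> I" if "t \<in> {0..1}" for t
    using that N by (intro subsetD[OF N(2)]) (auto simp: mult_left_le)
  define X where "X t \<omega> = W (N * t) \<omega> / sqrt N" for t \<omega>
  have inc: "(X t \<omega> - X s \<omega>) ^ (2 * l) = (W (N * t) \<omega> - W (N * s) \<omega>) ^ (2 * l) / N ^ l" for s t \<omega>
    using N by (simp add: X_def diff_divide_distrib[symmetric] power_divide power_mult)
  have mom: "integrable P (\<lambda>\<omega>. (X t \<omega> - X s \<omega>) ^ (2 * l))"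
    "(\<integral>\<omega>. (X t \<omega> - X s \<omega>) ^ (2 * l) \<partial>P) = fact (2 * l) / (2 ^ l * fact l) * (t - s) ^ l"
    if st: "0 \<le> s" "s < t" "t \<le> 1" for s t
  proof -
    have D: "distributed P lborel (\<lambda>\<omega>. W (N * t) \<omega> - W (N * s) \<omega>) (normal_density 0 (sqrt (N * t - N * s)))"
      using st N I by (intro d) auto
    have pos: "0 < N * t - N * s" using st N by simp
    then have pos': "0 < sqrt (N * t - N * s)" by simp
    show "integrable P (\<lambda>\<omega>. (X t \<omega> - X s \<omega>) ^ (2 * l))"
      unfolding inc using normal_even_moment(1)[OF P D pos'] by simp
    show "(\<integral>\<omega>. (X t \<omega> - X s \<omega>) ^ (2 * l) \<partial>P) = fact (2 * l) / (2 ^ l * fact l) * (t - s) ^ l"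
      unfolding inc using normal_even_moment(2)[OF P D pos', of l] pos N
      by (simp add: right_diff_distrib[symmetric] power_mult_distrib)
  qed
  show thesis
  proof (rule Kolmogorov_Chentsov[of P X l "fact (2 * l) / (2 ^ l * fact l)" \<beta> D])
    show "prob_space P" by fact
    show "continuous_on {0..1} (\<lambda>t. X t \<omega>)" if "\<omega> \<in> space P" for \<omega>
      unfolding X_def using I N
      by (intro continuous_intros continuous_on_compose2[OF c[OF that], of _ "\<lambda>t. N * t"]) auto
    show "X t \<in> borel_measurable P" if "t \<in> {0..1}" for t
      unfolding X_def using m[OF I[OF that]] by measurable
    fix bad assume bad: "bad \<in> sets P"
      "measure P bad \<le> fact (2 * l) / (2 ^ l * fact l) / (1 - 2 powr (1 - real l * (1 - 2 * \<beta>))) / D ^ (2 * l)"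
      "\<And>\<omega> s t. \<omega> \<in> space P \<Longrightarrow> \<omega> \<notin> bad \<Longrightarrow> s \<in> {0..1} \<Longrightarrow> t \<in> {0..1} \<Longrightarrow>
        \<bar>X t \<omega> - X s \<omega>\<bar> \<le> D * Holder_const \<beta> * \<bar>t - s\<bar> powr \<beta>"
    show thesis
    proof (rule that[OF bad(1)])
      show "measure P bad \<le> Brownian_tail_const \<beta> l / D ^ (2 * l)" using bad(2) by (simp add: Brownian_tail_const_def)
      fix \<omega> and s t :: real assume \<omega>: "\<omega> \<in> space P" "\<omega> \<notin> bad" and st: "s \<in> {0..N}" "t \<in> {0..N}"
      have "\<bar>W t \<omega> - W s \<omega>\<bar> = sqrt N * \<bar>X (t / N) \<omega> - X (s / N) \<omega>\<bar>"
        using N by (simp add: X_def diff_divide_distrib[symmetric] abs_divide)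
      also have "\<dots> \<le> sqrt N * (D * Holder_const \<beta> * \<bar>t / N - s / N\<bar> powr \<beta>)"
        using bad(3)[OF \<omega>, of "s / N" "t / N"] st N by (intro mult_left_mono) auto
      also have "\<bar>t / N - s / N\<bar> powr \<beta> = \<bar>t - s\<bar> powr \<beta> / N powr \<beta>"
        using N by (simp add: diff_divide_distrib[symmetric] abs_divide powr_divide)
      also have "sqrt N * (D * Holder_const \<beta> * (\<bar>t - s\<bar> powr \<beta> / N powr \<beta>)) =
          D * Holder_const \<beta> * N powr (1/2 - \<beta>) * \<bar>t - s\<bar> powr \<beta>"
        using N by (simp add: powr_diff powr_half_sqrt)
      finally show "\<bar>W t \<omega> - W s \<omega>\<bar> \<le> D * Holder_const \<beta> * N powr (1/2 - \<beta>) * \<bar>t - s\<bar> powr \<beta>" .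
    qed
  qed (use mom \<beta> l D in auto)
qed

section \<open>Limiting variances\<close>

lemma Brownian_increment:
  assumes "standard_brownian_motion_on I P W" "s \<in> I" "t \<in> I" "s < t"
  shows "distributed P lborel (\<lambda>\<omega>. W t \<omega> - W s \<omega>) (normal_density 0 (sqrt (t - s)))"
  using assms unfolding standard_brownian_motion_on_def by blast

text \<open>Finitely many terms do not affect a Cesaro mean, so the conditional second moments need
  to be known only from some time on: the stopped increments of the covariance oracle and the first
  step of the nonlinear one are never computed.\<close>

lemma lim_varianceI:
  assumes P: "prob_space (pmeasure M)"
    and v: "\<And>t. t0 < t \<Longrightarrow>
      AE \<omega> in pmeasure M. real_cond_exp (pmeasure M) (filt M (t - 1)) (\<lambda>\<omega>'. (noise M t \<omega>')\<^sup>2) \<omega> = v"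
  shows "lim_variance M = v"
proof -
  interpret prob_space "pmeasure M" by fact
  let ?a = "\<lambda>t. real_cond_exp (pmeasure M) (filt M (t - 1)) (\<lambda>\<omega>'. (noise M t \<omega>')\<^sup>2)"
  have "AE \<omega> in pmeasure M. \<forall>t. t0 < t \<longrightarrow> ?a t \<omega> = v"
    using v by (subst AE_all_countable) auto
  then have lim: "AE \<omega> in pmeasure M. (\<lambda>m. (\<Sum>t = 1..m. ?a t \<omega>) / real m) \<longlonglongrightarrow> v"
  proof (rule AE_mp, intro AE_I2 impI)
    fix \<omega> assume a: "\<forall>t. t0 < t \<longrightarrow> ?a t \<omega> = v"
    define C where "C = (\<Sum>t = 1..t0. ?a t \<omega> - v)"
    have eq: "C / real m + v = (\<Sum>t = 1..m. ?a t \<omega>) / real m" if m: "Suc t0 \<le> m" for m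
    proof -
      have "(\<Sum>t = 1..m. ?a t \<omega> - v) = C"
        unfolding C_def using m a by (intro sum.mono_neutral_right) auto
      then show ?thesis using m by (simp add: sum_subtractf field_simps)
    qed
    have "(\<lambda>m. C / real m + v) \<longlonglongrightarrow> 0 + v"
      by (intro tendsto_intros tendsto_divide_0[OF tendsto_const] filterlim_real_sequentially
          filterlim_at_top_imp_at_infinity)
    moreover have "\<forall>\<^sub>F m in sequentially. C / real m + v = (\<Sum>t = 1..m. ?a t \<omega>) / real m"
      using eventually_ge_at_top[of "Suc t0"] by eventually_elim (rule eq)
    ultimately show "(\<lambda>m. (\<Sum>t = 1..m. ?a t \<omega>) / real m) \<longlonglongrightarrow> v"
      by (simp add: Lim_transform_eventually)
  qed
  show ?thesis
    unfolding lim_variance_def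
  proof (rule the_equality)
    \<comment> \<open>Two almost sure limits agree at some point, as a probability space is not a
      null set; so the definite description is well defined.\<close>
    fix S assume "AE \<omega> in pmeasure M. (\<lambda>m. (\<Sum>t = 1..m. ?a t \<omega>) / real m) \<longlonglongrightarrow> S"
    with lim have "AE \<omega> in pmeasure M. S = v"
      by eventually_elim (rule LIMSEQ_unique)
    then show "S = v" by simp
  qed (rule lim)
qed

lemma subalgebra_sigma_finite:
  assumes "prob_space P" "subalgebra P F"
  shows "sigma_finite_subalgebra P F"
  using assms by (intro finite_measure_subalgebra_is_sigma_finite finite_measure_subalgebra.intro
      finite_measure_subalgebra_axioms.intro prob_space.finite_measure)

text \<open>The constant passes the defining test: for \<open>A\<close> in \<open>F\<close> the
  indicator of \<open>A\<close> is independent of \<open>f\<close>, so the integral of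
  \<open>f\<close> over \<open>A\<close> factorises. Independence is assumed for the preimages under
  \<open>f\<close>; they form an intersection-stable class, so it extends to the generated
  sigma-algebra.\<close>

lemma real_cond_exp_indep:
  fixes f :: "'w \<Rightarrow> real"
  assumes P: "prob_space P" and F: "subalgebra P F" and f: "integrable P f"
    and ind: "prob_space.indep_set P (sets F) {f -` B \<inter> space P | B. B \<in> sets borel}"
  shows "AE \<omega> in P. real_cond_exp P F f \<omega> = (\<integral>\<omega>. f \<omega> \<partial>P)"
proof -
  interpret prob_space P by fact
  have fm [measurable]: "f \<in> borel_measurable P" using f by simp
  let ?S = "{f -` B \<inter> space P | B. B \<in> sets borel}"
  have spF: "space F = space P" using F by (simp add: subalgebra_def)
  have "Int_stable ?S"
  proof (rule Int_stableI)
    fix a b assume "a \<in> ?S" "b \<in> ?S"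
    then obtain A B where "a = f -` A \<inter> space P" "b = f -` B \<inter> space P" "A \<in> sets borel" "B \<in> sets borel" by blast
    then have "a \<inter> b = f -` (A \<inter> B) \<inter> space P" "A \<inter> B \<in> sets borel" by auto
    then show "a \<inter> b \<in> ?S" by blast
  qed
  moreover have "Int_stable (sets F)" by (rule sets.Int_stable)
  ultimately have ind2: "indep_set (sigma_sets (space P) (sets F)) (sigma_sets (space P) ?S)"
    using ind by (intro indep_set_sigma_sets)
  have sF: "sigma_sets (space P) (sets F) = sets F" using sets.sigma_sets_eq[of F] spF by simp
  show ?thesis
  proof (rule sigma_finite_subalgebra.real_cond_exp_charact[OF subalgebra_sigma_finite[OF P F]])
    fix A assume A: "A \<in> sets F"
    then have AP: "A \<in> sets P" using F by (auto simp: subalgebra_def)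
    have "indep_var borel (indicator A :: 'w \<Rightarrow> real) borel f"
      unfolding indep_var_eq
    proof (intro conjI)
      have "sigma_sets (space P) {(indicator A :: 'w \<Rightarrow> real) -` B \<inter> space P | B. B \<in> sets borel} \<subseteq> sets F"
      proof -
        have "(indicator A :: 'w \<Rightarrow> real) \<in> borel_measurable F" using A by simp
        then show ?thesis
          using spF by (subst sF[symmetric]) (intro sigma_sets_mono', auto dest: measurable_sets)
      qed
      then show "indep_set (sigma_sets (space P) {(indicator A :: 'w \<Rightarrow> real) -` B \<inter> space P | B. B \<in> sets borel})
          (sigma_sets (space P) ?S)"
        using ind2 unfolding sF indep_sets2_eq by blast
    qed (use AP in auto)
    moreover have "integrable P (indicator A :: 'w \<Rightarrow> real)"
      using AP by (intro integrable_const_bound[where B = 1]) auto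
    ultimately have "(\<integral>\<omega>. indicator A \<omega> * f \<omega> \<partial>P) = (\<integral>\<omega>. indicator A \<omega> \<partial>P) * (\<integral>\<omega>. f \<omega> \<partial>P)"
      using AP f by (intro indep_var_lebesgue_integral) auto
    then show "(\<integral>\<omega>\<in>A. f \<omega> \<partial>P) = (\<integral>\<omega>\<in>A. (\<integral>\<omega>. f \<omega> \<partial>P) \<partial>P)"
      using AP by (simp add: set_lebesgue_integral_def)
  qed (use f in auto)
qed

section \<open>Oracles with independent noise and identity drift\<close>

lemma natural_filtration_subalgebra:
  assumes "\<And>j. 1 \<le> j \<Longrightarrow> \<xi> j \<in> borel_measurable P"
  shows "subalgebra P (natural_filtration P \<xi> t)"
  unfolding subalgebra_def natural_filtration_def
  using assms by (auto simp: sets_measure_of_conv space_measure_of_conv intro!: sets.sigma_sets_subset)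

lemma lim_variance_linear_oracle:
  assumes P: "prob_space P" and ind: "prob_space.indep_vars P (\<lambda>_. borel) \<xi> {1..}"
    and sq: "\<And>t. 1 \<le> t \<Longrightarrow> integrable P (\<lambda>\<omega>. (\<xi> t \<omega>)\<^sup>2)" "\<And>t. 1 \<le> t \<Longrightarrow> (\<integral>\<omega>. (\<xi> t \<omega>)\<^sup>2 \<partial>P) = v"
  shows "lim_variance (linear_oracle P \<xi>) = v"
proof (rule lim_varianceI[where ?t0.0 = 0])
  interpret prob_space P by fact
  show "prob_space (pmeasure (linear_oracle P \<xi>))" using P by (simp add: linear_oracle_def)
  fix t :: nat assume t: "0 < t"
  have rv: "\<xi> j \<in> borel_measurable P" if "1 \<le> j" for j
    using ind that by (auto simp: indep_vars_def)
  define E where "E i = {\<xi> i -` A \<inter> space P | A. A \<in> sets borel}" for i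
  \<comment> \<open>Two blocks of indices, the past and the present; independence of the noise
    passes to the sigma-algebras generated by the blocks.\<close>
  define I where "I = case_bool {1..t - 1} {t}"
  have "indep_sets E (\<Union>j\<in>UNIV. I j)"
  proof (rule indep_sets_mono_index)
    show "indep_sets E {1..}" using ind by (simp add: indep_vars_def2 E_def[abs_def])
    show "(\<Union>j\<in>UNIV. I j) \<subseteq> {1..}" using t by (auto simp: I_def split: bool.splits)
  qed
  moreover have "Int_stable (E i)" for i
  proof (rule Int_stableI)
    fix a b assume "a \<in> E i" "b \<in> E i"
    then obtain A B where "a = \<xi> i -` A \<inter> space P" "b = \<xi> i -` B \<inter> space P" "A \<in> sets borel" "B \<in> sets borel"
      unfolding E_def by blast
    then have "a \<inter> b = \<xi> i -` (A \<inter> B) \<inter> space P" "A \<inter> B \<in> sets borel" by auto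
    then show "a \<inter> b \<in> E i" unfolding E_def by blast
  qed
  moreover have "disjoint_family_on I UNIV"
    using t by (auto simp: disjoint_family_on_def I_def split: bool.splits)
  ultimately have isg: "indep_sets (\<lambda>j. sigma_sets (space P) (\<Union>i\<in>I j. E i)) UNIV"
    by (intro indep_sets_collect_sigma) auto
  have eqF: "sets (natural_filtration P \<xi> (t - 1)) = sigma_sets (space P) (\<Union>i\<in>I True. E i)"
    unfolding natural_filtration_def
  proof (subst sets_measure_of)
    have "{\<xi> j -` A \<inter> space P | j A. 1 \<le> j \<and> j \<le> t - 1 \<and> A \<in> sets borel} = (\<Union>i\<in>I True. E i)"
    proof (intro set_eqI iffI)
      fix a assume "a \<in> {\<xi> j -` A \<inter> space P | j A. 1 \<le> j \<and> j \<le> t - 1 \<and> A \<in> sets borel}"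
      then obtain j A where "a = \<xi> j -` A \<inter> space P" "1 \<le> j" "j \<le> t - 1" "A \<in> sets borel" by blast
      then have "j \<in> I True" "a \<in> E j" unfolding I_def E_def by auto
      then show "a \<in> (\<Union>i\<in>I True. E i)" by blast
    next
      fix a assume "a \<in> (\<Union>i\<in>I True. E i)"
      then obtain j A where "a = \<xi> j -` A \<inter> space P" "1 \<le> j" "j \<le> t - 1" "A \<in> sets borel"
        unfolding I_def E_def by auto
      then show "a \<in> {\<xi> j -` A \<inter> space P | j A. 1 \<le> j \<and> j \<le> t - 1 \<and> A \<in> sets borel}" by blast
    qed
    then show "sigma_sets (space P) {\<xi> j -` A \<inter> space P | j A. 1 \<le> j \<and> j \<le> t - 1 \<and> A \<in> sets borel} =
        sigma_sets (space P) (\<Union>i\<in>I True. E i)" by (simp only:)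
  qed auto
  have "indep_set (sets (natural_filtration P \<xi> (t - 1))) {(\<lambda>\<omega>. (\<xi> t \<omega>)\<^sup>2) -` B \<inter> space P | B. B \<in> sets borel}"
    unfolding indep_set_def
  proof (rule indep_sets_mono_sets[OF isg])
    fix j
    have sub: "{(\<lambda>\<omega>. (\<xi> t \<omega>)\<^sup>2) -` B \<inter> space P | B. B \<in> sets borel} \<subseteq> sigma_sets (space P) (E t)"
    proof
      fix a assume "a \<in> {(\<lambda>\<omega>. (\<xi> t \<omega>)\<^sup>2) -` B \<inter> space P | B. B \<in> sets borel}"
      then obtain B where B: "a = (\<lambda>\<omega>. (\<xi> t \<omega>)\<^sup>2) -` B \<inter> space P" "B \<in> sets borel" by blast
      have "(\<lambda>x::real. x\<^sup>2) \<in> borel_measurable borel" by simp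
      from measurable_sets[OF this B(2)] have "(\<lambda>x::real. x\<^sup>2) -` B \<in> sets borel" by simp
      moreover have "a = \<xi> t -` ((\<lambda>x. x\<^sup>2) -` B) \<inter> space P" using B by auto
      ultimately show "a \<in> sigma_sets (space P) (E t)" unfolding E_def by blast
    qed
    show "(case j of True \<Rightarrow> sets (natural_filtration P \<xi> (t - 1))
        | False \<Rightarrow> {(\<lambda>\<omega>. (\<xi> t \<omega>)\<^sup>2) -` B \<inter> space P | B. B \<in> sets borel}) \<subseteq> sigma_sets (space P) (\<Union>i\<in>I j. E i)"
      using sub eqF by (cases j) (auto simp: I_def)
  qed
  from real_cond_exp_indep[OF P natural_filtration_subalgebra sq(1) this] rv t
  have "AE \<omega> in P. real_cond_exp P (natural_filtration P \<xi> (t - 1)) (\<lambda>\<omega>'. (\<xi> t \<omega>')\<^sup>2) \<omega> = v"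
    by (simp add: sq(2))
  moreover have "pmeasure (linear_oracle P \<xi>) = P" "filt (linear_oracle P \<xi>) = natural_filtration P \<xi>"
    "noise (linear_oracle P \<xi>) = \<xi>"
    by (simp_all add: linear_oracle_def)
  ultimately show "AE \<omega> in pmeasure (linear_oracle P \<xi>). real_cond_exp (pmeasure (linear_oracle P \<xi>))
      (filt (linear_oracle P \<xi>) (t - 1)) (\<lambda>\<omega>'. (noise (linear_oracle P \<xi>) t \<omega>')\<^sup>2) \<omega> = v"
    by (simp only:)
qed

lemma lin_coeff_linear_oracle: "lin_coeff (linear_oracle P \<xi>) = 1"
  by (simp add: lin_coeff_def linear_oracle_def)

text \<open>Sorting the past times together with 0 and \<open>u\<close> makes every past value a sum
  of increments over disjoint intervals, because the motion starts at 0, while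
  \<open>W t - W u\<close> is exactly the next increment. Independence of the increments, grouped
  into the first \<open>n - 1\<close> and the last one, then gives the product.\<close>

lemma Brownian_past_indep:
  assumes W: "standard_brownian_motion_on {0..} P W" and t: "0 \<le> u" "u < t"
    and J: "finite J" "J \<subseteq> {0..u}" and C: "\<And>s. C s \<in> sets borel" and B: "B \<in> sets borel"
  shows "measure P ({\<omega>\<in>space P. \<forall>s\<in>J. W s \<omega> \<in> C s} \<inter> {\<omega>\<in>space P. W t \<omega> - W u \<omega> \<in> B}) =
    measure P {\<omega>\<in>space P. \<forall>s\<in>J. W s \<omega> \<in> C s} * measure P {\<omega>\<in>space P. W t \<omega> - W u \<omega> \<in> B}"
proof -
  interpret prob_space P using W by (simp add: standard_brownian_motion_on_def)
  define xs where "xs = sorted_list_of_set (J \<union> {0, u})"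
  have set: "set xs = J \<union> {0, u}" unfolding xs_def by (rule set_sorted_list_of_set) (use J in simp)
  have srt: "sorted_wrt (<) xs" by (simp add: xs_def strict_sorted_list_of_set)
  define n where "n = length xs"
  have n: "0 < n" using set by (auto simp: n_def)
  define \<tau> where "\<tau> i = (xs @ [t]) ! i" for i
  have srt': "sorted_wrt (<) (xs @ [t])" using srt set J t by (auto simp: sorted_wrt_append)
  have mono: "strict_mono_on {..n} \<tau>"
    unfolding strict_mono_on_def \<tau>_def using sorted_wrt_nth_less[OF srt'] by (auto simp: n_def)
  have \<tau>_lt: "\<tau> i = xs ! i" if "i < n" for i using that by (simp add: \<tau>_def nth_append n_def)
  have \<tau>n: "\<tau> n = t" by (simp add: \<tau>_def n_def)
  have last: "\<tau> (n - 1) = u"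
  proof -
    obtain k where k: "k < n" "xs ! k = u" using set by (metis UnI2 in_set_conv_nth insertCI n_def)
    have "xs ! (n - 1) \<in> set xs" using n by (simp add: n_def)
    then have "xs ! (n - 1) \<le> u" using set J t by auto
    moreover have "xs ! k \<le> xs ! (n - 1)"
    proof (cases "k = n - 1")
      case False
      then have "k < n - 1" using k by linarith
      then show ?thesis using sorted_wrt_nth_less[OF srt, of k "n - 1"] n by (simp add: n_def)
    qed simp
    ultimately show ?thesis using k n by (simp add: \<tau>_lt)
  qed
  have zero: "\<tau> 0 = 0"
  proof -
    obtain k where k: "k < n" "xs ! k = 0" using set by (metis UnI2 in_set_conv_nth insertCI n_def)
    have "xs ! 0 \<in> set xs" using n by (simp add: n_def)
    then have "0 \<le> xs ! 0" using set J t by auto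
    moreover have "xs ! 0 \<le> xs ! k"
      using srt k n sorted_wrt_nth_less[OF srt, of 0 k] by (cases "k = 0") (auto simp: n_def)
    ultimately show ?thesis using k n by (simp add: \<tau>_lt)
  qed
  have range: "\<tau> ` {..n} \<subseteq> {0..}"
  proof -
    have "\<tau> i \<in> set (xs @ [t])" if "i \<le> n" for i
      unfolding \<tau>_def using that by (intro nth_mem) (simp add: n_def)
    moreover have "set (xs @ [t]) \<subseteq> {0..}" using set J t by auto
    ultimately show ?thesis by blast
  qed
  define X where "X i \<omega> = W (\<tau> (Suc i)) \<omega> - W (\<tau> i) \<omega>" for i \<omega>
  have ind: "indep_vars (\<lambda>_. borel) X {..<n}"
    using W range mono unfolding standard_brownian_motion_on_def X_def by blast
  have W0: "W 0 \<omega> = 0" if "\<omega> \<in> space P" for \<omega>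
    using W that by (simp add: standard_brownian_motion_on_def)
  have tele: "W (\<tau> k) \<omega> = (\<Sum>i<k. X i \<omega>)" if "\<omega> \<in> space P" for k \<omega>
    using W0[OF that] zero sum_lessThan_telescope[of "\<lambda>i. W (\<tau> i) \<omega>" k] by (simp add: X_def)
  have "\<forall>s\<in>J. \<exists>k<n. \<tau> k = s"
  proof
    fix s assume "s \<in> J"
    then have "s \<in> set xs" using set by simp
    then show "\<exists>k<n. \<tau> k = s" by (metis \<tau>_lt in_set_conv_nth n_def)
  qed
  then obtain k where k: "\<And>s. s \<in> J \<Longrightarrow> k s < n \<and> \<tau> (k s) = s" by metis
  let ?A = "{..<n - 1}" and ?B = "{n - 1}"
  have iv: "indep_var (PiM ?A (\<lambda>_. borel)) (\<lambda>\<omega>. restrict (\<lambda>i. X i \<omega>) ?A)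
      (PiM ?B (\<lambda>_. borel)) (\<lambda>\<omega>. restrict (\<lambda>i. X i \<omega>) ?B)"
    using n by (intro indep_var_restrict[OF ind]) auto
  define Xa where "Xa = {f\<in>space (PiM ?A (\<lambda>_. borel :: real measure)). \<forall>s\<in>J. (\<Sum>i<k s. f i) \<in> C s}"
  define Xb where "Xb = {f\<in>space (PiM ?B (\<lambda>_. borel :: real measure)). f (n - 1) \<in> B}"
  have Xa: "Xa \<in> sets (PiM ?A (\<lambda>_. borel))"
  proof -
    have "{f\<in>space (PiM ?A (\<lambda>_. borel :: real measure)). (\<Sum>i<k s. f i) \<in> C s} \<in> sets (PiM ?A (\<lambda>_. borel))"
      if s: "s \<in> J" for s
    proof -
      have "(\<lambda>f. \<Sum>i<k s. f i) \<in> borel_measurable (PiM ?A (\<lambda>_. borel :: real measure))"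
        using k[OF s] by (intro borel_measurable_sum measurable_component_singleton) auto
      from measurable_sets[OF this C[of s]] show ?thesis
        by (simp add: vimage_def Int_def conj_commute)
    qed
    then show ?thesis unfolding Xa_def using J(1) by (intro sets.sets_Collect_finite_All) auto
  qed
  have Xb: "Xb \<in> sets (PiM ?B (\<lambda>_. borel))"
  proof -
    have "(\<lambda>f. f (n - 1)) \<in> borel_measurable (PiM ?B (\<lambda>_. borel :: real measure))"
      by (intro measurable_component_singleton) auto
    from measurable_sets[OF this B] show ?thesis
      unfolding Xb_def by (simp add: vimage_def Int_def conj_commute)
  qed
  have sum_eq: "(\<Sum>i<k s. if i < n - Suc 0 then X i \<omega> else undefined) = (\<Sum>i<k s. X i \<omega>)" if "s \<in> J" for s \<omega>
    using k[OF that] by (intro sum.cong) auto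
  have a: "(\<lambda>\<omega>. restrict (\<lambda>i. X i \<omega>) ?A) -` Xa \<inter> space P = {\<omega>\<in>space P. \<forall>s\<in>J. W s \<omega> \<in> C s}"
    using k sum_eq by (auto simp: Xa_def space_PiM tele[symmetric])
  have b: "(\<lambda>\<omega>. restrict (\<lambda>i. X i \<omega>) ?B) -` Xb \<inter> space P = {\<omega>\<in>space P. W t \<omega> - W u \<omega> \<in> B}"
    using n last \<tau>n by (auto simp: Xb_def space_PiM X_def)
  have ab: "(\<lambda>\<omega>. (restrict (\<lambda>i. X i \<omega>) ?A, restrict (\<lambda>i. X i \<omega>) ?B)) -` (Xa \<times> Xb) \<inter> space P =
      {\<omega>\<in>space P. \<forall>s\<in>J. W s \<omega> \<in> C s} \<inter> {\<omega>\<in>space P. W t \<omega> - W u \<omega> \<in> B}"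
    unfolding a[symmetric] b[symmetric] by auto
  from indep_varD[OF iv Xa Xb] show ?thesis unfolding a b ab .
qed

section \<open>The augmented Brownian filtration\<close>

lemma augmented_filtration_subalgebra:
  assumes "\<And>s. 0 \<le> s \<Longrightarrow> W s \<in> borel_measurable P"
  shows "subalgebra (completion P) (augmented_filtration P W t)"
proof -
  have "sigma_sets (space P) ({W s -` A \<inter> space P | s A. 0 \<le> s \<and> s \<le> real t \<and> A \<in> sets borel} \<union> null_sets (completion P))
      \<subseteq> sets (completion P)"
  proof -
    have "{W s -` A \<inter> space P | s A. 0 \<le> s \<and> s \<le> real t \<and> A \<in> sets borel} \<subseteq> sets (completion P)"
      using measurable_sets[OF assms] by (auto intro: sets_completionI_sets)
    moreover have "null_sets (completion P) \<subseteq> sets (completion P)" by blast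
    ultimately show ?thesis using sets.sigma_sets_subset[of _ "completion P"] by simp
  qed
  moreover have "({W s -` A \<inter> space P | s A. 0 \<le> s \<and> s \<le> real t \<and> A \<in> sets borel} \<union> null_sets (completion P))
      \<subseteq> Pow (space P)"
    using sets.sets_into_space[of _ "completion P"] by (auto dest: null_setsD2)
  ultimately show ?thesis
    unfolding subalgebra_def augmented_filtration_def by (simp add: space_measure_of_conv)
qed

text \<open>Cylinder events at finitely many past times together with the null sets of the
  completion form an intersection-stable generator of the filtration. On cylinders the product rule
  is that of independent increments; on null sets both sides vanish.\<close>

lemma augmented_filtration_indep:
  assumes W: "standard_brownian_motion_on {0..} P W" and t: "real t' < t"
  shows "prob_space.indep_set (completion P) (sets (augmented_filtration P W t'))
    {(\<lambda>\<omega>. (W t \<omega> - W (real t') \<omega>)\<^sup>2) -` B \<inter> space P | B. B \<in> sets borel}"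
proof -
  interpret P: prob_space P using W by (simp add: standard_brownian_motion_on_def)
  interpret prob_space "completion P" by (rule P.prob_space_completion)
  have m: "W s \<in> borel_measurable P" if "0 \<le> s" for s
    using W that by (simp add: standard_brownian_motion_on_def)
  define cyl where "cyl J C = {\<omega>\<in>space P. \<forall>s\<in>J. W s \<omega> \<in> C s}" for J :: "real set" and C
  define PI where "PI = {cyl J C | J C. finite J \<and> J \<subseteq> {0..real t'} \<and> (\<forall>s. C s \<in> sets borel)}"
  define S where "S = {(\<lambda>\<omega>. (W t \<omega> - W (real t') \<omega>)\<^sup>2) -` B \<inter> space P | B. B \<in> sets borel}"
  have cylm: "cyl J C \<in> sets P" if "finite J" "J \<subseteq> {0..real t'}" "\<forall>s. C s \<in> sets borel" for J C
  proof -
    have "{\<omega>\<in>space P. W s \<omega> \<in> C s} \<in> sets P" if "s \<in> J" for s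
    proof -
      have "W s \<in> borel_measurable P" using m that \<open>J \<subseteq> _\<close> by auto
      from measurable_sets[OF this] show ?thesis
        using \<open>\<forall>s. C s \<in> sets borel\<close> by (simp add: vimage_def Int_def conj_commute)
    qed
    then show ?thesis unfolding cyl_def using \<open>finite J\<close> by (intro sets.sets_Collect_finite_All) auto
  qed
  have Sm: "S \<subseteq> sets P"
  proof
    fix a assume "a \<in> S"
    then obtain B where B: "a = (\<lambda>\<omega>. (W t \<omega> - W (real t') \<omega>)\<^sup>2) -` B \<inter> space P" "B \<in> sets borel"
      unfolding S_def by blast
    have [measurable]: "W t \<in> borel_measurable P" "W (real t') \<in> borel_measurable P" using m t by auto
    have "(\<lambda>\<omega>. (W t \<omega> - W (real t') \<omega>)\<^sup>2) \<in> borel_measurable P" by measurable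
    then show "a \<in> sets P" using B by (auto dest: measurable_sets)
  qed
  have stable: "Int_stable (PI \<union> null_sets (completion P))"
  proof (rule Int_stableI)
    fix a b assume ab: "a \<in> PI \<union> null_sets (completion P)" "b \<in> PI \<union> null_sets (completion P)"
    have PIc: "x \<in> sets (completion P)" if "x \<in> PI \<union> null_sets (completion P)" for x
      using that cylm by (auto simp: PI_def)
    show "a \<inter> b \<in> PI \<union> null_sets (completion P)"
    proof (cases "a \<in> PI \<and> b \<in> PI")
      case True
      then obtain J C J' C' where 1: "a = cyl J C" "finite J" "J \<subseteq> {0..real t'}" "\<forall>s. C s \<in> sets borel"
        "b = cyl J' C'" "finite J'" "J' \<subseteq> {0..real t'}" "\<forall>s. C' s \<in> sets borel"
        unfolding PI_def by blast
      let ?C = "\<lambda>s. (if s \<in> J then C s else UNIV) \<inter> (if s \<in> J' then C' s else UNIV)"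
      have "a \<inter> b = cyl (J \<union> J') ?C" using 1 by (auto simp: cyl_def split: if_splits)
      moreover have "\<forall>s. ?C s \<in> sets borel" using 1 by auto
      ultimately show ?thesis unfolding PI_def using 1 by blast
    next
      case False
      then have "a \<in> null_sets (completion P) \<or> b \<in> null_sets (completion P)" using ab by blast
      then have "a \<inter> b \<in> null_sets (completion P)"
        using PIc[OF ab(1)] PIc[OF ab(2)] null_set_Int1[of a "completion P" b] null_set_Int1[of b "completion P" a]
        by (auto simp: Int_commute)
      then show ?thesis by blast
    qed
  qed
  have stS: "Int_stable S"
  proof (rule Int_stableI)
    fix a b assume "a \<in> S" "b \<in> S"
    then obtain A B where AB: "a = (\<lambda>\<omega>. (W t \<omega> - W (real t') \<omega>)\<^sup>2) -` A \<inter> space P"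
      "b = (\<lambda>\<omega>. (W t \<omega> - W (real t') \<omega>)\<^sup>2) -` B \<inter> space P" "A \<in> sets borel" "B \<in> sets borel"
      unfolding S_def by blast
    then have "a \<inter> b = (\<lambda>\<omega>. (W t \<omega> - W (real t') \<omega>)\<^sup>2) -` (A \<inter> B) \<inter> space P" "A \<inter> B \<in> sets borel" by auto
    then show "a \<inter> b \<in> S" unfolding S_def by blast
  qed
  have "indep_set (PI \<union> null_sets (completion P)) S"
  proof (rule indep_setI)
    show "PI \<union> null_sets (completion P) \<subseteq> events" using cylm by (auto simp: PI_def)
    show "S \<subseteq> events" using Sm by auto
    fix a b assume a: "a \<in> PI \<union> null_sets (completion P)" and b: "b \<in> S"
    show "prob (a \<inter> b) = prob a * prob b"
    proof (cases "a \<in> PI")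
      case True
      then obtain J C where J: "a = cyl J C" "finite J" "J \<subseteq> {0..real t'}" "\<And>s. C s \<in> sets borel"
        unfolding PI_def by blast
      obtain B where B: "b = (\<lambda>\<omega>. (W t \<omega> - W (real t') \<omega>)\<^sup>2) -` B \<inter> space P" "B \<in> sets borel"
        using b unfolding S_def by blast
      have "(\<lambda>x::real. x\<^sup>2) \<in> borel_measurable borel" by simp
      from measurable_sets[OF this B(2)] have B2: "(\<lambda>x. x\<^sup>2) -` B \<in> sets (borel :: real measure)" by simp
      have b2: "b = {\<omega>\<in>space P. W t \<omega> - W (real t') \<omega> \<in> (\<lambda>x. x\<^sup>2) -` B}" using B by auto
      have "measure P (a \<inter> b) = measure P a * measure P b"
        using Brownian_past_indep[OF W _ t J(2,3,4) B2] unfolding J(1) cyl_def b2 by simp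
      moreover have "a \<in> sets P" "b \<in> sets P" using cylm J Sm b by auto
      ultimately show ?thesis by simp
    next
      case False
      then have n: "a \<in> null_sets (completion P)" using a by simp
      then have "a \<inter> b \<in> null_sets (completion P)" using Sm b by (intro null_set_Int2) auto
      then show ?thesis using n by (simp add: measure_eq_0_null_sets)
    qed
  qed
  then have "indep_set (sigma_sets (space (completion P)) (PI \<union> null_sets (completion P))) (sigma_sets (space (completion P)) S)"
    by (rule indep_set_sigma_sets[OF _ stable stS])
  moreover have "sets (augmented_filtration P W t') \<subseteq> sigma_sets (space P) (PI \<union> null_sets (completion P))"
  proof -
    have "W s -` A \<inter> space P \<in> PI" if "0 \<le> s" "s \<le> real t'" "A \<in> sets borel" for s A
    proof -
      have "W s -` A \<inter> space P = cyl {s} (\<lambda>_. A)" by (auto simp: cyl_def)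
      then show ?thesis unfolding PI_def using that by (intro CollectI exI[of _ "{s}"] exI[of _ "\<lambda>_. A"]) auto
    qed
    then have "{W s -` A \<inter> space P | s A. 0 \<le> s \<and> s \<le> real t' \<and> A \<in> sets borel} \<union> null_sets (completion P)
        \<subseteq> PI \<union> null_sets (completion P)" by blast
    moreover have "\<dots> \<subseteq> Pow (space P)"
      using sets.sets_into_space[of _ "completion P"] by (auto simp: PI_def cyl_def dest!: null_setsD2)
    ultimately show ?thesis
      unfolding augmented_filtration_def by (subst sets_measure_of) (auto intro!: sigma_sets_mono')
  qed
  ultimately show ?thesis
    unfolding S_def[symmetric] indep_sets2_eq space_completion by blast
qed

text \<open>After time \<open>N\<close> the noise consists of plain Brownian increments of unit
  length, so the stopping does not matter for the limit.\<close>

lemma lim_variance_cov_oracle: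
  assumes W: "standard_brownian_motion_on {0..} P W"
  shows "lim_variance (cov_oracle \<gamma> P W N) = 1"
proof (rule lim_varianceI[where ?t0.0 = N])
  interpret P: prob_space P using W by (simp add: standard_brownian_motion_on_def)
  have pc: "prob_space (completion P)" by (rule P.prob_space_completion)
  show "prob_space (pmeasure (cov_oracle \<gamma> P W N))" using pc by (simp add: cov_oracle_def)
  have m: "W s \<in> borel_measurable P" if "0 \<le> s" for s
    using W that by (simp add: standard_brownian_motion_on_def)
  fix t :: nat assume t: "N < t"
  let ?f = "\<lambda>\<omega>. (W (real t) \<omega> - W (real (t - 1)) \<omega>)\<^sup>2"
  have t1: "real (t - 1) < real t" "real (t - 1) = real t - 1" using t by auto
  have d: "distributed P lborel (\<lambda>\<omega>. W (real t) \<omega> - W (real (t - 1)) \<omega>) (normal_density 0 (sqrt (real t - real (t - 1))))"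
    using W t1(1) by (intro Brownian_increment) auto
  have mom: "integrable P ?f" "(\<integral>\<omega>. ?f \<omega> \<partial>P) = 1"
    using normal_even_moment[OF P.prob_space_axioms d, of 1] t1 by auto
  have fm: "?f \<in> borel_measurable P" using mom(1) by simp
  have "AE \<omega> in completion P. real_cond_exp (completion P) (augmented_filtration P W (t - 1)) ?f \<omega> = (\<integral>\<omega>. ?f \<omega> \<partial>completion P)"
  proof (rule real_cond_exp_indep[OF pc augmented_filtration_subalgebra])
    show "integrable (completion P) ?f" using mom(1) integrable_completion[OF fm] by simp
    show "prob_space.indep_set (completion P) (sets (augmented_filtration P W (t - 1))) {?f -` B \<inter> space (completion P) | B. B \<in> sets borel}"
      using augmented_filtration_indep[OF W t1(1)] by simp
  qed (rule m)
  moreover have "pmeasure (cov_oracle \<gamma> P W N) = completion P"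
    "filt (cov_oracle \<gamma> P W N) (t - 1) = augmented_filtration P W (t - 1)"
    "noise (cov_oracle \<gamma> P W N) t = (\<lambda>\<omega>. W (real t) \<omega> - W (real (t - 1)) \<omega>)"
    using t t1(2) by (auto simp: cov_oracle_def)
  ultimately show "AE \<omega> in pmeasure (cov_oracle \<gamma> P W N). real_cond_exp (pmeasure (cov_oracle \<gamma> P W N))
      (filt (cov_oracle \<gamma> P W N) (t - 1)) (\<lambda>\<omega>'. (noise (cov_oracle \<gamma> P W N) t \<omega>')\<^sup>2) \<omega> = 1"
    using mom(2) integral_completion[OF fm] by (simp only:)
qed

section \<open>Laws of the oracle path and of the target\<close>

lemma target_path_unit:
  assumes "lin_coeff M = 1" "lim_variance M = 1"
  shows "target_path B M = (\<lambda>\<omega> r. B r \<omega>)"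
  using assms by (intro ext) (simp add: target_path_def)

lemma measure_oracle_path_law:
  assumes "drift M \<in> borel_measurable borel" "\<And>t. 1 \<le> t \<Longrightarrow> noise M t \<in> borel_measurable P"
    and "\<Gamma> \<in> sets skorokhod_borel"
  shows "measure (path_law P (oracle_path st M T)) \<Gamma> =
      measure P {\<omega>\<in>space P. restrict (oracle_path st M T \<omega>) {0..1} \<in> \<Gamma>}"
    and "{\<omega>\<in>space P. restrict (oracle_path st M T \<omega>) {0..1} \<in> \<Gamma>} \<in> sets P"
  by (rule measure_path_law[OF oracle_path_measurable[OF assms(1,2)] continuous_oracle_path assms(3)]; assumption)+

lemma measure_Brownian_law:
  assumes "standard_brownian_motion_on {0..1} Q B" "\<Gamma> \<in> sets skorokhod_borel"
  shows "measure (path_law Q (\<lambda>\<omega> r. B r \<omega>)) \<Gamma> = measure Q {\<omega>\<in>space Q. (\<lambda>r\<in>{0..1}. B r \<omega>) \<in> \<Gamma>}"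
    and "{\<omega>\<in>space Q. (\<lambda>r\<in>{0..1}. B r \<omega>) \<in> \<Gamma>} \<in> sets Q"
proof -
  have 1: "(\<lambda>\<omega>. B t \<omega>) \<in> borel_measurable Q" if "t \<in> {0..1}" for t
    using assms(1) that by (simp add: standard_brownian_motion_on_def)
  have 2: "continuous_on {0..1} (\<lambda>r. B r \<omega>)" if "\<omega> \<in> space Q" for \<omega>
    using assms(1) that by (simp add: standard_brownian_motion_on_def)
  show "measure (path_law Q (\<lambda>\<omega> r. B r \<omega>)) \<Gamma> = measure Q {\<omega>\<in>space Q. (\<lambda>r\<in>{0..1}. B r \<omega>) \<in> \<Gamma>}"
    "{\<omega>\<in>space Q. (\<lambda>r\<in>{0..1}. B r \<omega>) \<in> \<Gamma>} \<in> sets Q"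
    by (rule measure_path_law[OF 1 2 assms(2)]; assumption)+
qed

section \<open>The nonlinear class\<close>

lemma smooth_cutoff_measurable: "smooth_cutoff chi \<Longrightarrow> chi \<in> borel_measurable borel"
proof -
  assume "smooth_cutoff chi"
  then have "((deriv ^^ 0) chi) differentiable (at z)" for z unfolding smooth_cutoff_def by blast
  then have "isCont chi z" for z by (simp add: differentiable_imp_continuous_within)
  then show ?thesis by (intro borel_measurable_continuous_onI continuous_at_imp_continuous_on) auto
qed

lemma vimage_algebra_subalgebra:
  assumes "b \<in> measurable P M"
  shows "subalgebra P (vimage_algebra (space P) b M)"
  unfolding subalgebra_def using sets_image_in_sets[OF refl assms] by simp

lemma real_cond_exp_zero:
  assumes "prob_space P" "subalgebra P F"
  shows "AE \<omega> in P. real_cond_exp P F (\<lambda>_. 0) \<omega> = 0"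
  by (rule sigma_finite_subalgebra.real_cond_exp_F_meas[OF subalgebra_sigma_finite[OF assms]]) simp_all

lemma nl_oracle_fields:
  "pmeasure (nl_oracle \<eta> \<alpha> q lam c0 chi P b N) = P"
  "1 < t \<Longrightarrow> filt (nl_oracle \<eta> \<alpha> q lam c0 chi P b N) (t - 1) = vimage_algebra (space P) b (count_space UNIV)"
  "1 < t \<Longrightarrow> (\<lambda>\<omega>. (noise (nl_oracle \<eta> \<alpha> q lam c0 chi P b N) t \<omega>)\<^sup>2) = (\<lambda>_. 0)"
  unfolding nl_oracle_def by simp_all

lemma lim_variance_nl_oracle:
  assumes P: "prob_space P" and b: "b \<in> measurable P (count_space UNIV)"
  shows "lim_variance (nl_oracle \<eta> \<alpha> q lam c0 chi P b N) = 0"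
  by (rule lim_varianceI[where ?t0.0 = 1], unfold nl_oracle_fields)
    (rule P, rule real_cond_exp_zero[OF P vimage_algebra_subalgebra[OF b]])

text \<open>Write \<open>\<rho>\<close> for \<open>nl_rho \<alpha> q N\<close>. On success the first
  step lands exactly at \<open>\<rho> / sqrt N\<close>. As long as the iterate is at least
  \<open>\<kappa> * \<rho> / sqrt N\<close>, the argument of the first cutoff is at least
  \<open>\<kappa> / sqrt \<rho> \<ge> 2\<close>, so the drift is the weak linear one and the iterate
  shrinks only by a factor of the product; since the product stays above \<open>\<kappa>\<close>,
  the lower bound reproduces itself. About \<open>N\<close> such iterates, divided by
  \<open>sqrt N\<close>, give an endpoint of order \<open>\<rho>\<close>.\<close>

lemma nl_path_endpoint:
  fixes \<eta> \<alpha> q lam c0 \<kappa> :: real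
  assumes \<eta>: "0 < \<eta>" and \<alpha>: "0 \<le> \<alpha>" and chi: "smooth_cutoff chi" and c0: "0 < c0" and \<kappa>: "0 < \<kappa>" and N: "2 \<le> N"
    and c: "c0 * real N powr (\<alpha> - 1) * \<eta> \<le> 1/2"
    and \<rho>: "nl_rho \<alpha> q N \<le> 1/2"
    and prod: "(\<Prod>s = 2..N - 1. 1 - c0 * real N powr (\<alpha> - 1) * step_size \<eta> \<alpha> s) \<ge> \<kappa>"
    and \<kappa>2: "2 * nl_rho \<alpha> q N powr (1/2) < \<kappa>"
    and b: "b \<omega>"
  shows "\<kappa> * nl_rho \<alpha> q N / 2 \<le> oracle_path (step_size \<eta> \<alpha>) (nl_oracle \<eta> \<alpha> q lam c0 chi P b N) N \<omega> 1"
proof -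
  let ?st = "step_size \<eta> \<alpha>" and ?M = "nl_oracle \<eta> \<alpha> q lam c0 chi P b N"
  let ?\<rho> = "nl_rho \<alpha> q N"
  define cN where "cN = c0 * real N powr (\<alpha> - 1)"
  define x where "x t = iterate ?st ?M t \<omega>" for t
  have \<rho>0: "0 < ?\<rho>" using N by (simp add: nl_rho_def)
  have cN: "0 < cN" using c0 N by (simp add: cN_def)
  have fac: "0 \<le> 1 - cN * ?st s" "1 - cN * ?st s \<le> 1" if "1 \<le> s" for s
  proof -
    have s: "0 < ?st s" "?st s \<le> \<eta>"
      using step_size_pos[OF \<eta> that, of \<alpha>] step_size_antimono[of \<eta> \<alpha> 1 s] that \<eta> \<alpha> by (auto simp: step_size_def)
    have "cN * ?st s \<le> cN * \<eta>" using s cN by (intro mult_left_mono) auto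
    then show "0 \<le> 1 - cN * ?st s" using c by (simp add: cN_def)
    show "1 - cN * ?st s \<le> 1" using s cN by simp
  qed
  define pr where "pr t = (\<Prod>s = 2..<t. 1 - cN * ?st s)" for t
  have prS: "pr (Suc t) = pr t * (1 - cN * ?st t)" if "2 \<le> t" for t
    using that by (simp add: pr_def prod.atLeastLessThan_Suc)
  have pr_le: "pr t \<le> 1" for t unfolding pr_def using fac by (intro prod_le_1) auto
  have prN: "\<kappa> \<le> pr N"
  proof -
    have "{2..N - 1} = {2..<N}" using N by auto
    then show ?thesis using prod by (simp add: pr_def cN_def)
  qed
  have pr_ge: "\<kappa> \<le> pr t" if t: "2 \<le> t" "t \<le> N" for t
  proof -
    have "pr N \<le> pr t"
      using t(2)
    proof (induction N rule: dec_induct)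
      case (step n)
      have "pr (Suc n) \<le> pr n * 1"
        unfolding prS[OF order_trans[OF t(1) step(1)]] using fac step t
        by (intro mult_left_mono) (auto simp: pr_def intro!: prod_nonneg)
      then show ?case using step by simp
    qed simp
    then show ?thesis using prN by simp
  qed
  \<comment> \<open>The normalisation of the noise by \<open>\<eta> * (1 - ?\<rho>)\<close> cancels
    the first step size \<open>\<eta>\<close> and the centred value
    \<open>1 - ?\<rho>\<close>.\<close>
  have x2: "x 2 = ?\<rho> / sqrt (real N)"
  proof -
    have "x 1 = 0" by (simp add: x_def iterate.simps(2))
    then have "x (Suc 1) = ?st 1 * noise ?M 1 \<omega> - ?st 1 * drift ?M 0"
      by (simp add: x_def iterate.simps(2))
    also have "drift ?M 0 = 0" by (simp add: nl_oracle_def nl_drift_def)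
    also have "?st 1 = \<eta>" by (simp add: step_size_def)
    also have "noise ?M 1 \<omega> = ?\<rho> / (\<eta> * sqrt (real N))" using b \<rho> by (simp add: nl_oracle_def)
    finally show ?thesis using \<eta> by (simp add: numeral_2_eq_2)
  qed
  have drift_step: "x (Suc t) = x t * (1 - cN * ?st t)" if t: "2 \<le> t" and xt: "\<kappa> * ?\<rho> / sqrt (real N) \<le> x t" "x t \<le> 1" for t
  proof -
    have N0: "0 < sqrt (real N)" using N by simp
    have "0 < \<kappa> * ?\<rho> / sqrt (real N)" using \<kappa> \<rho>0 N0 by simp
    then have x0: "0 < x t" using xt(1) by linarith
    \<comment> \<open>Here \<open>2 * ?\<rho> powr (1/2) < \<kappa>\<close> turns the lower bound on
      the iterate into saturation of the first cutoff. The second is saturated because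
      \<open>x t \<le> 1\<close>.\<close>
    have "2 * ?\<rho> powr (3/2) = (2 * ?\<rho> powr (1/2)) * ?\<rho>"
      using \<rho>0 powr_add[of ?\<rho> "1/2" 1] by simp
    also have "\<dots> \<le> \<kappa> * ?\<rho>" using \<kappa>2 \<rho>0 by (intro mult_right_mono) auto
    also have "\<dots> \<le> sqrt (real N) * x t" using xt(1) N0 by (simp add: field_simps)
    finally have "2 \<le> sqrt (real N) * x t / ?\<rho> powr (3/2)" using \<rho>0 by (simp add: field_simps)
    then have "chi (sqrt (real N) * x t / ?\<rho> powr (3/2)) = 1" "chi (3 - x t) = 1"
      using chi xt(2) by (auto simp: smooth_cutoff_def)
    then have "drift ?M (x t) = cN * x t" using x0 by (simp add: nl_oracle_def nl_drift_def cN_def)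
    moreover have "noise ?M t \<omega> = 0" using t by (simp add: nl_oracle_def)
    ultimately show ?thesis using t by (simp add: x_def iterate.simps(2) algebra_simps)
  qed
  have r1: "?\<rho> / sqrt (real N) \<le> 1"
  proof -
    have "1 \<le> sqrt (real N)" using N by simp
    then have "?\<rho> \<le> sqrt (real N)" using \<rho> by linarith
    then show ?thesis using N by simp
  qed
  have xt: "x t = ?\<rho> / sqrt (real N) * pr t" if "2 \<le> t" "t \<le> Suc N" for t
    using that
  proof (induction t rule: dec_induct)
    case base
    then show ?case using x2 by (simp add: pr_def)
  next
    case (step t)
    have 1: "\<kappa> * (?\<rho> / sqrt (real N)) \<le> pr t * (?\<rho> / sqrt (real N))"
      using pr_ge[of t] step \<rho>0 by (intro mult_right_mono) auto
    have 2: "x t \<le> ?\<rho> / sqrt (real N) * 1"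
      using step pr_le[of t] \<rho>0 by (simp del: mult_1_right) (intro mult_left_mono divide_right_mono; simp)
    have "x t \<le> 1" using 2 r1 by linarith
    moreover have "\<kappa> * ?\<rho> / sqrt (real N) \<le> x t" using 1 step by (simp add: mult.commute)
    ultimately have "x (Suc t) = x t * (1 - cN * ?st t)" using drift_step[of t] step by simp
    then show ?case using step prS[of t] by simp
  qed
  \<comment> \<open>The product bound reaches only to \<open>pr N\<close>, so the last iterate in
    the sum, \<open>x (Suc N)\<close>, is merely bounded below by 0. The loss is covered by
    \<open>N \<ge> 2\<close>, which makes \<open>(N - 1) / N\<close> at least
    \<open>1 / 2\<close>.\<close>
  have "(\<Sum>k<N. x (k + 2)) = (\<Sum>k<N - 1. x (k + 2)) + x (Suc N)"
    using N by (cases N) (auto simp: numeral_2_eq_2)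
  moreover have "real (N - 1) * (\<kappa> * ?\<rho> / sqrt (real N)) \<le> (\<Sum>k<N - 1. x (k + 2))"
  proof -
    have "(\<Sum>k<N - 1. \<kappa> * ?\<rho> / sqrt (real N)) \<le> (\<Sum>k<N - 1. x (k + 2))"
    proof (rule sum_mono)
      fix k assume "k \<in> {..<N - 1}"
      then have k: "2 \<le> k + 2" "k + 2 \<le> N" by auto
      have "\<kappa> * (?\<rho> / sqrt (real N)) \<le> pr (k + 2) * (?\<rho> / sqrt (real N))"
        using pr_ge[OF k] \<rho>0 by (intro mult_right_mono) auto
      then show "\<kappa> * ?\<rho> / sqrt (real N) \<le> x (k + 2)" using xt[of "k + 2"] k by (simp add: mult.commute)
    qed
    then show ?thesis by simp
  qed
  moreover have "0 \<le> x (Suc N)"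
  proof -
    have "0 \<le> pr (Suc N)" unfolding pr_def using fac by (intro prod_nonneg) auto
    then show ?thesis using xt[of "Suc N"] N \<rho>0 by simp
  qed
  ultimately have "real (N - 1) * (\<kappa> * ?\<rho> / sqrt (real N)) \<le> (\<Sum>k<N. x (k + 2))" by linarith
  then have "real (N - 1) * (\<kappa> * ?\<rho> / sqrt (real N)) / sqrt (real N) \<le> (\<Sum>k<N. x (k + 2)) / sqrt (real N)"
    by (intro divide_right_mono) auto
  moreover have "real (N - 1) * (\<kappa> * ?\<rho> / sqrt (real N)) / sqrt (real N) = \<kappa> * ?\<rho> * (real (N - 1) / real N)"
    by simp
  moreover have "\<kappa> * ?\<rho> * (1 / 2) \<le> \<kappa> * ?\<rho> * (real (N - 1) / real N)"
    using \<kappa> \<rho>0 N by (intro mult_left_mono) (auto simp: field_simps of_nat_diff)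
  moreover have "oracle_path ?st ?M N \<omega> 1 = (\<Sum>k<N. x (k + 2)) / sqrt (real N)"
    using oracle_path_endpoint[of N ?st ?M \<omega>] N by (simp add: x_def)
  ultimately show ?thesis by linarith
qed

text \<open>The target is the zero path and gives no mass to the neighbourhood of the paths whose
  endpoint exceeds \<open>\<kappa> * \<rho> / 4\<close>, where \<open>\<rho>\<close> is
  \<open>nl_rho \<alpha> q T\<close>, whereas success yields such an endpoint with probability
  \<open>\<rho>\<close>.\<close>

lemma nl_lower_bound:
  fixes \<eta> \<alpha> q lam c0 \<kappa> :: real and N1 :: nat
  assumes "0 < \<eta>" "0 \<le> \<alpha>" and chi: "smooth_cutoff chi" and "0 < c0" "0 < \<kappa>"
    and nl_N1: "\<And>N. N \<ge> N1 \<Longrightarrow> c0 * real N powr (\<alpha> - 1) * \<eta> \<le> 1/2 \<and>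
        nl_rho \<alpha> q N \<le> 1/2 \<and>
        (\<Prod>s = 2..N - 1. 1 - c0 * real N powr (\<alpha> - 1) * step_size \<eta> \<alpha> s) \<ge> \<kappa> \<and>
        2 * nl_rho \<alpha> q N powr (1/2) < \<kappa>"
    and nl: "\<And>N. N \<ge> N1 \<Longrightarrow> bernoulli_variable (nl_rho \<alpha> q N) (P N) (b N)"
    and Q: "prob_space Q"
  shows "\<exists>c>0. \<exists>T0. \<forall>T\<ge>T0. c * real T powr (- a_nl \<alpha> q) \<le>
    prokhorov_dist (path_law (pmeasure (nl_oracle \<eta> \<alpha> q lam c0 chi (P T) (b T) T))
        (oracle_path (step_size \<eta> \<alpha>) (nl_oracle \<eta> \<alpha> q lam c0 chi (P T) (b T) T) T))
      (path_law Q (target_path B (nl_oracle \<eta> \<alpha> q lam c0 chi (P T) (b T) T)))"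
\<comment> \<open>The factor \<open>\<kappa> / 4\<close> keeps the zero path out of every
  neighbourhood considered, and 1 keeps the radius below the success probability.\<close>
proof (intro exI[of _ "min (\<kappa> / 4) 1"] conjI exI[of _ "max N1 2"] allI impI)
  show "0 < min (\<kappa> / 4) 1" using \<open>0 < \<kappa>\<close> by simp
  fix T :: nat assume T: "max N1 2 \<le> T"
  let ?\<rho> = "nl_rho \<alpha> q T"
  let ?M = "nl_oracle \<eta> \<alpha> q lam c0 chi (P T) (b T) T"
  have bern: "bernoulli_variable ?\<rho> (P T) (b T)" using nl T by simp
  have P: "prob_space (P T)" and bm [measurable]: "b T \<in> measurable (P T) (count_space UNIV)"
    and dist: "distr (P T) (count_space UNIV) (b T) = measure_pmf (bernoulli_pmf ?\<rho>)"
    using bern by (auto simp: bernoulli_variable_def)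
  interpret prob_space "P T" by fact
  have \<rho>0: "0 < ?\<rho>" "?\<rho> \<le> 1" using nl_N1[of T] T by (auto simp: nl_rho_def)
  have pb: "measure (P T) {\<omega>\<in>space (P T). b T \<omega>} = ?\<rho>"
  proof -
    have "measure (P T) (b T -` {True} \<inter> space (P T)) = measure (distr (P T) (count_space UNIV) (b T)) {True}"
      using bm by (subst measure_distr) auto
    also have "\<dots> = ?\<rho>" unfolding dist using \<rho>0 by (simp add: measure_pmf_single)
    finally show ?thesis by (simp add: vimage_def Int_def conj_commute)
  qed
  have tgt: "target_path B ?M = (\<lambda>\<omega> r. 0)"
    using lim_variance_nl_oracle[OF P bm] by (intro ext) (simp add: target_path_def)
  have [measurable]: "chi \<in> borel_measurable borel" using chi by (rule smooth_cutoff_measurable)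
  have drift: "drift ?M \<in> borel_measurable borel"
    unfolding nl_oracle_def nl_drift_def[abs_def] by simp
  have noise: "noise ?M t \<in> borel_measurable (P T)" for t
    unfolding nl_oracle_def by simp
  have pm: "pmeasure ?M = P T" by (simp add: nl_oracle_def)
  have main: "min (\<kappa> / 4) 1 * ?\<rho> \<le> prokhorov_dist (path_law (P T) (oracle_path (step_size \<eta> \<alpha>) ?M T)) (path_law Q (\<lambda>\<omega> r. 0))"
  proof (rule prokhorov_dist_ge)
    fix \<delta> :: real assume \<delta>: "0 < \<delta>" "\<delta> < min (\<kappa> / 4) 1 * ?\<rho>"
    have \<delta>1: "\<delta> < \<kappa> / 4 * ?\<rho>" "\<delta> < ?\<rho>"
      using \<delta>(2) \<rho>0 mult_right_mono[of "min (\<kappa> / 4) 1" "\<kappa> / 4" ?\<rho>] mult_right_mono[of "min (\<kappa> / 4) 1" 1 ?\<rho>] by linarith+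
    let ?\<Gamma> = "{f \<in> skorokhod_paths. \<kappa> * ?\<rho> / 4 < \<bar>f 1\<bar>}"
    have "measure (path_law Q (\<lambda>\<omega> r. 0)) (skorokhod_nbhd ?\<Gamma> \<delta>) \<le> measure Q {}"
    proof (rule measure_path_law_le[OF Q])
      fix \<omega>
      show "restrict (\<lambda>r. 0) {0..1} \<notin> skorokhod_nbhd ?\<Gamma> \<delta>"
      proof
        assume "restrict (\<lambda>r. 0) {0..1} \<in> skorokhod_nbhd ?\<Gamma> \<delta>"
        then show False
        proof (rule nbhd_endpoint_close)
          fix f assume "f \<in> ?\<Gamma>" "\<bar>f 1 - restrict (\<lambda>r. 0) {0..1} (1::real)\<bar> < \<delta>"
          then show False using \<delta>1 by simp
        qed
      qed
    qed simp
    moreover have "?\<rho> \<le> measure (path_law (P T) (oracle_path (step_size \<eta> \<alpha>) ?M T)) ?\<Gamma>"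
    proof -
      note ml = measure_oracle_path_law[OF drift noise endpoint_greater_sets]
      have "measure (P T) {\<omega>\<in>space (P T). b T \<omega>} \<le> measure (P T) {\<omega>\<in>space (P T). restrict (oracle_path (step_size \<eta> \<alpha>) ?M T \<omega>) {0..1} \<in> ?\<Gamma>}"
      proof (rule finite_measure_mono[OF _ ml(2)])
        show "{\<omega>\<in>space (P T). b T \<omega>} \<subseteq> {\<omega>\<in>space (P T). restrict (oracle_path (step_size \<eta> \<alpha>) ?M T \<omega>) {0..1} \<in> ?\<Gamma>}"
        proof
          fix \<omega> assume "\<omega> \<in> {\<omega>\<in>space (P T). b T \<omega>}"
          then have \<omega>: "\<omega> \<in> space (P T)" "b T \<omega>" by auto
          have "restrict (oracle_path (step_size \<eta> \<alpha>) ?M T \<omega>) {0..1} \<in> skorokhod_paths"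
            by (rule continuous_skorokhod_path[OF continuous_oracle_path])
          moreover have "\<kappa> * ?\<rho> / 2 \<le> oracle_path (step_size \<eta> \<alpha>) ?M T \<omega> 1"
            using assms nl_N1[of T] T \<omega> by (intro nl_path_endpoint) auto
          moreover have "0 < \<kappa> * ?\<rho>" using \<rho>0 \<open>0 < \<kappa>\<close> by simp
          ultimately show "\<omega> \<in> {\<omega>\<in>space (P T). restrict (oracle_path (step_size \<eta> \<alpha>) ?M T \<omega>) {0..1} \<in> ?\<Gamma>}"
            using \<omega> by simp
        qed
      qed
      then show ?thesis unfolding pb ml(1) .
    qed
    ultimately show "\<exists>\<Gamma>\<in>sets skorokhod_borel.
      measure (path_law Q (\<lambda>\<omega> r. 0)) (skorokhod_nbhd \<Gamma> \<delta>) + \<delta> < measure (path_law (P T) (oracle_path (step_size \<eta> \<alpha>) ?M T)) \<Gamma> \<or>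
      measure (path_law (P T) (oracle_path (step_size \<eta> \<alpha>) ?M T)) (skorokhod_nbhd \<Gamma> \<delta>) + \<delta> < measure (path_law Q (\<lambda>\<omega> r. 0)) \<Gamma>"
      using \<delta>1 endpoint_greater_sets[of "\<kappa> * ?\<rho> / 4"] by (intro bexI[of _ ?\<Gamma>]) auto
  qed (use P Q in \<open>auto simp: path_law_def intro: measure_distr_le_1\<close>)
  then show "min (\<kappa> / 4) 1 * real T powr (- a_nl \<alpha> q) \<le>
    prokhorov_dist (path_law (pmeasure ?M) (oracle_path (step_size \<eta> \<alpha>) ?M T)) (path_law Q (target_path B ?M))"
    unfolding tgt pm by (simp add: nl_rho_def)
qed

section \<open>The smoothing class\<close>

text \<open>Sums over blocks are Gaussian, and there are at most \<open>N * N\<close> blocks. The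
  factor 6 makes each tail at most \<open>2 / N ^ 3\<close>, so the union bound leaves
  \<open>2 / N\<close>. Outside the exceptional set the walk is Hoelder of exponent
  \<open>1/2\<close> on the integers, at the price of a logarithm only.\<close>

lemma gaussian_walk_bound:
  assumes \<xi>: "gaussian_noise P \<xi>" and N: "1 \<le> N"
  obtains bad where "bad \<in> sets P" "measure P bad \<le> 2 / real N"
    "\<And>\<omega> i j. \<omega> \<in> space P \<Longrightarrow> \<omega> \<notin> bad \<Longrightarrow> i \<le> j \<Longrightarrow> j \<le> N \<Longrightarrow>
      \<bar>\<Sum>k\<in>{i<..j}. \<xi> k \<omega>\<bar> \<le> sqrt (6 * ln (real N)) * real (j - i) powr (1/2)"
proof -
  have P: "prob_space P" and ind: "prob_space.indep_vars P (\<lambda>_. borel) \<xi> {1..}"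
    and d: "\<And>j. 1 \<le> j \<Longrightarrow> distributed P lborel (\<xi> j) std_normal_density"
    using \<xi> by (auto simp: gaussian_noise_def)
  interpret prob_space P by fact
  define y where "y = sqrt (6 * ln (real N))"
  have y: "0 \<le> y" "y\<^sup>2 = 6 * ln (real N)" using N by (auto simp: y_def)
  define E where "E i j = {\<omega>\<in>space P. y * sqrt (real (j - i)) < \<bar>\<Sum>k\<in>{i<..j}. \<xi> k \<omega>\<bar>}" for i j
  have m: "\<xi> k \<in> borel_measurable P" if "1 \<le> k" for k using d[OF that] distributed_measurable by fastforce
  have E: "E i j \<in> sets P" "i < j \<Longrightarrow> measure P (E i j) \<le> 2 / real N ^ 3" for i j
  proof -
    have "(\<lambda>\<omega>. \<Sum>k\<in>{i<..j}. \<xi> k \<omega>) \<in> borel_measurable P"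
      by (intro borel_measurable_sum m) auto
    then show "E i j \<in> sets P" unfolding E_def by measurable
    assume ij: "i < j"
    have "distributed P lborel (\<lambda>\<omega>. \<Sum>k\<in>{i<..j}. \<xi> k \<omega>)
        (normal_density (\<Sum>k\<in>{i<..j}. 0) (sqrt (\<Sum>k\<in>{i<..j}. 1\<^sup>2)))"
      using ij d by (intro sum_indep_normal indep_vars_subset[OF ind]) auto
    then have "distributed P lborel (\<lambda>\<omega>. \<Sum>k\<in>{i<..j}. \<xi> k \<omega>) (normal_density 0 (sqrt (real (j - i))))"
      by simp
    from normal_tail[OF P this _ y(1)] have "measure P (E i j) \<le> 2 * exp (- y\<^sup>2 / 2)"
      using ij by (simp add: E_def)
    also have "exp (- y\<^sup>2 / 2) = 1 / real N ^ 3"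
    proof -
      have "exp (- y\<^sup>2 / 2) = exp (- (3 * ln (real N)))" using y by simp
      also have "\<dots> = 1 / exp (ln (real N)) ^ 3" by (simp add: exp_minus exp_of_nat_mult[symmetric] inverse_eq_divide)
      finally show ?thesis using N by simp
    qed
    finally show "measure P (E i j) \<le> 2 / real N ^ 3" by simp
  qed
  define I where "I = {(i, j). i < j \<and> j \<le> N}"
  have I: "I \<subseteq> {..<N} \<times> {1..N}" by (auto simp: I_def)
  then have fI: "finite I" by (rule finite_subset) auto
  have cI: "card I \<le> N * N" using card_mono[OF _ I] by simp
  show thesis
  proof (rule that[of "\<Union>(i, j)\<in>I. E i j"])
    show "(\<Union>(i, j)\<in>I. E i j) \<in> sets P" using fI E(1) by auto
    have "measure P (\<Union>ij\<in>I. case ij of (i, j) \<Rightarrow> E i j) \<le> (\<Sum>ij\<in>I. measure P (case ij of (i, j) \<Rightarrow> E i j))"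
      using fI E(1) by (intro finite_measure_subadditive_finite) auto
    also have "\<dots> \<le> (\<Sum>ij\<in>I. 2 / real N ^ 3)"
      using E(2) by (intro sum_mono) (auto simp: I_def)
    also have "\<dots> = real (card I) * (2 / real N ^ 3)" by simp
    also have "\<dots> \<le> real (N * N) * (2 / real N ^ 3)"
      using cI N by (intro mult_right_mono) (auto simp only: of_nat_le_iff zero_le_divide_iff, auto)
    also have "\<dots> = 2 / real N" using N by (simp add: power3_eq_cube)
    finally show "measure P (\<Union>(i, j)\<in>I. E i j) \<le> 2 / real N" .
    fix \<omega> i j assume \<omega>: "\<omega> \<in> space P" "\<omega> \<notin> (\<Union>(i, j)\<in>I. E i j)" and ij: "i \<le> j" "j \<le> N"
    show "\<bar>\<Sum>k\<in>{i<..j}. \<xi> k \<omega>\<bar> \<le> sqrt (6 * ln (real N)) * real (j - i) powr (1/2)"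
    proof (cases "i = j")
      case False
      then have "(i, j) \<in> I" using ij by (simp add: I_def)
      then have "\<omega> \<notin> E i j" using \<omega> by blast
      then show ?thesis using \<omega> by (simp add: E_def y_def powr_half_sqrt)
    qed simp
  qed
qed

lemma linear_recursion:
  assumes "drift M = (\<lambda>x. x)" "1 \<le> t"
  shows "iterate st M (Suc t) \<omega> = (1 - st t) * iterate st M t \<omega> + st t * noise M t \<omega>"
  using assms by (simp add: iterate.simps(2) algebra_simps)

text \<open>The second half of the unit interval contains about \<open>1 / h\<close> disjoint
  windows of length \<open>h / 2\<close>, on which the increments are independent. Each exceeds
  \<open>a\<close> with at least the probability \<open>p\<close> of the proof, so all of them stay
  within \<open>a\<close> with probability at most
  \<open>(1 - p) ^ m \<le> exp (- (m * p))\<close>.\<close>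

lemma Brownian_oscillation_prob:
  assumes B: "standard_brownian_motion_on {0..1} Q B" and h: "0 < h" "h \<le> 1/2" and a: "0 < a"
  shows "1 - exp (- ((1 / h - 2) * (exp (- 4) / sqrt (2 * pi) * exp (- (2 * a\<^sup>2 / h))))) \<le>
    measure (path_law Q (\<lambda>\<omega> r. B r \<omega>)) (osc_paths (1/2) h a)"
proof -
  interpret prob_space Q using B by (simp add: standard_brownian_motion_on_def)
  have bm: "B t \<in> borel_measurable Q" if "t \<in> {0..1}" for t
    using B that by (simp add: standard_brownian_motion_on_def)
  define m where "m = nat \<lfloor>1 / h\<rfloor> - 1"
  have f: "2 \<le> \<lfloor>1 / h\<rfloor>" using h by (simp add: le_floor_iff field_simps)
  then have "int m = \<lfloor>1 / h\<rfloor> - 1" unfolding m_def by linarith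
  then have rm: "real m = real_of_int \<lfloor>1 / h\<rfloor> - 1" by (metis of_int_1 of_int_diff of_int_of_nat_eq)
  then have m: "1 / h - 2 \<le> real m" "real m + 1 \<le> 1 / h" by linarith+
  have m1: "1 \<le> m" using f unfolding m_def by linarith
  then have "0 \<in> {..<m}" by simp
  then have ne: "{..<m} \<noteq> {}" by blast
  \<comment> \<open>The shift by one window makes the first time exceed \<open>1/2\<close> strictly,
    and the length \<open>h / 2\<close> stays strictly below \<open>h\<close>, as
    \<open>osc_paths\<close> demands.\<close>
  define \<tau> where "\<tau> i = 1/2 + (real i + 1) * (h / 2)" for i :: nat
  have \<tau>: "1/2 < \<tau> i" "i \<le> m \<Longrightarrow> \<tau> i \<le> 1" "\<tau> (Suc i) - \<tau> i = h / 2" for i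
  proof -
    show "1/2 < \<tau> i" using h by (simp add: \<tau>_def)
    show "\<tau> (Suc i) - \<tau> i = h / 2" by (simp add: \<tau>_def field_simps)
    assume "i \<le> m"
    then have "(real i + 1) * h \<le> 1 / h * h" using m h by (intro mult_right_mono) auto
    then show "\<tau> i \<le> 1" using h by (simp add: \<tau>_def)
  qed
  have mono: "strict_mono_on {..m} \<tau>" using h by (auto simp: strict_mono_on_def \<tau>_def)
  have range: "\<tau> ` {..m} \<subseteq> {0..1}" 
  proof (rule image_subsetI)
    fix i assume "i \<in> {..m}"
    then have "1/2 < \<tau> i" "\<tau> i \<le> 1" using \<tau>(1,2)[of i] by auto
    then show "\<tau> i \<in> {0..1}" by simp
  qed
  define X where "X i \<omega> = B (\<tau> (Suc i)) \<omega> - B (\<tau> i) \<omega>" for i \<omega>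
  have ind: "indep_vars (\<lambda>_. borel) X {..<m}"
    using B range mono unfolding standard_brownian_motion_on_def X_def by blast
  define \<sigma> where "\<sigma> = sqrt (h / 2)"
  have \<sigma>: "0 < \<sigma>" "\<sigma>\<^sup>2 = h / 2" using h by (auto simp: \<sigma>_def)
  \<comment> \<open>A lower bound for the mass of \<open>[a + \<sigma>, a + 2 * \<sigma>]\<close>:
    interval length times the density at the right end, with \<open>(a + 2 * \<sigma>)\<^sup>2 \<le>
    2 * a\<^sup>2 + 8 * \<sigma>\<^sup>2\<close> in the exponent.\<close>
  define p where "p = exp (- 4) / sqrt (2 * pi) * exp (- (2 * a\<^sup>2 / h))"
  have X: "measure Q (X i -` {- a..a} \<inter> space Q) \<le> 1 - p" if i: "i < m" for i
  proof -
    have "\<tau> i \<in> {0..1}" "\<tau> (Suc i) \<in> {0..1}" using range i by (simp_all only: image_subset_iff atMost_iff)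
    moreover have "\<tau> i < \<tau> (Suc i)" using \<tau>(3)[of i] h by linarith
    ultimately have D: "distributed Q lborel (X i) (normal_density 0 \<sigma>)"
      using Brownian_increment[OF B, of "\<tau> i" "\<tau> (Suc i)"] unfolding X_def \<sigma>_def \<tau>(3) by simp
    have [measurable]: "X i \<in> borel_measurable Q" using distributed_measurable[OF D] by simp
    have "p \<le> normal_density 0 \<sigma> (a + 2 * \<sigma>) * (a + 2 * \<sigma> - (a + \<sigma>))"
    proof -
      have "(a + 2 * \<sigma>)\<^sup>2 \<le> 2 * a\<^sup>2 + 8 * \<sigma>\<^sup>2"
        using zero_le_power2[of "a - 2 * \<sigma>"] by (simp add: power2_eq_square algebra_simps)
      then have "(a + 2 * \<sigma>)\<^sup>2 / (2 * \<sigma>\<^sup>2) \<le> (2 * a\<^sup>2 + 8 * \<sigma>\<^sup>2) / (2 * \<sigma>\<^sup>2)"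
        by (intro divide_right_mono) auto
      also have "\<dots> = 2 * a\<^sup>2 / h + 4" using \<sigma> h by (simp add: field_simps)
      finally have "exp (- 4 + - (2 * a\<^sup>2 / h)) \<le> exp (- (a + 2 * \<sigma>)\<^sup>2 / (2 * \<sigma>\<^sup>2))" by simp
      then have "exp (- 4) * exp (- (2 * a\<^sup>2 / h)) \<le> exp (- (a + 2 * \<sigma>)\<^sup>2 / (2 * \<sigma>\<^sup>2))"
        by (simp only: exp_add)
      then have "p \<le> exp (- (a + 2 * \<sigma>)\<^sup>2 / (2 * \<sigma>\<^sup>2)) / sqrt (2 * pi)"
        unfolding p_def by (simp add: divide_right_mono)
      also have "\<dots> = normal_density 0 \<sigma> (a + 2 * \<sigma>) * \<sigma>"
        using \<sigma>(1) by (simp add: normal_density_def real_sqrt_mult)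
      finally show ?thesis by simp
    qed
    also have "\<dots> \<le> measure Q {\<omega>\<in>space Q. a + \<sigma> \<le> X i \<omega> \<and> X i \<omega> \<le> a + 2 * \<sigma>}"
      using \<sigma> a by (intro distributed_interval_ge[OF prob_space_axioms D] normal_density_ge) auto
    also have "\<dots> \<le> measure Q (space Q - (X i -` {- a..a} \<inter> space Q))"
      using \<sigma> by (intro finite_measure_mono) auto
    also have "\<dots> = 1 - measure Q (X i -` {- a..a} \<inter> space Q)"
      by (intro prob_compl) measurable
    finally show ?thesis by simp
  qed
  let ?S = "{\<omega>\<in>space Q. (\<lambda>r\<in>{0..1}. B r \<omega>) \<in> osc_paths (1/2) h a}"
  have S: "?S \<in> sets Q" by (rule measure_Brownian_law(2)[OF B osc_paths_sets]) simp
  have "space Q - ?S \<subseteq> (\<Inter>i\<in>{..<m}. X i -` {- a..a} \<inter> space Q)"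
  proof
    fix \<omega> assume \<omega>: "\<omega> \<in> space Q - ?S"
    have c: "continuous_on {0..1} (\<lambda>r. B r \<omega>)" using B \<omega> by (simp add: standard_brownian_motion_on_def)
    have "\<bar>X i \<omega>\<bar> \<le> a" if i: "i < m" for i
    proof (rule ccontr)
      assume "\<not> ?thesis"
      moreover have "\<tau> (Suc i) \<le> 1" "1/2 < \<tau> i" "\<tau> i < \<tau> (Suc i)" "\<tau> (Suc i) - \<tau> i < h" "\<tau> i \<le> 1"
        using \<tau>[of i] \<tau>[of "Suc i"] i h by auto
      ultimately have "(\<lambda>r\<in>{0..1}. B r \<omega>) \<in> osc_paths (1/2) h a"
        unfolding osc_paths_def using continuous_skorokhod_path[OF c]
        by (intro CollectI conjI exI[of _ "\<tau> i"] exI[of _ "\<tau> (Suc i)"]) (auto simp: X_def)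
      then show False using \<omega> by simp
    qed
    then show "\<omega> \<in> (\<Inter>i\<in>{..<m}. X i -` {- a..a} \<inter> space Q)"
      using \<omega> by (auto simp: abs_le_iff minus_le_iff)
  qed
  then have "measure Q (space Q - ?S) \<le> measure Q (\<Inter>i\<in>{..<m}. X i -` {- a..a} \<inter> space Q)"
  proof (rule finite_measure_mono)
    have "X i \<in> borel_measurable Q" if "i < m" for i using ind that by (auto simp: indep_vars_def)
    then show "(\<Inter>i\<in>{..<m}. X i -` {- a..a} \<inter> space Q) \<in> sets Q"
      using ne by (intro sets.finite_INT) (auto intro: measurable_sets)
  qed
  also have "\<dots> = (\<Prod>i<m. measure Q (X i -` {- a..a} \<inter> space Q))"
    using ne by (intro indep_varsD_finite[OF ind]) auto
  also have "\<dots> \<le> (\<Prod>i<m. 1 - p)"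
    using X by (intro prod_mono) auto
  also have "\<dots> = (1 - p) ^ m" by simp
  also have "\<dots> \<le> exp (- p) ^ m"
  proof (rule power_mono)
    show "1 - p \<le> exp (- p)" using exp_ge_add_one_self[of "- p"] by simp
    show "0 \<le> 1 - p" using X[of 0] m1 order_trans[OF measure_nonneg] by (metis One_nat_def Suc_le_eq)
  qed
  also have "\<dots> = exp (- (real m * p))" by (simp add: exp_of_nat_mult[symmetric])
  also have "\<dots> \<le> exp (- ((1 / h - 2) * p))"
  proof -
    have "0 \<le> p" by (simp add: p_def)
    from mult_right_mono[OF m(1) this] show ?thesis by simp
  qed
  finally have "measure Q (space Q - ?S) \<le> exp (- ((1 / h - 2) * p))" .
  moreover have "measure Q (space Q - ?S) = 1 - measure Q ?S" using S by (rule prob_compl)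
  moreover have "measure (path_law Q (\<lambda>\<omega> r. B r \<omega>)) (osc_paths (1/2) h a) = measure Q ?S"
    by (rule measure_Brownian_law(1)[OF B osc_paths_sets]) simp
  ultimately show ?thesis unfolding p_def by linarith
qed

text \<open>Over windows of length \<open>h = s * T powr (\<alpha> - 1)\<close> the path moves at
  most by order \<open>s * T powr (- a_sm \<alpha>) * sqrt (ln T)\<close>, Brownian motion by order
  \<open>sqrt s\<close> times the same rate. For small \<open>s\<close> the second dominates, with a
  gap of the size of the rate.\<close>

lemma sm_lower_bound:
  fixes \<eta> \<alpha> :: real
  assumes \<eta>: "0 < \<eta>" and \<alpha>: "0 < \<alpha>" "\<alpha> < 1" and \<xi>: "gaussian_noise P \<xi>"
    and B: "standard_brownian_motion_on {0..1} Q B"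
  shows "\<exists>c>0. \<exists>T0. \<forall>T\<ge>T0. c * (real T powr (- a_sm \<alpha>) * sqrt (ln (real T))) \<le>
    prokhorov_dist (path_law (pmeasure (linear_oracle P \<xi>)) (oracle_path (step_size \<eta> \<alpha>) (linear_oracle P \<xi>) T))
      (path_law Q (target_path B (linear_oracle P \<xi>)))"
proof -
  let ?M = "linear_oracle P \<xi>" and ?st = "step_size \<eta> \<alpha>"
  have P: "prob_space P" and ind: "prob_space.indep_vars P (\<lambda>_. borel) \<xi> {1..}"
    and d: "\<And>j. 1 \<le> j \<Longrightarrow> distributed P lborel (\<xi> j) std_normal_density"
    using \<xi> by (auto simp: gaussian_noise_def)
  interpret P: prob_space P by fact
  have Q: "prob_space Q" using B by (simp add: standard_brownian_motion_on_def)
  have "lim_variance ?M = 1"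
    by (rule lim_variance_linear_oracle[OF P ind]) (use normal_even_moment[OF P d, of _ 1] in simp_all)
  then have tgt: "target_path B ?M = (\<lambda>\<omega> r. B r \<omega>)"
    by (intro target_path_unit lin_coeff_linear_oracle)
  have half: "0 < (1/2::real)" "(1/2::real) < 1" by simp_all
  show ?thesis
  proof (rule recursion_Holder_bound[OF \<eta> \<alpha> half])
    fix A :: real assume A: "A \<ge> 1" and rb: "\<And>x Z H N n. x (1::nat) = (0::real) \<Longrightarrow> 0 \<le> H \<Longrightarrow>
       (\<And>t. 1 \<le> t \<Longrightarrow> t \<le> N \<Longrightarrow> x (Suc t) = (1 - ?st t) * x t + ?st t * (Z t - Z (t - 1))) \<Longrightarrow>
       (\<And>i j. i \<le> j \<Longrightarrow> j \<le> N \<Longrightarrow> \<bar>Z j - Z i\<bar> \<le> H * real (j - i) powr (1/2)) \<Longrightarrow>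
       1 \<le> n \<Longrightarrow> n \<le> N \<Longrightarrow> \<bar>x (Suc n)\<bar> \<le> A * H * real n powr (- (\<alpha> * (1 - 1/2)))"
    \<comment> \<open>Two requirements fix these constants. \<open>\<kappa>\<^sup>2 = s * cc\<close>
      makes \<open>2 * (a T)\<^sup>2 / h T\<close> equal to
      \<open>(1 - \<alpha>) / 2 * ln T\<close>, so a single window oscillates with probability at
      least of order \<open>T powr (- (1 - \<alpha>) / 2)\<close>, while the number of windows has
      order \<open>T powr (1 - \<alpha>)\<close>. \<open>10 * A * s = \<kappa> / 2\<close> makes the
      path oscillate by at most half of \<open>a T\<close>.\<close>
    define cc where "cc = (1 - \<alpha>) / 4"
    define \<kappa> where "\<kappa> = cc / (20 * A)"
    define s where "s = \<kappa> / (20 * A)"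
    have pos: "0 < cc" "0 < \<kappa>" "0 < s" using \<alpha> A by (auto simp: cc_def \<kappa>_def s_def)
    define h where "h T = s * real T powr (- (1 - \<alpha>))" for T :: nat
    define a where "a T = \<kappa> * (real T powr (- a_sm \<alpha>) * sqrt (ln (real T)))" for T :: nat
    have "\<forall>\<^sub>F T::nat in sequentially. exp (- ((1 / (s * real T powr (- (1 - \<alpha>))) - 2) *
        (exp (- 4) / sqrt (2 * pi) * real T powr (- ((1 - \<alpha>) / 2))))) \<le> 1/4"
      using pos \<alpha> by real_asymp
    moreover have "\<forall>\<^sub>F T::nat in sequentially. s * real T powr (- (1 - \<alpha>)) \<le> 1/2"
      using pos \<alpha> by real_asymp
    moreover have "\<forall>\<^sub>F T::nat in sequentially. \<kappa> * (real T powr (- ((1 - \<alpha>) / 2)) * sqrt (ln (real T))) \<le> 1"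
      using pos \<alpha> by real_asymp
    moreover have "\<forall>\<^sub>F T::nat in sequentially. 8 \<le> T" by (rule eventually_ge_at_top)
    ultimately have "\<forall>\<^sub>F T::nat in sequentially. exp (- ((1 / h T - 2) *
        (exp (- 4) / sqrt (2 * pi) * real T powr (- ((1 - \<alpha>) / 2))))) \<le> 1/4 \<and> h T \<le> 1/2 \<and> a T \<le> 1 \<and> 8 \<le> T"
      unfolding h_def a_def a_sm_def by eventually_elim auto
    then obtain T0 where T0: "\<And>T. T0 \<le> T \<Longrightarrow> exp (- ((1 / h T - 2) *
        (exp (- 4) / sqrt (2 * pi) * real T powr (- ((1 - \<alpha>) / 2))))) \<le> 1/4 \<and> h T \<le> 1/2 \<and> a T \<le> 1 \<and> 8 \<le> T"
      unfolding eventually_sequentially by blast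
    have "a T / 4 \<le> prokhorov_dist (path_law P (oracle_path ?st ?M T)) (path_law Q (\<lambda>\<omega> r. B r \<omega>))" if T: "T0 \<le> T" for T
    proof (rule prokhorov_dist_ge)
      have T8: "8 \<le> T" and hT: "h T \<le> 1/2" "0 < h T" and aT: "a T \<le> 1" "0 < a T"
        using T0[OF T] pos by (auto simp: h_def a_def)
      fix \<delta> :: real assume \<delta>: "0 < \<delta>" "\<delta> < a T / 4"
      let ?\<Gamma> = "osc_paths (1/2) (h T) (a T)"
      have e2: "exp \<delta> \<le> 2"
      proof -
        have "exp \<delta> \<le> 1 + \<delta> + \<delta>\<^sup>2" using \<delta> aT by (intro exp_bound) auto
        also have "\<dots> \<le> 1 + 1 / 4 + (1 / 4)\<^sup>2" using \<delta> aT by (intro add_mono power_mono) auto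
        finally show ?thesis by (simp add: power2_eq_square)
      qed
      then have em2: "1/2 \<le> exp (- \<delta>)" by (simp add: exp_minus field_simps)
      have \<nu>: "3/4 \<le> measure (path_law Q (\<lambda>\<omega> r. B r \<omega>)) ?\<Gamma>"
      proof -
        have "2 * (a T)\<^sup>2 / h T = (1 - \<alpha>) / 2 * ln (real T)"
        proof -
          have "(real T powr (- a_sm \<alpha>))\<^sup>2 = real T powr (- (1 - \<alpha>))"
            using T8 by (simp add: a_sm_def power2_eq_square powr_add[symmetric])
          then have "(a T)\<^sup>2 = \<kappa>\<^sup>2 * real T powr (- (1 - \<alpha>)) * ln (real T)"
            using T8 by (simp add: a_def power_mult_distrib)
          moreover have "\<kappa>\<^sup>2 = s * cc" using A by (simp add: s_def \<kappa>_def power2_eq_square)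
          ultimately have "(a T)\<^sup>2 = h T * (cc * ln (real T))" by (simp add: h_def)
          then have "(a T)\<^sup>2 / h T = cc * ln (real T)" using hT(2) by (simp add: nonzero_divide_eq_eq mult.commute)
          moreover have "2 * (a T)\<^sup>2 / h T = 2 * ((a T)\<^sup>2 / h T)" by simp
          ultimately show ?thesis unfolding cc_def by linarith
        qed
        then have "exp (- (2 * (a T)\<^sup>2 / h T)) = real T powr (- ((1 - \<alpha>) / 2))"
          using T8 by (simp add: powr_def)
        then show ?thesis using Brownian_oscillation_prob[OF B hT(2,1) aT(2)] T0[OF T] by simp
      qed
      obtain bad where bad: "bad \<in> sets P" "measure P bad \<le> 2 / real T"
        "\<And>\<omega> i j. \<omega> \<in> space P \<Longrightarrow> \<omega> \<notin> bad \<Longrightarrow> i \<le> j \<Longrightarrow> j \<le> T \<Longrightarrow>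
          \<bar>\<Sum>k\<in>{i<..j}. \<xi> k \<omega>\<bar> \<le> sqrt (6 * ln (real T)) * real (j - i) powr (1/2)"
        using gaussian_walk_bound[OF \<xi>, of T] T8 by auto
      have "measure (path_law P (oracle_path ?st ?M T)) (skorokhod_nbhd ?\<Gamma> \<delta>) \<le> measure P bad"
      proof (rule measure_path_law_le[OF P bad(1)])
        fix \<omega> assume \<omega>: "\<omega> \<in> space P" "\<omega> \<notin> bad"
        define x where "x t = iterate ?st ?M t \<omega>" for t
        define W where "W t = (\<Sum>k\<in>{0<..t}. \<xi> k \<omega>)" for t :: nat
        have Wd: "W j - W i = (\<Sum>k\<in>{i<..j}. \<xi> k \<omega>)" if "i \<le> j" for i j
        proof -
          have "{0<..j} = {0<..i} \<union> {i<..j}" using that by auto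
          then show ?thesis unfolding W_def by (subst \<open>{0<..j} = _\<close>) (auto simp: sum.union_disjoint)
        qed
        have xb: "\<bar>x (Suc n)\<bar> \<le> A * sqrt (6 * ln (real T)) * real n powr (- (\<alpha> * (1 - 1/2)))" if n: "1 \<le> n" "n \<le> T" for n
        proof (rule rb[of x "sqrt (6 * ln (real T))" T W n])
          show "x 1 = 0" by (simp add: x_def iterate.simps(2))
          fix t :: nat assume t: "1 \<le> t"
          have "{t - 1<..t} = {t}" using t by auto
          then show "x (Suc t) = (1 - ?st t) * x t + ?st t * (W t - W (t - 1))"
            using linear_recursion[of ?M t ?st \<omega>] t Wd[of "t - 1" t] by (simp add: x_def linear_oracle_def)
        next
          fix i j :: nat assume "i \<le> j" "j \<le> T"
          then show "\<bar>W j - W i\<bar> \<le> sqrt (6 * ln (real T)) * real (j - i) powr (1/2)"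
            using bad(3)[OF \<omega>] Wd by simp
        qed (use n T8 in auto)
        show "restrict (oracle_path ?st ?M T \<omega>) {0..1} \<notin> skorokhod_nbhd ?\<Gamma> \<delta>"
        proof
          assume *: "restrict (oracle_path ?st ?M T \<omega>) {0..1} \<in> skorokhod_nbhd ?\<Gamma> \<delta>"
          obtain u v where uv: "exp (- \<delta>) * (1/2) \<le> u" "0 \<le> u" "u < v" "v \<le> 1" "v - u \<le> exp \<delta> * h T"
            "a T - 2 * \<delta> < \<bar>oracle_path ?st ?M T \<omega> v - oracle_path ?st ?M T \<omega> u\<bar>"
            using nbhd_osc_paths[OF _ *] by (auto simp: restrict_def split: if_splits)
          \<comment> \<open>The offset \<open>1/2\<close> shrinks by at most the factor
            \<open>exp (- \<delta>)\<close>, so only iterates with index beyond \<open>T / 4\<close>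
            enter.\<close>
          have u4: "1/4 \<le> u" using uv(1) em2 by linarith
          let ?X = "A * sqrt (6 * ln (real T)) * (real T / 4) powr (- (\<alpha> / 2))"
          have "\<bar>oracle_path ?st ?M T \<omega> v - oracle_path ?st ?M T \<omega> u\<bar> \<le> sqrt (real T) * ?X * (v - u)"
          proof (rule oracle_path_Lipschitz[OF uv(2-4)])
            fix k assume k: "k < T" "real T * u < real k + 1"
            have "real T * (1/4) \<le> real T * u" using u4 by (intro mult_left_mono) auto
            then have kT: "real T / 4 \<le> real (k + 1)" using k(2) unfolding of_nat_add of_nat_1 by linarith
            have "\<bar>x (Suc (k + 1))\<bar> \<le> A * sqrt (6 * ln (real T)) * real (k + 1) powr (- (\<alpha> * (1 - 1/2)))"
              using k by (intro xb) auto
            also have "\<dots> \<le> A * sqrt (6 * ln (real T)) * (real T / 4) powr (- (\<alpha> * (1 - 1/2)))"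
              using kT T8 A \<alpha> by (intro mult_left_mono powr_mono2') auto
            finally show "\<bar>iterate ?st ?M (k + 2) \<omega>\<bar> \<le> ?X" by (simp add: x_def)
          qed
          also have "\<dots> \<le> sqrt (real T) * ?X * (2 * h T)"
          proof (rule mult_left_mono)
            have "exp \<delta> * h T \<le> 2 * h T" using e2 hT by (intro mult_right_mono) auto
            then show "v - u \<le> 2 * h T" using uv(5) by linarith
          qed (use A T8 in auto)
          also have "\<dots> \<le> a T / 2"
          proof -
            have q: "(real T / 4) powr (- (\<alpha> / 2)) \<le> 2 * real T powr (- (\<alpha> / 2))"
            proof -
              have "(real T / 4) powr (- (\<alpha> / 2)) = 4 powr (\<alpha> / 2) * real T powr (- (\<alpha> / 2))"
                using T8 by (simp add: powr_divide powr_minus field_simps)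
              also have "4 powr (\<alpha> / 2) \<le> 4 powr (1/2)" using \<alpha> by (intro powr_mono) auto
              also have "(4::real) powr (1/2) = 2" by (simp add: powr_half_sqrt)
              finally show ?thesis by (simp add: mult_right_mono)
            qed
            have s6: "sqrt 6 \<le> 5/2" by (rule real_le_lsqrt) (auto simp: power2_eq_square)
            have "sqrt (real T) * real T powr (- (\<alpha> / 2)) * real T powr (- (1 - \<alpha>)) = real T powr (- a_sm \<alpha>)"
            proof -
              have e: "1/2 + - (\<alpha> / 2) + - (1 - \<alpha>) = - a_sm \<alpha>" by (simp add: a_sm_def field_simps)
              have "sqrt (real T) = real T powr (1/2)" by (simp add: powr_half_sqrt)
              then show ?thesis by (simp only: powr_add[symmetric] e)
            qed
            then have eq: "sqrt (real T) * (A * sqrt (6 * ln (real T)) * (2 * real T powr (- (\<alpha> / 2)))) * (2 * h T)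
                = 4 * sqrt 6 * A * s * (real T powr (- a_sm \<alpha>) * sqrt (ln (real T)))"
              by (simp add: h_def real_sqrt_mult)
            have "sqrt (real T) * ?X * (2 * h T) \<le> sqrt (real T) * (A * sqrt (6 * ln (real T)) * (2 * real T powr (- (\<alpha> / 2)))) * (2 * h T)"
              using q A hT T8 by (intro mult_right_mono mult_left_mono) auto
            also have "\<dots> = sqrt 6 * (4 * A * s * (real T powr (- a_sm \<alpha>) * sqrt (ln (real T))))"
              unfolding eq by simp
            also have "\<dots> \<le> 5/2 * (4 * A * s * (real T powr (- a_sm \<alpha>) * sqrt (ln (real T))))"
              using s6 A pos T8 by (intro mult_right_mono mult_nonneg_nonneg) auto
            also have "\<dots> = a T / 2" using A by (simp add: a_def s_def)
            finally show ?thesis .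
          qed
          finally show False using uv(6) \<delta> by linarith
        qed
      qed
      \<comment> \<open>The masses are now at least \<open>3/4\<close> against at most
        \<open>1/4\<close>, and \<open>\<delta> < 1/4\<close> does not close the gap.\<close>
      also have "\<dots> \<le> 1/4"
      proof -
        have "2 / real T \<le> 2 / 8" using T8 by (intro divide_left_mono) auto
        then show ?thesis using bad(2) by linarith
      qed
      finally have "measure (path_law P (oracle_path ?st ?M T)) (skorokhod_nbhd ?\<Gamma> \<delta>) + \<delta> < measure (path_law Q (\<lambda>\<omega> r. B r \<omega>)) ?\<Gamma>"
        using \<nu> \<delta> aT by linarith
      then show "\<exists>\<Gamma>\<in>sets skorokhod_borel.
        measure (path_law Q (\<lambda>\<omega> r. B r \<omega>)) (skorokhod_nbhd \<Gamma> \<delta>) + \<delta> < measure (path_law P (oracle_path ?st ?M T)) \<Gamma> \<or>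
        measure (path_law P (oracle_path ?st ?M T)) (skorokhod_nbhd \<Gamma> \<delta>) + \<delta> < measure (path_law Q (\<lambda>\<omega> r. B r \<omega>)) \<Gamma>"
        using osc_paths_sets[of "1/2" "h T" "a T"] by (intro bexI[of _ ?\<Gamma>]) auto
    qed (use P Q in \<open>auto simp: path_law_def intro: measure_distr_le_1\<close>)
    then have "\<forall>T\<ge>T0. \<kappa> / 4 * (real T powr (- a_sm \<alpha>) * sqrt (ln (real T))) \<le>
      prokhorov_dist (path_law (pmeasure ?M) (oracle_path ?st ?M T)) (path_law Q (target_path B ?M))"
      unfolding tgt by (simp add: a_def linear_oracle_def)
    then show ?thesis using pos by (intro exI[of _ "\<kappa> / 4"] conjI exI[of _ T0]) auto
  qed
qed

section \<open>The covariance class\<close>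

text \<open>The random time is rounded down to the grid of width \<open>1 / Suc n\<close>, where it
  takes countably many values; continuity of the paths gives the limit.\<close>

lemma process_at_random_time_measurable:
  fixes W :: "real \<Rightarrow> 'w \<Rightarrow> real"
  assumes W: "\<And>t. 0 \<le> t \<Longrightarrow> W t \<in> borel_measurable P"
    and c: "\<And>\<omega>. \<omega> \<in> space P \<Longrightarrow> continuous_on {0..} (\<lambda>t. W t \<omega>)"
    and \<sigma> [measurable]: "\<sigma> \<in> borel_measurable P" and \<sigma>0: "\<And>\<omega>. \<omega> \<in> space P \<Longrightarrow> 0 \<le> \<sigma> \<omega>"
  shows "(\<lambda>\<omega>. W (\<sigma> \<omega>) \<omega>) \<in> borel_measurable P"
proof (rule borel_measurable_LIMSEQ_real)
  let ?k = "\<lambda>n \<omega>. nat \<lfloor>\<sigma> \<omega> * real (Suc n)\<rfloor>"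
  fix n
  have "(\<lambda>\<omega>. W (real k / real (Suc n)) \<omega>) \<in> borel_measurable P" for k :: nat by (rule W) simp
  moreover have "?k n \<in> measurable P (count_space UNIV)" by measurable
  ultimately show "(\<lambda>\<omega>. W (real (?k n \<omega>) / real (Suc n)) \<omega>) \<in> borel_measurable P"
    by (rule measurable_compose_countable)
next
  fix \<omega> assume \<omega>: "\<omega> \<in> space P"
  let ?k = "\<lambda>n. nat \<lfloor>\<sigma> \<omega> * real (Suc n)\<rfloor>"
  have "(\<lambda>n. real (?k n) / real (Suc n)) \<longlonglongrightarrow> \<sigma> \<omega>"
  proof (rule LIMSEQ_I)
    fix e :: real assume "0 < e"
    then obtain n0 where n0: "1 / real (Suc n0) < e" using nat_approx_posE by blast
    show "\<exists>n0. \<forall>n\<ge>n0. norm (real (?k n) / real (Suc n) - \<sigma> \<omega>) < e"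
    proof (intro exI[of _ n0] allI impI)
      fix n assume "n0 \<le> n"
      then have "1 / real (Suc n) \<le> 1 / real (Suc n0)" by (intro divide_left_mono) auto
      moreover have "0 \<le> \<sigma> \<omega> * real (Suc n)" using \<sigma>0[OF \<omega>] by simp
      then have "real (?k n) \<le> \<sigma> \<omega> * real (Suc n)" "\<sigma> \<omega> * real (Suc n) \<le> real (?k n) + 1" by linarith+
      then have "real (?k n) / real (Suc n) \<le> \<sigma> \<omega> * real (Suc n) / real (Suc n)"
        "\<sigma> \<omega> * real (Suc n) / real (Suc n) \<le> (real (?k n) + 1) / real (Suc n)"
        by (intro divide_right_mono; simp)+
      then have "real (?k n) / real (Suc n) \<le> \<sigma> \<omega>" "\<sigma> \<omega> \<le> real (?k n) / real (Suc n) + 1 / real (Suc n)"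
        by (simp_all add: add_divide_distrib)
      ultimately show "norm (real (?k n) / real (Suc n) - \<sigma> \<omega>) < e"
        unfolding real_norm_def using n0 by linarith
    qed
  qed
  then show "(\<lambda>n. W (real (?k n) / real (Suc n)) \<omega>) \<longlonglongrightarrow> W (\<sigma> \<omega>) \<omega>"
    using \<sigma>0[OF \<omega>] by (intro continuous_on_tendsto_compose[OF c[OF \<omega>]]) auto
qed

locale cov_setup =
  fixes P :: "'w measure" and W and \<gamma> :: real and N :: nat and s0 :: real
  assumes W: "standard_brownian_motion_on {0..} P W" and \<gamma>: "0 < \<gamma>" and N: "1 \<le> N"
    and s0: "s0 = real N - 1/4 * real N powr (1 - 2 * \<gamma>)"
begin

lemma P: "prob_space P" and Wm: "0 \<le> t \<Longrightarrow> W t \<in> borel_measurable P"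
  and Wc: "\<omega> \<in> space P \<Longrightarrow> continuous_on {0..} (\<lambda>t. W t \<omega>)"
  and W0: "\<omega> \<in> space P \<Longrightarrow> W 0 \<omega> = 0"
  using W by (auto simp: standard_brownian_motion_on_def)

lemma s0_bounds: "real N / 2 \<le> s0" "s0 < real N" "0 < s0"
proof -
  have "real N powr (1 - 2 * \<gamma>) \<le> real N powr 1" using \<gamma> N by (intro powr_mono) auto
  moreover have "0 < real N powr (1 - 2 * \<gamma>)" using N by simp
  ultimately show "real N / 2 \<le> s0" "s0 < real N" "0 < s0" using s0 N by auto
qed

lemma cov_time_eq: "cov_time \<gamma> W N \<omega> = Inf (insert (real N) {s. s0 \<le> s \<and> W s \<omega> = 0})"
  by (simp add: cov_time_def s0)

lemma cov_time_bounds: "s0 \<le> cov_time \<gamma> W N \<omega>" "cov_time \<gamma> W N \<omega> \<le> real N"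
proof -
  have "bdd_below (insert (real N) {s. s0 \<le> s \<and> W s \<omega> = 0})" by (auto intro!: bdd_belowI[of _ s0])
  then show "cov_time \<gamma> W N \<omega> \<le> real N" unfolding cov_time_eq by (intro cInf_lower) auto
  show "s0 \<le> cov_time \<gamma> W N \<omega>" unfolding cov_time_eq using s0_bounds by (intro cInf_greatest) auto
qed

text \<open>By continuity the zeros beyond \<open>s0\<close> form a closed set, so the infimum is
  attained and is itself a zero.\<close>

lemma cov_time_zero:
  assumes \<omega>: "\<omega> \<in> space P" and s: "s0 \<le> s" "s \<le> real N" "W s \<omega> = 0"
  shows "W (cov_time \<gamma> W N \<omega>) \<omega> = 0" "cov_time \<gamma> W N \<omega> \<le> s"
proof -
  let ?S = "{s \<in> {s0..}. W s \<omega> = 0}"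
  have "continuous_on {s0..} (\<lambda>t. W t \<omega>)"
    by (rule continuous_on_subset[OF Wc[OF \<omega>]]) (use s0_bounds in auto)
  then have cl: "closed ?S" by (rule continuous_closed_preimage_constant) simp
  have bdd: "bdd_below ?S" by (auto intro!: bdd_belowI[of _ s0])
  have sS: "s \<in> ?S" using s by auto
  then have mem: "Inf ?S \<in> ?S" using cl bdd by (intro closed_contains_Inf) auto
  have le: "Inf ?S \<le> s" using sS bdd by (intro cInf_lower)
  have "cov_time \<gamma> W N \<omega> = inf (real N) (Inf ?S)"
    unfolding cov_time_eq using cInf_insert[of ?S "real N"] sS bdd by auto
  also have "\<dots> = Inf ?S" using le s by (simp add: inf_real_def)
  finally have eq: "cov_time \<gamma> W N \<omega> = Inf ?S" .
  show "W (cov_time \<gamma> W N \<omega>) \<omega> = 0" using mem unfolding eq by blast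
  show "cov_time \<gamma> W N \<omega> \<le> s" using le unfolding eq .
qed

text \<open>For \<open>s0 \<le> c < N\<close> the event says that the path has a zero in
  \<open>[s0, c]\<close>. By compactness this means that \<open>\<bar>W\<bar>\<close> takes
  arbitrarily small values there, and by continuity it is enough to look at a countable dense set of
  times. The affine map \<open>?t\<close> provides one from the rational parameters in
  \<open>[0, 1]\<close>, also when \<open>c = s0\<close>.\<close>

lemma cov_time_measurable: "cov_time \<gamma> W N \<in> borel_measurable P"
  unfolding borel_measurable_iff_le
proof
  fix c :: real
  consider "c < s0" | "real N \<le> c" | "s0 \<le> c" "c < real N" by linarith
  then show "{\<omega> \<in> space P. cov_time \<gamma> W N \<omega> \<le> c} \<in> sets P"
  proof cases
    case 1
    then have "{\<omega> \<in> space P. cov_time \<gamma> W N \<omega> \<le> c} = {}"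
      using cov_time_bounds(1) by (auto simp: not_le intro: less_le_trans)
    then show ?thesis by (simp only: sets.empty_sets)
  next
    case 2
    then have "{\<omega> \<in> space P. cov_time \<gamma> W N \<omega> \<le> c} = space P"
      using cov_time_bounds(2) order_trans by blast
    then show ?thesis by simp
  next
    case 3
    let ?t = "\<lambda>u. s0 + u * (c - s0)"
    have t: "0 \<le> ?t u" "s0 \<le> ?t u" "?t u \<le> c" if "u \<in> {0..1}" for u
    proof -
      have "0 \<le> u * (c - s0)" using that 3 by simp
      moreover have "u * (c - s0) \<le> 1 * (c - s0)" using that 3 by (intro mult_right_mono) auto
      ultimately show "0 \<le> ?t u" "s0 \<le> ?t u" "?t u \<le> c" using s0_bounds by auto
    qed
    have "cov_time \<gamma> W N \<omega> \<le> c \<longleftrightarrow> (\<forall>n. \<exists>r\<in>\<rat> \<inter> {0..1}. \<bar>W (?t r) \<omega>\<bar> < 1 / real (Suc n))"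
      if \<omega>: "\<omega> \<in> space P" for \<omega>
    proof -
      have cont: "continuous_on {0..1} (\<lambda>u. W (?t u) \<omega>)"
        using t by (intro continuous_on_compose2[OF Wc[OF \<omega>]] continuous_intros) auto
      show ?thesis
      proof
        assume le: "cov_time \<gamma> W N \<omega> \<le> c"
        have "\<exists>s. s0 \<le> s \<and> s \<le> c \<and> W s \<omega> = 0"
        proof (rule ccontr)
          assume no: "\<not> ?thesis"
          have "c < cov_time \<gamma> W N \<omega>"
          proof (cases "\<exists>s. s0 \<le> s \<and> s \<le> real N \<and> W s \<omega> = 0")
            case True
            then obtain s where "s0 \<le> s" "s \<le> real N" "W s \<omega> = 0" by blast
            from cov_time_zero(1)[OF \<omega> this] no cov_time_bounds(1) show ?thesis by (meson not_le)
          next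
            case False
            have "real N \<le> x" if "x \<in> insert (real N) {s. s0 \<le> s \<and> W s \<omega> = 0}" for x
            proof (rule ccontr)
              assume "\<not> real N \<le> x"
              then have "s0 \<le> x \<and> x \<le> real N \<and> W x \<omega> = 0" using that by auto
              then show False using False by blast
            qed
            then have "real N \<le> cov_time \<gamma> W N \<omega>" unfolding cov_time_eq by (intro cInf_greatest) auto
            then show ?thesis using 3 by linarith
          qed
          then show False using le 3 by linarith
        qed
        then obtain s where s: "s0 \<le> s" "s \<le> c" "W s \<omega> = 0" by blast
        obtain u where u: "u \<in> {0..1}" "?t u = s"
        proof (cases "c = s0")
          case True
          then show thesis using s that[of 0] by simp
        next
          case False
          then show thesis using s that[of "(s - s0) / (c - s0)"] 3 by (simp add: field_simps)
        qed
        show "\<forall>n. \<exists>r\<in>\<rat> \<inter> {0..1}. \<bar>W (?t r) \<omega>\<bar> < 1 / real (Suc n)"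
        proof (rule ccontr)
          assume "\<not> ?thesis"
          then obtain n where n: "\<And>r. r \<in> \<rat> \<inter> {0..1} \<Longrightarrow> 1 / real (Suc n) \<le> \<bar>W (?t r) \<omega>\<bar>" by (meson not_less)
          \<comment> \<open>Truncation turns the lower bound on \<open>\<bar>W\<bar>\<close> at
            rational parameters into a continuous function that vanishes there, hence everywhere,
            against the zero at \<open>u\<close>.\<close>
          have "\<bar>max 0 (1 / real (Suc n) - \<bar>W (?t u) \<omega>\<bar>)\<bar> \<le> 0"
          proof (rule continuous_bound_on_rationals[where \<phi> = "\<lambda>u. max 0 (1 / real (Suc n) - \<bar>W (?t u) \<omega>\<bar>)"])
            show "continuous_on {0..1} (\<lambda>u. max 0 (1 / real (Suc n) - \<bar>W (?t u) \<omega>\<bar>))"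
              by (intro continuous_intros cont)
            show "\<bar>max 0 (1 / real (Suc n) - \<bar>W (?t q) \<omega>\<bar>)\<bar> \<le> 0" if "q \<in> \<rat> \<inter> {0..1}" for q
              using n[OF that] by (simp add: max_def)
          qed (rule u)
          then show False using u s by simp
        qed
      next
        assume *: "\<forall>n. \<exists>r\<in>\<rat> \<inter> {0..1}. \<bar>W (?t r) \<omega>\<bar> < 1 / real (Suc n)"
        obtain u where u: "u \<in> {0..1}" "\<And>v. v \<in> {0..1} \<Longrightarrow> \<bar>W (?t u) \<omega>\<bar> \<le> \<bar>W (?t v) \<omega>\<bar>"
        proof -
          have "continuous_on {0..1} (\<lambda>u. \<bar>W (?t u) \<omega>\<bar>)" by (intro continuous_intros cont)
          from continuous_attains_inf[OF compact_Icc _ this] that show thesis by auto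
        qed
        have "W (?t u) \<omega> = 0"
        proof (rule ccontr)
          assume "W (?t u) \<omega> \<noteq> 0"
          then obtain n where "1 / real (Suc n) < \<bar>W (?t u) \<omega>\<bar>" using nat_approx_posE[of "\<bar>W (?t u) \<omega>\<bar>"] by auto
          moreover obtain r where "r \<in> {0..1}" "\<bar>W (?t r) \<omega>\<bar> < 1 / real (Suc n)" using * by blast
          ultimately show False using u(2)[of r] by linarith
        qed
        then show "cov_time \<gamma> W N \<omega> \<le> c"
          using cov_time_zero(2)[OF \<omega>, of "?t u"] t[OF u(1)] 3 by linarith
      qed
    qed
    then have "{\<omega> \<in> space P. cov_time \<gamma> W N \<omega> \<le> c} =
        (\<Inter>n. \<Union>r\<in>\<rat> \<inter> {0..1}. {\<omega> \<in> space P. \<bar>W (?t r) \<omega>\<bar> < 1 / real (Suc n)})"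
      by (auto simp del: of_nat_Suc)
    also have "\<dots> \<in> sets P"
    proof (intro sets.countable_INT image_subsetI sets.countable_UN' countable_Int1 countable_rat)
      fix n r assume "r \<in> \<rat> \<inter> {0..1::real}"
      then have [measurable]: "W (?t r) \<in> borel_measurable P" using t by (intro Wm) auto
      show "{\<omega> \<in> space P. \<bar>W (?t r) \<omega>\<bar> < 1 / real (Suc n)} \<in> sets P" by measurable
    qed simp
    finally show ?thesis .
  qed
qed

definition stopped :: "nat \<Rightarrow> 'w \<Rightarrow> real" where
  "stopped j \<omega> = W (min (real j) (cov_time \<gamma> W N \<omega>)) \<omega>"

lemma stopped_measurable: "stopped j \<in> borel_measurable P"
  unfolding stopped_def
proof (rule process_at_random_time_measurable[OF Wm Wc])
  show "(\<lambda>\<omega>. min (real j) (cov_time \<gamma> W N \<omega>)) \<in> borel_measurable P"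
    using cov_time_measurable by measurable
  show "0 \<le> min (real j) (cov_time \<gamma> W N \<omega>)" for \<omega> using cov_time_bounds(1)[of \<omega>] s0_bounds by simp
qed auto

lemma noise_eq:
  assumes "1 \<le> j"
  shows "noise (cov_oracle \<gamma> P W N) j \<omega> =
    (if j \<le> N then stopped j \<omega> - stopped (j - 1) \<omega> else W (real j) \<omega> - W (real j - 1) \<omega>)"
  using assms by (simp add: cov_oracle_def stopped_def of_nat_diff)

lemma noise_measurable:
  assumes "1 \<le> j"
  shows "noise (cov_oracle \<gamma> P W N) j \<in> borel_measurable (completion P)"
proof (rule measurable_completion)
  have [measurable]: "stopped j \<in> borel_measurable P" "stopped (j - 1) \<in> borel_measurable P"
    "W (real j) \<in> borel_measurable P" "W (real j - 1) \<in> borel_measurable P"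
    using stopped_measurable Wm assms by auto
  have "noise (cov_oracle \<gamma> P W N) j = (\<lambda>\<omega>. if j \<le> N then stopped j \<omega> - stopped (j - 1) \<omega> else W (real j) \<omega> - W (real j - 1) \<omega>)"
    using noise_eq[OF assms] by auto
  then show "noise (cov_oracle \<gamma> P W N) j \<in> borel_measurable P" by simp
qed

section \<open>A zero in the stopping window with probability of order
  \<open>N powr (- \<gamma>)\<close>\<close>

definition d :: real where "d = 1/4 * real N powr (1 - 2 * \<gamma>)"

text \<open>A sufficient condition for a zero in the window \<open>[s0, N]\<close> of length
  \<open>d\<close>: the motion starts it in \<open>[0, sqrt d]\<close> and then drops by at least
  \<open>sqrt d\<close>. The two events are independent, and the limit \<open>- 2 * sqrt d\<close>
  on the drop keeps the density bounded below.\<close>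

definition crossing :: "'w set" where
  "crossing = {\<omega>\<in>space P. 0 \<le> W s0 \<omega> \<and> W s0 \<omega> \<le> sqrt d} \<inter>
    {\<omega>\<in>space P. - 2 * sqrt d \<le> W (real N) \<omega> - W s0 \<omega> \<and> W (real N) \<omega> - W s0 \<omega> \<le> - sqrt d}"

lemma d: "0 < d" "s0 = real N - d" "d \<le> s0"
  using N s0 s0_bounds by (auto simp: d_def)

lemma crossing_sets: "crossing \<in> sets P"
proof -
  have [measurable]: "W s0 \<in> borel_measurable P" "W (real N) \<in> borel_measurable P"
    using s0_bounds by (auto intro!: Wm)
  show ?thesis unfolding crossing_def by measurable
qed

lemma crossing_space: "crossing \<subseteq> space P"
  by (auto simp: crossing_def)

text \<open>\<open>sqrt d\<close> is \<open>N powr (- \<gamma>) / 2\<close> times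
  \<open>sqrt N\<close>, so lying in \<open>[0, sqrt d]\<close> at time \<open>s0\<close> costs a
  factor of order \<open>N powr (- \<gamma>)\<close>; the drop is of the order of its standard
  deviation \<open>sqrt d\<close> and has constant probability. As \<open>d \<le> s0\<close>, the
  first density loses at most the factor \<open>exp (- 1/2)\<close>, the second at most
  \<open>exp (- 2)\<close>.\<close>

lemma crossing_prob:
  "exp (- 5/2) / (4 * pi) * real N powr (- \<gamma>) \<le> measure P crossing"
proof -
  have 1: "exp (- 1/2) / sqrt (2 * pi) * (real N powr (- \<gamma>) / 2) \<le> measure P {\<omega>\<in>space P. 0 \<le> W s0 \<omega> \<and> W s0 \<omega> \<le> sqrt d}"
  proof -
    have D: "distributed P lborel (\<lambda>\<omega>. W s0 \<omega> - W 0 \<omega>) (normal_density 0 (sqrt s0))"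
      using Brownian_increment[OF W, of 0 s0] s0_bounds by simp
    have "exp (- 1/2) / sqrt (2 * pi) * (real N powr (- \<gamma>) / 2) \<le> normal_density 0 (sqrt s0) (sqrt d) * (sqrt d - 0)"
    proof -
      have "sqrt d = sqrt (real N) * (real N powr (- \<gamma>) / 2)"
      proof -
        have "d = (sqrt (real N) * (real N powr (- \<gamma>) / 2))\<^sup>2"
          using N by (simp add: d_def power_mult_distrib power_divide power2_eq_square powr_diff powr_minus powr_add[symmetric] field_simps)
        then show ?thesis using N by (simp add: real_sqrt_unique)
      qed
      then have "real N powr (- \<gamma>) / 2 = sqrt d / sqrt (real N)" using N by simp
      also have "\<dots> \<le> sqrt d / sqrt s0" using s0_bounds d by (intro divide_left_mono) auto
      finally have a: "real N powr (- \<gamma>) / 2 \<le> sqrt d / sqrt s0" .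
      have "d / (2 * s0) \<le> 1/2" using d s0_bounds by (simp add: field_simps)
      then have b: "exp (- 1/2) \<le> exp (- (d / (2 * s0)))" by simp
      have "exp (- 1/2) / sqrt (2 * pi) * (real N powr (- \<gamma>) / 2) \<le> exp (- (d / (2 * s0))) / sqrt (2 * pi) * (sqrt d / sqrt s0)"
        using a b by (intro mult_mono divide_right_mono) auto
      also have "\<dots> = normal_density 0 (sqrt s0) (sqrt d) * (sqrt d - 0)"
        using d s0_bounds by (simp add: normal_density_def real_sqrt_mult)
      finally show ?thesis .
    qed
    also have "\<dots> \<le> measure P {\<omega>\<in>space P. 0 \<le> W s0 \<omega> - W 0 \<omega> \<and> W s0 \<omega> - W 0 \<omega> \<le> sqrt d}"
      using d s0_bounds by (intro distributed_interval_ge[OF P D] normal_density_ge) auto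
    also have "{\<omega>\<in>space P. 0 \<le> W s0 \<omega> - W 0 \<omega> \<and> W s0 \<omega> - W 0 \<omega> \<le> sqrt d} = {\<omega>\<in>space P. 0 \<le> W s0 \<omega> \<and> W s0 \<omega> \<le> sqrt d}"
      using W0 by auto
    finally show ?thesis .
  qed
  have 2: "exp (- 2) / sqrt (2 * pi) \<le> measure P {\<omega>\<in>space P. - 2 * sqrt d \<le> W (real N) \<omega> - W s0 \<omega> \<and> W (real N) \<omega> - W s0 \<omega> \<le> - sqrt d}"
  proof -
    have D: "distributed P lborel (\<lambda>\<omega>. W (real N) \<omega> - W s0 \<omega>) (normal_density 0 (sqrt d))"
      using Brownian_increment[OF W, of s0 "real N"] s0_bounds d by simp
    have "exp (- 2) / sqrt (2 * pi) = normal_density 0 (sqrt d) (2 * sqrt d) * (- sqrt d - - 2 * sqrt d)"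
      using d by (simp add: normal_density_def real_sqrt_mult)
    also have "\<dots> \<le> measure P {\<omega>\<in>space P. - 2 * sqrt d \<le> W (real N) \<omega> - W s0 \<omega> \<and> W (real N) \<omega> - W s0 \<omega> \<le> - sqrt d}"
      using d by (intro distributed_interval_ge[OF P D] normal_density_ge) (auto simp: abs_le_iff)
    finally show ?thesis .
  qed
  have "measure P crossing = measure P {\<omega>\<in>space P. 0 \<le> W s0 \<omega> \<and> W s0 \<omega> \<le> sqrt d} *
      measure P {\<omega>\<in>space P. - 2 * sqrt d \<le> W (real N) \<omega> - W s0 \<omega> \<and> W (real N) \<omega> - W s0 \<omega> \<le> - sqrt d}"
    using Brownian_past_indep[OF W, of s0 "real N" "{s0}" "\<lambda>_. {0..sqrt d}" "{- 2 * sqrt d..- sqrt d}"] s0_bounds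
    by (simp add: crossing_def)
  also have "\<dots> \<ge> (exp (- 1/2) / sqrt (2 * pi) * (real N powr (- \<gamma>) / 2)) * (exp (- 2) / sqrt (2 * pi))"
    using 1 2 by (intro mult_mono) auto
  also have "(exp (- 1/2) / sqrt (2 * pi) * (real N powr (- \<gamma>) / 2)) * (exp (- 2) / sqrt (2 * pi)) =
      exp (- 5/2) / (4 * pi) * real N powr (- \<gamma>)"
  proof -
    have "exp (- 5/2) = exp (- 1/2) * exp (- 2 :: real)" by (simp add: exp_add[symmetric])
    moreover have "x / r * (g / 2) * (y / r) = x * y / (2 * (r * r)) * g" for x y g r :: real
      by (simp add: mult_ac)
    moreover have "2 * (sqrt (2 * pi) * sqrt (2 * pi)) = 4 * pi" by simp
    ultimately show ?thesis by (simp only:)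
  qed
  finally show ?thesis .
qed

text \<open>The intermediate value theorem gives a zero in the window, so the motion is stopped at a
  zero and the first \<open>N\<close> noise terms add up to 0.\<close>

lemma crossing_stopped:
  assumes "\<omega> \<in> crossing"
  shows "stopped N \<omega> = 0" "stopped 0 \<omega> = 0"
proof -
  have \<omega>: "\<omega> \<in> space P" "0 \<le> W s0 \<omega>" "W (real N) \<omega> \<le> 0"
    using assms by (auto simp: crossing_def)
  have "\<exists>s\<ge>s0. s \<le> real N \<and> W s \<omega> = 0"
    using \<omega> s0_bounds by (intro IVT2' continuous_on_subset[OF Wc[OF \<omega>(1)]]) auto
  then have "W (cov_time \<gamma> W N \<omega>) \<omega> = 0" using cov_time_zero(1)[OF \<omega>(1)] by blast
  then show "stopped N \<omega> = 0" using cov_time_bounds(2)[of \<omega>] by (simp add: stopped_def min_def)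
  show "stopped 0 \<omega> = 0" using cov_time_bounds(1)[of \<omega>] s0_bounds W0[OF \<omega>(1)] by (simp add: stopped_def min_def)
qed

end

lemma cov_lower_bound:
  fixes \<eta> \<alpha> \<gamma> :: real
  assumes \<eta>: "0 < \<eta>" and \<alpha>: "0 < \<alpha>" "\<alpha> < 1" and \<gamma>: "0 < \<gamma>" "\<gamma> < a_sm \<alpha>"
    and W: "standard_brownian_motion_on {0..} P W" and B: "standard_brownian_motion_on {0..1} Q B"
  shows "\<exists>c>0. \<exists>T0. \<forall>T\<ge>T0. c * real T powr (- a_cov \<gamma>) \<le>
    prokhorov_dist (path_law (pmeasure (cov_oracle \<gamma> P W T)) (oracle_path (step_size \<eta> \<alpha>) (cov_oracle \<gamma> P W T) T))
      (path_law Q (target_path B (cov_oracle \<gamma> P W T)))"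
proof -
  let ?st = "step_size \<eta> \<alpha>"
  have P: "prob_space P" using W by (simp add: standard_brownian_motion_on_def)
  interpret P: prob_space P by fact
  have Pc: "prob_space (completion P)" by (rule P.prob_space_completion)
  have Q: "prob_space Q" using B by (simp add: standard_brownian_motion_on_def)
  \<comment> \<open>\<open>\<beta>\<close> is the midpoint of
    \<open>\<gamma> / (1 - \<alpha>)\<close> and \<open>1/2\<close>, so that
    \<open>\<gamma> < \<beta> * (1 - \<alpha>)\<close>. The gap is split: the exponent
    \<open>\<theta>\<close> is spent on the Hoelder constant, and the error of the endpoint still
    has order \<open>T powr (- \<gamma> - \<theta>)\<close> up to a logarithm. The choice of
    \<open>l\<close> makes the exceptional probability, of order
    \<open>T powr (- 2 * l * \<theta>)\<close>, smaller than that of a crossing.\<close>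
  define g where "g = \<gamma> / (1 - \<alpha>)"
  define \<beta> where "\<beta> = (g + 1/2) / 2"
  have g1: "g < 1/2" "0 < g" using \<gamma> \<alpha> by (auto simp: g_def a_sm_def field_simps)
  have \<beta>: "0 < \<beta>" "\<beta> < 1/2" "\<beta> < 1"
  proof -
    show "0 < \<beta>" "\<beta> < 1/2" using g1 by (auto simp: \<beta>_def)
    then show "\<beta> < 1" by linarith
  qed
  have g2: "\<gamma> < \<beta> * (1 - \<alpha>)"
  proof -
    have "\<gamma> / (1 - \<alpha>) < \<beta>" using g1 by (simp add: \<beta>_def g_def)
    then show ?thesis using \<alpha> by (simp add: field_simps)
  qed
  define \<theta> where "\<theta> = (\<beta> * (1 - \<alpha>) - \<gamma>) / 2"
  have \<theta>: "0 < \<theta>" using g2 by (simp add: \<theta>_def)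
  obtain l :: nat where l: "max (1 / (1 - 2 * \<beta>)) (\<gamma> / (2 * \<theta>)) < real l" using reals_Archimedean2 by blast
  then have l1: "1 < real l * (1 - 2 * \<beta>)" and l2: "\<gamma> < 2 * real l * \<theta>"
    using \<beta> \<theta> by (auto simp: field_simps)
  define c1 where "c1 = exp (- 5/2) / (4 * pi)"
  have c1: "0 < c1" by (simp add: c1_def)
  let ?K = "Brownian_tail_const \<beta> l"
  have K: "0 < ?K" using l1 by (rule Brownian_tail_const_pos)
  show ?thesis
  proof (rule recursion_Holder_bound[OF \<eta> \<alpha> \<beta>(1,3)])
    fix A :: real assume A: "A \<ge> 1" and rb: "\<And>x Z H N n. x (1::nat) = (0::real) \<Longrightarrow> 0 \<le> H \<Longrightarrow>
     (\<And>t. 1 \<le> t \<Longrightarrow> t \<le> N \<Longrightarrow> x (Suc t) = (1 - ?st t) * x t + ?st t * (Z t - Z (t - 1))) \<Longrightarrow>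
     (\<And>i j. i \<le> j \<Longrightarrow> j \<le> N \<Longrightarrow> \<bar>Z j - Z i\<bar> \<le> H * real (j - i) powr \<beta>) \<Longrightarrow>
     1 \<le> n \<Longrightarrow> n \<le> N \<Longrightarrow> \<bar>x (Suc n)\<bar> \<le> A * H * real n powr (- (\<alpha> * (1 - \<beta>)))"
    define C where "C = A * Holder_const \<beta> * (1 + 1 / \<eta>)"
    have C: "0 < C" using A \<eta> Holder_const_pos[OF \<beta>(1)] by (simp add: C_def add_pos_pos)
    have ex: "\<theta> - \<beta> * (1 - \<alpha>) < - \<gamma>" using g2 by (simp add: \<theta>_def field_simps)
    have "\<forall>\<^sub>F T::nat in sequentially. C * real T powr (\<theta> - \<beta> * (1 - \<alpha>)) * (2 + ln (real T)) \<le> c1 / 8 * real T powr (- \<gamma>)"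
    proof -
      have "\<forall>\<^sub>F T::nat in sequentially. C * real T powr (- \<theta>) * (2 + ln (real T)) \<le> c1 / 8"
        using \<theta> C c1 by real_asymp
      then show ?thesis using eventually_ge_at_top[of 1]
      proof eventually_elim
        case (elim T)
        have "C * real T powr (- \<theta>) * (2 + ln (real T)) * real T powr (- \<gamma>) \<le> c1 / 8 * real T powr (- \<gamma>)"
          using elim by (intro mult_right_mono) auto
        moreover have "real T powr (\<theta> - \<beta> * (1 - \<alpha>)) = real T powr (- \<theta>) * real T powr (- \<gamma>)"
          by (simp add: powr_add[symmetric] \<theta>_def field_simps)
        ultimately show ?case by (simp only: mult_ac)
      qed
    qed
    moreover have "\<forall>\<^sub>F T::nat in sequentially. ?K / real T powr (2 * real l * \<theta>) \<le> c1 / 2 * real T powr (- \<gamma>)"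
      using l2 K c1 \<gamma> by real_asymp
    ultimately have "\<forall>\<^sub>F T::nat in sequentially. C * real T powr (\<theta> - \<beta> * (1 - \<alpha>)) * (2 + ln (real T)) \<le> c1 / 8 * real T powr (- \<gamma>) \<and>
        ?K / real T powr (2 * real l * \<theta>) \<le> c1 / 2 * real T powr (- \<gamma>) \<and> 1 \<le> T"
      using eventually_ge_at_top[of 1] by eventually_elim auto
    then obtain T0 where T0: "\<And>T. T0 \<le> T \<Longrightarrow> C * real T powr (\<theta> - \<beta> * (1 - \<alpha>)) * (2 + ln (real T)) \<le> c1 / 8 * real T powr (- \<gamma>) \<and>
        ?K / real T powr (2 * real l * \<theta>) \<le> c1 / 2 * real T powr (- \<gamma>) \<and> 1 \<le> T"
      unfolding eventually_sequentially by blast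
    have "c1 / 8 * real T powr (- \<gamma>) \<le> prokhorov_dist (path_law (completion P) (oracle_path ?st (cov_oracle \<gamma> P W T) T)) (path_law Q (\<lambda>\<omega> r. B r \<omega>))"
      if T: "T0 \<le> T" for T
    proof (rule prokhorov_dist_ge)
      have T1: "1 \<le> T" using T0[OF T] by simp
      let ?M = "cov_oracle \<gamma> P W T"
      interpret cov_setup P W \<gamma> T "real T - 1/4 * real T powr (1 - 2 * \<gamma>)"
        using W \<gamma> T1 by unfold_locales auto
      fix \<delta> :: real assume \<delta>: "0 < \<delta>" "\<delta> < c1 / 8 * real T powr (- \<gamma>)"
      \<comment> \<open>The oracle endpoint lies within \<open>y\<close> of 0 with probability at
        least \<open>4 * y\<close>: a crossing has at least \<open>8 * y\<close>, and at most half
        of this is lost to the exceptional set. A standard normal endpoint lies within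
        \<open>y + \<delta>\<close> of 0 with probability at most \<open>y + \<delta>\<close>, its
        density being at most \<open>1/2\<close>. Since \<open>\<delta> < y\<close>, a gap
        remains.\<close>
      define y where "y = c1 / 8 * real T powr (- \<gamma>)"
      have y: "0 < y" using c1 T1 by (simp add: y_def)
      have y4: "4 * y = c1 / 2 * real T powr (- \<gamma>)" by (simp add: y_def)
      let ?\<Gamma> = "{f \<in> skorokhod_paths. \<bar>f 1\<bar> \<le> y}"
      have "measure (path_law Q (\<lambda>\<omega> r. B r \<omega>)) (skorokhod_nbhd ?\<Gamma> \<delta>) \<le>
          measure Q {\<omega>\<in>space Q. - (y + \<delta>) \<le> B 1 \<omega> - B 0 \<omega> \<and> B 1 \<omega> - B 0 \<omega> \<le> y + \<delta>}"
      proof (rule measure_path_law_le[OF Q])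
        have [measurable]: "B 1 \<in> borel_measurable Q" "B 0 \<in> borel_measurable Q"
          using B by (auto simp: standard_brownian_motion_on_def)
        show "{\<omega>\<in>space Q. - (y + \<delta>) \<le> B 1 \<omega> - B 0 \<omega> \<and> B 1 \<omega> - B 0 \<omega> \<le> y + \<delta>} \<in> sets Q" by measurable
        fix \<omega> assume \<omega>: "\<omega> \<in> space Q" "\<omega> \<notin> {\<omega>\<in>space Q. - (y + \<delta>) \<le> B 1 \<omega> - B 0 \<omega> \<and> B 1 \<omega> - B 0 \<omega> \<le> y + \<delta>}"
        have B0: "B 0 \<omega> = 0" using B \<omega>(1) by (simp add: standard_brownian_motion_on_def)
        show "(\<lambda>r\<in>{0..1}. B r \<omega>) \<notin> skorokhod_nbhd ?\<Gamma> \<delta>"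
        proof
          assume "(\<lambda>r\<in>{0..1}. B r \<omega>) \<in> skorokhod_nbhd ?\<Gamma> \<delta>"
          then obtain f where "f \<in> ?\<Gamma>" "\<bar>f 1 - (\<lambda>r\<in>{0..1}. B r \<omega>) (1::real)\<bar> < \<delta>"
            by (rule nbhd_endpoint_close)
          then have "\<bar>f 1\<bar> \<le> y" "\<bar>f 1 - B 1 \<omega>\<bar> < \<delta>" by auto
          then have "- (y + \<delta>) \<le> B 1 \<omega>" "B 1 \<omega> \<le> y + \<delta>" by linarith+
          then show False using \<omega> B0 by auto
        qed
      qed
      also have "\<dots> \<le> 1 / (2 * 1) * (y + \<delta> - - (y + \<delta>))"
      proof (rule distributed_interval_le[OF Q])
        show "distributed Q lborel (\<lambda>\<omega>. B 1 \<omega> - B 0 \<omega>) (normal_density 0 1)"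
          using Brownian_increment[OF B, of 0 1] by simp
      qed (use y \<delta> normal_density_le[of 1] in auto)
      finally have \<nu>: "measure (path_law Q (\<lambda>\<omega> r. B r \<omega>)) (skorokhod_nbhd ?\<Gamma> \<delta>) \<le> y + \<delta>" by simp
      have \<mu>: "4 * y \<le> measure (path_law (completion P) (oracle_path ?st ?M T)) ?\<Gamma>"
      proof -
        have drift: "drift ?M \<in> borel_measurable borel" by (simp add: cov_oracle_def)
        have ml: "measure (path_law (completion P) (oracle_path ?st ?M T)) ?\<Gamma> =
            measure (completion P) {\<omega>\<in>space (completion P). restrict (oracle_path ?st ?M T \<omega>) {0..1} \<in> ?\<Gamma>}"
          "{\<omega>\<in>space (completion P). restrict (oracle_path ?st ?M T \<omega>) {0..1} \<in> ?\<Gamma>} \<in> sets (completion P)"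
          by (rule measure_oracle_path_law[OF drift noise_measurable endpoint_le_sets]; assumption)+
        show ?thesis
        proof (rule Brownian_Holder[OF W _ _ \<beta>(1) l1, of "real T" "real T powr \<theta>"])
          fix bad assume bad: "bad \<in> sets P" "measure P bad \<le> ?K / (real T powr \<theta>) ^ (2 * l)"
            "\<And>\<omega> s t. \<omega> \<in> space P \<Longrightarrow> \<omega> \<notin> bad \<Longrightarrow> s \<in> {0..real T} \<Longrightarrow> t \<in> {0..real T} \<Longrightarrow>
              \<bar>W t \<omega> - W s \<omega>\<bar> \<le> real T powr \<theta> * Holder_const \<beta> * real T powr (1/2 - \<beta>) * \<bar>t - s\<bar> powr \<beta>"
          have peq: "(real T powr \<theta>) ^ (2 * l) = real T powr (2 * real l * \<theta>)"
            using T1 by (simp add: powr_realpow[symmetric] powr_powr mult_ac)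
          have badp: "measure P bad \<le> c1 / 2 * real T powr (- \<gamma>)"
            using bad(2) T0[OF T] unfolding peq by linarith
          have "crossing - bad \<subseteq> {\<omega>\<in>space (completion P). restrict (oracle_path ?st ?M T \<omega>) {0..1} \<in> ?\<Gamma>}"
          proof
            fix \<omega> assume "\<omega> \<in> crossing - bad"
            then have \<omega>: "\<omega> \<in> crossing" "\<omega> \<in> space P" "\<omega> \<notin> bad" using crossing_space by blast+
            define x where "x t = iterate ?st ?M t \<omega>" for t
            define Z where "Z t = stopped t \<omega>" for t
            define H where "H = real T powr \<theta> * Holder_const \<beta> * real T powr (1/2 - \<beta>)"
            have H: "0 \<le> H" using Holder_const_pos[OF \<beta>(1)] by (simp add: H_def)
            have x1: "x 1 = 0" by (simp add: x_def iterate.simps(2))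
            have rec: "x (Suc t) = (1 - ?st t) * x t + ?st t * (Z t - Z (t - 1))" if t: "1 \<le> t" "t \<le> T" for t
              using linear_recursion[of ?M t ?st \<omega>] t noise_eq[OF t(1), of \<omega>] by (simp add: x_def Z_def cov_oracle_def)
            have hol: "\<bar>Z j - Z i\<bar> \<le> H * real (j - i) powr \<beta>" if ij: "i \<le> j" "j \<le> T" for i j
            proof -
              let ?u = "min (real i) (cov_time \<gamma> W T \<omega>)" and ?v = "min (real j) (cov_time \<gamma> W T \<omega>)"
              have uv: "?u \<in> {0..real T}" "?v \<in> {0..real T}"
                using ij cov_time_bounds[of \<omega>] s0_bounds by auto
              have "\<bar>Z j - Z i\<bar> \<le> H * \<bar>?v - ?u\<bar> powr \<beta>"
                using bad(3)[OF \<omega>(2,3) uv] by (simp add: Z_def stopped_def H_def)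
              also have "\<dots> \<le> H * real (j - i) powr \<beta>"
                using ij \<beta> H by (intro mult_left_mono powr_mono2) (auto simp: of_nat_diff)
              finally show ?thesis .
            qed
            have xb: "\<bar>x (Suc n)\<bar> \<le> (A * H) * real n powr (- (\<alpha> * (1 - \<beta>)))" if n: "1 \<le> n" "n \<le> T" for n
              by (rule rb[of x H T Z n]) (use x1 H rec hol n in auto)
            have "\<bar>(\<Sum>k<T. x (k + 2)) - (Z T - Z 0)\<bar> \<le> (A * H) * (1 + 1 / \<eta>) * real T powr (\<alpha> - \<alpha> * (1 - \<beta>)) * (2 + ln (real T))"
            proof (rule recursion_sum_error[OF \<eta> \<alpha>])
              show "\<alpha> * (1 - \<beta>) \<le> \<alpha>" using \<alpha> \<beta> by (simp add: mult_left_le)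
              show "0 \<le> A * H" using A H by simp
            qed (use rec x1 T1 xb in auto)
            then have "\<bar>\<Sum>k<T. x (k + 2)\<bar> \<le> C * (real T powr \<theta> * real T powr (1/2 - \<beta>) * real T powr (\<alpha> * \<beta>)) * (2 + ln (real T))"
              using crossing_stopped[OF \<omega>(1)] by (simp add: Z_def H_def C_def algebra_simps)
            also have "real T powr \<theta> * real T powr (1/2 - \<beta>) * real T powr (\<alpha> * \<beta>) = real T powr (\<theta> - \<beta> * (1 - \<alpha>)) * sqrt (real T)"
            proof -
              have "sqrt (real T) = real T powr (1/2)" by (simp add: powr_half_sqrt)
              moreover have "\<theta> + (1/2 - \<beta>) + \<alpha> * \<beta> = \<theta> - \<beta> * (1 - \<alpha>) + 1/2" by (simp add: algebra_simps)
              ultimately show ?thesis by (simp only: powr_add[symmetric])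
            qed
            finally have "\<bar>\<Sum>k<T. x (k + 2)\<bar> / sqrt (real T) \<le> C * (real T powr (\<theta> - \<beta> * (1 - \<alpha>))) * (2 + ln (real T))"
              using T1 by (simp add: pos_divide_le_eq mult_ac)
            also have "\<dots> \<le> y" using T0[OF T] by (simp add: y_def)
            finally have "\<bar>oracle_path ?st ?M T \<omega> 1\<bar> \<le> y"
              using oracle_path_endpoint[of T ?st ?M \<omega>] T1 by (simp add: x_def abs_divide)
            then show "\<omega> \<in> {\<omega>\<in>space (completion P). restrict (oracle_path ?st ?M T \<omega>) {0..1} \<in> ?\<Gamma>}"
              using \<omega> continuous_skorokhod_path[OF continuous_oracle_path] by simp
          qed
          then have "measure (completion P) (crossing - bad) \<le> measure (completion P) {\<omega>\<in>space (completion P). restrict (oracle_path ?st ?M T \<omega>) {0..1} \<in> ?\<Gamma>}"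
            using ml(2) by (intro finite_measure.finite_measure_mono prob_space.finite_measure[OF Pc])
          moreover have "measure (completion P) (crossing - bad) = measure P (crossing - bad)"
            using crossing_sets bad(1) by (intro measure_completion) auto
          moreover have "measure P crossing \<le> measure P (crossing - bad) + measure P bad"
            using crossing_sets bad(1) by (intro order_trans[OF P.finite_measure_mono[of crossing "(crossing - bad) \<union> bad"] measure_Un_le]) auto
          moreover have "c1 * real T powr (- \<gamma>) \<le> measure P crossing" using crossing_prob by (simp add: c1_def)
          ultimately show "4 * y \<le> measure (path_law (completion P) (oracle_path ?st ?M T)) ?\<Gamma>"
            unfolding ml(1) using badp y4 by linarith
        qed (use T1 in auto)
      qed
      have "\<delta> < y" using \<delta> by (simp add: y_def)
      then have "measure (path_law Q (\<lambda>\<omega> r. B r \<omega>)) (skorokhod_nbhd ?\<Gamma> \<delta>) + \<delta> < measure (path_law (completion P) (oracle_path ?st ?M T)) ?\<Gamma>"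
        using \<nu> \<mu> y by linarith
      then show "\<exists>\<Gamma>\<in>sets skorokhod_borel.
        measure (path_law Q (\<lambda>\<omega> r. B r \<omega>)) (skorokhod_nbhd \<Gamma> \<delta>) + \<delta> < measure (path_law (completion P) (oracle_path ?st ?M T)) \<Gamma> \<or>
        measure (path_law (completion P) (oracle_path ?st ?M T)) (skorokhod_nbhd \<Gamma> \<delta>) + \<delta> < measure (path_law Q (\<lambda>\<omega> r. B r \<omega>)) \<Gamma>"
        using endpoint_le_sets[of y] by (intro bexI[of _ ?\<Gamma>]) auto
    qed (use Pc Q in \<open>auto simp: path_law_def intro: measure_distr_le_1\<close>)
    moreover have "target_path B (cov_oracle \<gamma> P W T) = (\<lambda>\<omega> r. B r \<omega>)" for T
      using lim_variance_cov_oracle[OF W] by (intro target_path_unit) (simp_all add: lin_coeff_def cov_oracle_def)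
    moreover have "pmeasure (cov_oracle \<gamma> P W T) = completion P" for T by (simp add: cov_oracle_def)
    ultimately show ?thesis using c1
      by (intro exI[of _ "c1 / 8"] conjI exI[of _ T0] allI impI) (simp_all add: a_cov_def)
  qed
qed

section \<open>The oscillation class\<close>

locale osc_setup = prob_space P for P :: "'w measure" +
  fixes \<xi> :: "nat \<Rightarrow> 'w \<Rightarrow> real" and q u v :: real
  assumes osc: "osc_noise q u v P \<xi>" and q: "0 < q" "q < 1" and v: "0 \<le> v" "v < u"
begin

lemma ind: "indep_vars (\<lambda>_. borel) \<xi> {1..}"
  using osc by (simp add: osc_noise_def)

lemma noise_rv: "1 \<le> j \<Longrightarrow> \<xi> j \<in> borel_measurable P"
  using ind by (auto simp: indep_vars_def)

lemma noise_prob: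
  assumes "1 \<le> j" "A \<in> sets borel"
  shows "prob (\<xi> j -` A \<inter> space P) =
    q / 2 * (indicator A u + indicator A (- u)) + (1 - q) / 2 * (indicator A v + indicator A (- v))"
  using osc assms unfolding osc_noise_def by blast

lemma noise_symmetric:
  assumes j: "1 \<le> j"
  shows "distr P borel (\<lambda>\<omega>. - \<xi> j \<omega>) = distr P borel (\<xi> j)"
proof (rule measure_eqI)
  have [measurable]: "\<xi> j \<in> borel_measurable P" using noise_rv[OF j] .
  fix A assume "A \<in> sets (distr P borel (\<lambda>\<omega>. - \<xi> j \<omega>))"
  then have A: "A \<in> sets borel" by simp
  have "uminus -` A \<in> sets (borel :: real measure)" using A measurable_sets[of uminus borel borel A] by simp
  moreover have "(\<lambda>\<omega>. - \<xi> j \<omega>) -` A \<inter> space P = \<xi> j -` (uminus -` A) \<inter> space P" by auto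
  ultimately have "prob ((\<lambda>\<omega>. - \<xi> j \<omega>) -` A \<inter> space P) = prob (\<xi> j -` A \<inter> space P)"
    using noise_prob[OF j] A by (simp add: indicator_vimage[symmetric] indicator_def add.commute)
  then show "emeasure (distr P borel (\<lambda>\<omega>. - \<xi> j \<omega>)) A = emeasure (distr P borel (\<xi> j)) A"
    using A by (simp add: emeasure_distr emeasure_eq_measure)
qed simp

lemma second_moment:
  assumes j: "1 \<le> j"
  shows "integrable P (\<lambda>\<omega>. (\<xi> j \<omega>)\<^sup>2)" "(\<integral>\<omega>. (\<xi> j \<omega>)\<^sup>2 \<partial>P) = q * u\<^sup>2 + (1 - q) * v\<^sup>2"
proof -
  have [measurable]: "\<xi> j \<in> borel_measurable P" using noise_rv[OF j] .
  let ?U = "\<xi> j -` {u, - u} \<inter> space P" and ?V = "\<xi> j -` {v, - v} \<inter> space P"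
  let ?f = "\<lambda>\<omega>. u\<^sup>2 * indicator ?U \<omega> + v\<^sup>2 * indicator ?V \<omega> :: real"
  have "prob (\<xi> j -` (- {u, - u, v, - v}) \<inter> space P) = 0"
    using noise_prob[OF j, of "- {u, - u, v, - v}"] by simp
  then have "AE \<omega> in P. \<omega> \<notin> \<xi> j -` (- {u, - u, v, - v}) \<inter> space P"
    by (intro AE_not_in) (auto simp: null_sets_def emeasure_eq_measure)
  then have ae: "AE \<omega> in P. (\<xi> j \<omega>)\<^sup>2 = ?f \<omega>"
  proof (rule AE_mp, intro AE_I2 impI)
    fix \<omega> assume "\<omega> \<in> space P" "\<omega> \<notin> \<xi> j -` (- {u, - u, v, - v}) \<inter> space P"
    then show "(\<xi> j \<omega>)\<^sup>2 = ?f \<omega>" using v by (auto simp: indicator_def)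
  qed
  have i: "integrable P ?f" by (auto simp: emeasure_eq_measure intro!: integrable_real_indicator)
  then show "integrable P (\<lambda>\<omega>. (\<xi> j \<omega>)\<^sup>2)" using ae by (subst integrable_cong_AE[OF _ _ ae]) auto
  have "(\<integral>\<omega>. (\<xi> j \<omega>)\<^sup>2 \<partial>P) = (\<integral>\<omega>. ?f \<omega> \<partial>P)" by (rule integral_cong_AE[OF _ _ ae]) auto
  also have "\<dots> = u\<^sup>2 * prob ?U + v\<^sup>2 * prob ?V"
    by (subst Bochner_Integration.integral_add) (auto simp: emeasure_eq_measure intro!: integrable_real_indicator)
  also have "prob ?U = q" using noise_prob[OF j, of "{u, - u}"] v by (simp add: indicator_def)
  \<comment> \<open>For \<open>v = 0\<close> the two weights fall on the same point and still add up
    to \<open>1 - q\<close>.\<close>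
  also have "prob ?V = 1 - q" using noise_prob[OF j, of "{v, - v}"] v by (simp add: indicator_def)
  finally show "(\<integral>\<omega>. (\<xi> j \<omega>)\<^sup>2 \<partial>P) = q * u\<^sup>2 + (1 - q) * v\<^sup>2" by (simp add: mult.commute)
qed

text \<open>The joint law of finitely many independent variables is the product of the marginals,
  and by symmetry the flip leaves every marginal unchanged.\<close>

lemma joint_flip:
  assumes j: "1 \<le> j" "j \<le> N" and E: "E \<in> sets (PiM {1..N} (\<lambda>_. borel))"
  shows "prob ((\<lambda>\<omega>. \<lambda>i\<in>{1..N}. if i = j then - \<xi> i \<omega> else \<xi> i \<omega>) -` E \<inter> space P) =
    prob ((\<lambda>\<omega>. \<lambda>i\<in>{1..N}. \<xi> i \<omega>) -` E \<inter> space P)"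
proof -
  let ?I = "{1..N}"
  have ne: "?I \<noteq> {}" using j by auto
  define Y where "Y i x = (if i = j then - x else x)" for i and x :: real
  have iI: "indep_vars (\<lambda>_. borel) \<xi> ?I" by (rule indep_vars_subset[OF ind]) auto
  have Ym: "Y i \<in> borel_measurable borel" for i unfolding Y_def by simp
  have iY: "indep_vars (\<lambda>_. borel) (\<lambda>i \<omega>. Y i (\<xi> i \<omega>)) ?I" by (rule indep_vars_compose2[OF iI Ym])
  have rv: "\<xi> i \<in> borel_measurable P" if "i \<in> ?I" for i using that noise_rv by simp
  have rvY: "(\<lambda>\<omega>. Y i (\<xi> i \<omega>)) \<in> borel_measurable P" if "i \<in> ?I" for i
    using measurable_compose[OF rv[OF that] Ym] .
  have "distr P borel (\<lambda>\<omega>. Y i (\<xi> i \<omega>)) = distr P borel (\<xi> i)" if "i \<in> ?I" for i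
    using noise_symmetric[OF j(1)] by (cases "i = j") (auto simp: Y_def)
  then have "PiM ?I (\<lambda>i. distr P borel (\<lambda>\<omega>. Y i (\<xi> i \<omega>))) = PiM ?I (\<lambda>i. distr P borel (\<xi> i))"
    by (intro PiM_cong) auto
  then have eq: "distr P (PiM ?I (\<lambda>_. borel)) (\<lambda>\<omega>. \<lambda>i\<in>?I. Y i (\<xi> i \<omega>)) = distr P (PiM ?I (\<lambda>_. borel)) (\<lambda>\<omega>. \<lambda>i\<in>?I. \<xi> i \<omega>)"
    using indep_vars_iff_distr_eq_PiM'[OF ne rv] indep_vars_iff_distr_eq_PiM'[OF ne rvY] iI iY by simp
  have m: "(\<lambda>\<omega>. \<lambda>i\<in>?I. \<xi> i \<omega>) \<in> measurable P (PiM ?I (\<lambda>_. borel))" using rv by (intro measurable_restrict) auto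
  have mY: "(\<lambda>\<omega>. \<lambda>i\<in>?I. Y i (\<xi> i \<omega>)) \<in> measurable P (PiM ?I (\<lambda>_. borel))" using rvY by (intro measurable_restrict) auto
  have "prob ((\<lambda>\<omega>. \<lambda>i\<in>?I. Y i (\<xi> i \<omega>)) -` E \<inter> space P) = prob ((\<lambda>\<omega>. \<lambda>i\<in>?I. \<xi> i \<omega>) -` E \<inter> space P)"
    using measure_distr[OF m E] measure_distr[OF mY E] eq by simp
  then show ?thesis by (simp add: Y_def)
qed

text \<open>Fixing the first jump makes the events for different \<open>j\<close> disjoint, so that
  their probabilities add. The event depends on absolute values only and is therefore invariant
  under a flip of the sign at \<open>j\<close>.\<close>

definition first_jump :: "nat \<Rightarrow> nat \<Rightarrow> 'w set" where
  "first_jump a j = {\<omega>\<in>space P. \<bar>\<xi> j \<omega>\<bar> = u \<and> (\<forall>i\<in>{a..<j}. \<bar>\<xi> i \<omega>\<bar> \<noteq> u)}"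

lemma first_jump_sets:
  assumes "1 \<le> a" "a \<le> j"
  shows "first_jump a j \<in> sets P"
proof -
  have [measurable]: "\<xi> j \<in> borel_measurable P" using noise_rv assms by simp
  have "{\<omega>\<in>space P. \<bar>\<xi> i \<omega>\<bar> \<noteq> u} \<in> sets P" if "i \<in> {a..<j}" for i
  proof -
    have [measurable]: "\<xi> i \<in> borel_measurable P" using noise_rv assms that by simp
    show ?thesis by measurable
  qed
  then have "{\<omega>\<in>space P. \<forall>i\<in>{a..<j}. \<bar>\<xi> i \<omega>\<bar> \<noteq> u} \<in> sets P" by (intro sets.sets_Collect_finite_All) auto
  moreover have "{\<omega>\<in>space P. \<bar>\<xi> j \<omega>\<bar> = u} \<in> sets P" by measurable
  moreover have "first_jump a j = {\<omega>\<in>space P. \<bar>\<xi> j \<omega>\<bar> = u} \<inter> {\<omega>\<in>space P. \<forall>i\<in>{a..<j}. \<bar>\<xi> i \<omega>\<bar> \<noteq> u}"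
    by (auto simp: first_jump_def)
  ultimately show ?thesis by simp
qed

lemma first_jump_disjoint: "disjoint_family_on (first_jump a) {a..b}"
  unfolding disjoint_family_on_def first_jump_def
  by (auto simp: set_eq_iff) (metis atLeastLessThan_iff linorder_neqE_nat)

lemma jump_prob_sum:
  assumes a: "1 \<le> a" "a \<le> b"
  shows "(\<Sum>j\<in>{a..b}. prob (first_jump a j)) = 1 - (1 - q) ^ (Suc b - a)"
proof -
  have "(\<Sum>j\<in>{a..b}. prob (first_jump a j)) = prob (\<Union>j\<in>{a..b}. first_jump a j)"
    using first_jump_sets a first_jump_disjoint by (intro finite_measure_finite_Union[symmetric]) auto
  also have "(\<Union>j\<in>{a..b}. first_jump a j) = space P - (\<Inter>j\<in>{a..b}. \<xi> j -` (- {u, - u}) \<inter> space P)"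
  proof (intro set_eqI iffI)
    fix \<omega> assume "\<omega> \<in> (\<Union>j\<in>{a..b}. first_jump a j)"
    then show "\<omega> \<in> space P - (\<Inter>j\<in>{a..b}. \<xi> j -` (- {u, - u}) \<inter> space P)"
      using v by (auto simp: first_jump_def abs_real_def split: if_splits)
  next
    fix \<omega> assume \<omega>: "\<omega> \<in> space P - (\<Inter>j\<in>{a..b}. \<xi> j -` (- {u, - u}) \<inter> space P)"
    have "\<exists>j. j \<in> {a..b} \<and> \<bar>\<xi> j \<omega>\<bar> = u"
    proof (rule ccontr)
      assume "\<not> ?thesis"
      then have "\<xi> j \<omega> \<in> - {u, - u}" if "j \<in> {a..b}" for j using that v by auto
      then have "\<omega> \<in> (\<Inter>j\<in>{a..b}. \<xi> j -` (- {u, - u}) \<inter> space P)" using \<omega> by blast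
      then show False using \<omega> by blast
    qed
    then obtain j where j: "j \<in> {a..b}" "\<bar>\<xi> j \<omega>\<bar> = u" "\<And>i. i < j \<Longrightarrow> \<not> (i \<in> {a..b} \<and> \<bar>\<xi> i \<omega>\<bar> = u)"
      using exists_least_iff[of "\<lambda>j. j \<in> {a..b} \<and> \<bar>\<xi> j \<omega>\<bar> = u"] by blast
    then have "\<omega> \<in> first_jump a j" using \<omega> by (auto simp: first_jump_def)
    then show "\<omega> \<in> (\<Union>j\<in>{a..b}. first_jump a j)" using j(1) by blast
  qed
  also have "prob \<dots> = 1 - prob (\<Inter>j\<in>{a..b}. \<xi> j -` (- {u, - u}) \<inter> space P)"
    using a noise_rv by (intro prob_compl sets.finite_INT) (auto intro!: measurable_sets)
  also have "prob (\<Inter>j\<in>{a..b}. \<xi> j -` (- {u, - u}) \<inter> space P) = (\<Prod>j\<in>{a..b}. prob (\<xi> j -` (- {u, - u}) \<inter> space P))"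
    using a by (intro indep_varsD[OF ind]) auto
  also have "\<dots> = (\<Prod>j\<in>{a..b}. 1 - q)"
  proof (rule prod.cong[OF refl])
    fix j assume "j \<in> {a..b}"
    then show "prob (\<xi> j -` (- {u, - u}) \<inter> space P) = 1 - q"
      using noise_prob[of j "- {u, - u}"] a v by (simp add: indicator_def)
  qed
  finally show ?thesis by simp
qed

text \<open>On a first jump at \<open>j\<close> the flip changes the window sum of the iterates by
  at least \<open>u\<close>, so this sum is at least \<open>u / 2\<close> in absolute value either
  before or after the flip. As the flip preserves both the law of the noise and the event, the first
  alternative has at least half of the probability of the first jump.\<close>

lemma jump_oscillation_prob:
  fixes \<eta> \<alpha> :: real
  assumes \<eta>: "0 < \<eta>" and \<alpha>: "0 \<le> \<alpha>" and a: "2 \<le> a" "a \<le> b" "b + L \<le> N"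
    and sa: "step_size \<eta> \<alpha> a \<le> 1" and L: "1 \<le> real (Suc L) * step_size \<eta> \<alpha> N"
    and h: "real (Suc L) / real N < h" and w: "w < u / (2 * sqrt (real N))"
  shows "(1 - (1 - q) ^ (Suc b - a)) / 2 \<le>
    measure (path_law P (oracle_path (step_size \<eta> \<alpha>) (linear_oracle P \<xi>) N)) (osc_paths 0 h w)"
proof -
  let ?st = "step_size \<eta> \<alpha>" and ?M = "linear_oracle P \<xi>" and ?I = "{1..N}"
  have N: "2 \<le> N" using a by simp
  \<comment> \<open>The same oracle on the space of noise vectors of length \<open>N\<close>. It
    exhibits the iterates up to index \<open>Suc N\<close> as measurable functions of the vector, to
    which the flip can be applied; the noise beyond \<open>N\<close> is set to 0 and does not enter
    them.\<close>
  define R where "R = linear_oracle (PiM ?I (\<lambda>_. borel)) (\<lambda>i f. if i \<le> N then f i else 0 :: real)"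
  define G where "G j f = (\<Sum>i\<le>L. iterate ?st R (Suc (j + i)) f)" for j f
  define V where "V \<omega> = (\<lambda>i\<in>?I. \<xi> i \<omega>)" for \<omega>
  define V' where "V' j \<omega> = (\<lambda>i\<in>?I. if i = j then - \<xi> i \<omega> else \<xi> i \<omega>)" for j \<omega>
  have Gm: "G j \<in> borel_measurable (PiM ?I (\<lambda>_. borel))" for j
  proof -
    have "iterate ?st R t \<in> borel_measurable (PiM ?I (\<lambda>_. borel))" for t
    proof (rule iterate_measurable)
      show "drift R \<in> borel_measurable borel" by (simp add: R_def linear_oracle_def)
      fix t :: nat assume "1 \<le> t"
      then show "noise R t \<in> borel_measurable (PiM ?I (\<lambda>_. borel))"
        by (cases "t \<le> N") (auto simp: R_def linear_oracle_def intro!: measurable_component_singleton)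
    qed
    then show ?thesis unfolding G_def by (intro borel_measurable_sum)
  qed
  have recR: "iterate ?st R (Suc t) f = (1 - ?st t) * iterate ?st R t f + ?st t * (if t \<le> N then f t else 0)"
    if "1 \<le> t" for t f
    using linear_recursion[of R t ?st f] that by (simp add: R_def linear_oracle_def)
  have iter: "iterate ?st ?M t \<omega> = iterate ?st R t (V \<omega>)" if "t \<le> Suc N" for t \<omega>
    using that
  proof (induction t)
    case (Suc t)
    show ?case
    proof (cases "t = 0")
      case True
      then show ?thesis by (simp add: iterate.simps(2))
    next
      case False
      then have t: "1 \<le> t" by simp
      have "iterate ?st ?M (Suc t) \<omega> = (1 - ?st t) * iterate ?st ?M t \<omega> + ?st t * \<xi> t \<omega>"
        using linear_recursion[of ?M t ?st \<omega>] t by (simp add: linear_oracle_def)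
      moreover have "V \<omega> t = \<xi> t \<omega>" using t Suc.prems by (simp add: V_def)
      ultimately show ?thesis using recR[OF t, of "V \<omega>"] Suc t by simp
    qed
  qed simp
  define E where "E j = {f\<in>space (PiM ?I (\<lambda>_. borel)). u \<le> 2 * \<bar>G j f\<bar> \<and> \<bar>f j\<bar> = u \<and> (\<forall>i\<in>{a..<j}. \<bar>f i\<bar> \<noteq> u)}" for j
  have E: "E j \<in> sets (PiM ?I (\<lambda>_. borel))" if j: "j \<in> {a..b}" for j
  proof -
    let ?S = "PiM ?I (\<lambda>_. borel :: real measure)"
    have comp: "(\<lambda>f. f i) \<in> borel_measurable ?S" if "i \<in> ?I" for i
      using that by (rule measurable_component_singleton)
    note Gm[of j, measurable]
    have "{f\<in>space ?S. \<bar>f i\<bar> \<noteq> u} \<in> sets ?S" if "i \<in> {a..<j}" for i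
    proof -
      have [measurable]: "(\<lambda>f. f i) \<in> borel_measurable ?S" using that j a by (intro comp) auto
      show ?thesis by measurable
    qed
    then have 1: "{f\<in>space ?S. \<forall>i\<in>{a..<j}. \<bar>f i\<bar> \<noteq> u} \<in> sets ?S" by (intro sets.sets_Collect_finite_All) auto
    have [measurable]: "(\<lambda>f. f j) \<in> borel_measurable ?S" using j a by (intro comp) auto
    have 2: "{f\<in>space ?S. u \<le> 2 * \<bar>G j f\<bar> \<and> \<bar>f j\<bar> = u} \<in> sets ?S" by measurable
    have "E j = {f\<in>space ?S. u \<le> 2 * \<bar>G j f\<bar> \<and> \<bar>f j\<bar> = u} \<inter> {f\<in>space ?S. \<forall>i\<in>{a..<j}. \<bar>f i\<bar> \<noteq> u}"
      by (auto simp: E_def)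
    then show ?thesis using 1 2 by simp
  qed
  have Vsp: "V \<omega> \<in> space (PiM ?I (\<lambda>_. borel))" "V' j \<omega> \<in> space (PiM ?I (\<lambda>_. borel))" for \<omega> j
    by (auto simp: V_def V'_def space_PiM)
  have rvI: "\<xi> i \<in> borel_measurable P" if "i \<in> ?I" for i using that noise_rv by simp
  have Vm: "V \<in> measurable P (PiM ?I (\<lambda>_. borel))"
    unfolding V_def using rvI by (intro measurable_restrict) auto
  have V'm: "V' j \<in> measurable P (PiM ?I (\<lambda>_. borel))" for j
    unfolding V'_def using rvI by (intro measurable_restrict) (auto intro!: borel_measurable_uminus)
  have half: "prob (first_jump a j) \<le> 2 * prob (V -` E j \<inter> space P)" if j: "j \<in> {a..b}" for j
  proof -
    have sub: "first_jump a j \<subseteq> (V -` E j \<inter> space P) \<union> (V' j -` E j \<inter> space P)"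
    proof
      fix \<omega> assume \<omega>: "\<omega> \<in> first_jump a j"
      let ?x = "\<lambda>t. iterate ?st R t (V \<omega>)" and ?y = "\<lambda>t. iterate ?st R t (V' j \<omega>)"
      have "\<bar>V \<omega> j\<bar> \<le> \<bar>\<Sum>i\<le>L. ?x (Suc (j + i)) - ?y (Suc (j + i))\<bar>"
      proof -
        have "\<bar>(if j \<le> N then V \<omega> j else 0)\<bar> \<le> \<bar>\<Sum>i\<le>L. ?x (Suc (j + i)) - ?y (Suc (j + i))\<bar>"
        proof (rule recursion_flip_response[where e = "\<lambda>t. if t \<le> N then V \<omega> t else 0" and st = ?st
              and e' = "\<lambda>t. if t \<le> N then V' j \<omega> t else 0"])
          show "?st j \<le> 1" using step_size_antimono[of \<eta> \<alpha> a j] \<eta> \<alpha> a j sa by auto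
          show "0 \<le> ?st t \<and> ?st t \<le> ?st j" if "j \<le> t" for t
            using step_size_antimono[of \<eta> \<alpha> j t] step_size_pos[OF \<eta>, of t \<alpha>] \<eta> \<alpha> a j that by auto
          have "?st N \<le> ?st j" using step_size_antimono[of \<eta> \<alpha> j N] \<eta> \<alpha> a j by auto
          then have "real (Suc L) * ?st N \<le> real (Suc L) * ?st j" by (intro mult_left_mono) auto
          then show "1 \<le> real (Suc L) * ?st j" using L by linarith
        qed (use recR a j in \<open>auto simp: V_def V'_def iterate.simps(2)\<close>)
        then show ?thesis using a j by simp
      qed
      also have "\<dots> \<le> \<bar>G j (V \<omega>)\<bar> + \<bar>G j (V' j \<omega>)\<bar>"
        unfolding sum_subtractf G_def by (rule abs_triangle_ineq4)
      also have "\<bar>V \<omega> j\<bar> = u" using \<omega> a j by (simp add: first_jump_def V_def)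
      finally have "u \<le> 2 * \<bar>G j (V \<omega>)\<bar> \<or> u \<le> 2 * \<bar>G j (V' j \<omega>)\<bar>" by linarith
      moreover have "\<bar>V \<omega> j\<bar> = u \<and> (\<forall>i\<in>{a..<j}. \<bar>V \<omega> i\<bar> \<noteq> u)"
        "\<bar>V' j \<omega> j\<bar> = u \<and> (\<forall>i\<in>{a..<j}. \<bar>V' j \<omega> i\<bar> \<noteq> u)" "\<omega> \<in> space P"
        using \<omega> a j by (auto simp: first_jump_def V_def V'_def)
      ultimately show "\<omega> \<in> (V -` E j \<inter> space P) \<union> (V' j -` E j \<inter> space P)"
        using Vsp unfolding E_def by blast
    qed
    have "prob (first_jump a j) \<le> prob ((V -` E j \<inter> space P) \<union> (V' j -` E j \<inter> space P))"
      using measurable_sets[OF Vm E[OF j]] measurable_sets[OF V'm E[OF j]]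
      by (intro finite_measure_mono[OF sub]) auto
    also have "\<dots> \<le> prob (V -` E j \<inter> space P) + prob (V' j -` E j \<inter> space P)"
      using measurable_sets[OF Vm E[OF j]] measurable_sets[OF V'm E[OF j]] by (intro measure_Un_le)
    also have "prob (V' j -` E j \<inter> space P) = prob (V -` E j \<inter> space P)"
      using joint_flip[OF _ _ E[OF j]] a j unfolding V_def V'_def by auto
    finally show ?thesis by simp
  qed
  have drift: "drift ?M \<in> borel_measurable borel" by (simp add: linear_oracle_def)
  have noise: "noise ?M t \<in> borel_measurable P" if "1 \<le> t" for t using noise_rv[OF that] by (simp add: linear_oracle_def)
  have ml: "measure (path_law P (oracle_path ?st ?M N)) (osc_paths 0 h w) =
      measure P {\<omega>\<in>space P. restrict (oracle_path ?st ?M N \<omega>) {0..1} \<in> osc_paths 0 h w}"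
    "{\<omega>\<in>space P. restrict (oracle_path ?st ?M N \<omega>) {0..1} \<in> osc_paths 0 h w} \<in> sets P"
    by (rule measure_oracle_path_law[OF drift noise osc_paths_sets[OF order_refl]]; assumption)+
  have "(\<Union>j\<in>{a..b}. V -` E j \<inter> space P) \<subseteq> {\<omega>\<in>space P. restrict (oracle_path ?st ?M N \<omega>) {0..1} \<in> osc_paths 0 h w}"
  proof
    fix \<omega> assume "\<omega> \<in> (\<Union>j\<in>{a..b}. V -` E j \<inter> space P)"
    then obtain j where j: "j \<in> {a..b}" and \<omega>: "\<omega> \<in> space P" "V \<omega> \<in> E j" by blast
    \<comment> \<open>The increment of the path from \<open>j - 1\<close> to \<open>j + L\<close> on
      the grid collects the \<open>L + 1\<close> iterates with index \<open>Suc j\<close> to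
      \<open>Suc (j + L)\<close>, the first that feel the noise at \<open>j\<close>. Since
      \<open>j \<ge> 2\<close>, the left end is positive, as \<open>osc_paths 0\<close>
      demands.\<close>
    define s where "s = real (j - 1) / real N"
    define t where "t = real (j + L) / real N"
    have jN: "j + L \<le> N" "2 \<le> j" using j a by auto
    have st: "0 < s" "s < t" "t \<le> 1" "t - s = real (Suc L) / real N"
      using jN N by (auto simp: s_def t_def divide_less_cancel divide_le_eq_1 diff_divide_distrib[symmetric] of_nat_diff)
    have "oracle_path ?st ?M N \<omega> t - oracle_path ?st ?M N \<omega> s =
        ((\<Sum>k<j + L. iterate ?st ?M (k + 2) \<omega>) - (\<Sum>k<j - 1. iterate ?st ?M (k + 2) \<omega>)) / sqrt (real N)"
      unfolding s_def t_def using jN N by (subst (1 2) oracle_path_grid) (auto simp: diff_divide_distrib)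
    also have "(\<Sum>k<j + L. iterate ?st ?M (k + 2) \<omega>) - (\<Sum>k<j - 1. iterate ?st ?M (k + 2) \<omega>) = G j (V \<omega>)"
    proof -
      have "{..<j + L} = {..<j - 1} \<union> {j - 1..<j + L}" using jN by auto
      then have "(\<Sum>k<j + L. iterate ?st ?M (k + 2) \<omega>) - (\<Sum>k<j - 1. iterate ?st ?M (k + 2) \<omega>) = (\<Sum>k\<in>{j - 1..<j + L}. iterate ?st ?M (k + 2) \<omega>)"
        by (simp add: sum.union_disjoint ivl_disj_int)
      also have "\<dots> = (\<Sum>i\<le>L. iterate ?st ?M (Suc (j + i)) \<omega>)"
        by (rule sum.reindex_bij_witness[of _ "\<lambda>i. j - 1 + i" "\<lambda>k. k - (j - 1)"]) (use jN in auto)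
      also have "\<dots> = G j (V \<omega>)" unfolding G_def using jN by (intro sum.cong iter) auto
      finally show ?thesis .
    qed
    finally have "\<bar>oracle_path ?st ?M N \<omega> t - oracle_path ?st ?M N \<omega> s\<bar> = \<bar>G j (V \<omega>)\<bar> / sqrt (real N)"
      by (simp add: abs_divide)
    moreover have "u / 2 / sqrt (real N) \<le> \<bar>G j (V \<omega>)\<bar> / sqrt (real N)"
      using \<omega>(2) by (intro divide_right_mono) (auto simp: E_def)
    ultimately have "w < \<bar>oracle_path ?st ?M N \<omega> t - oracle_path ?st ?M N \<omega> s\<bar>" using w by simp
    then have "restrict (oracle_path ?st ?M N \<omega>) {0..1} \<in> osc_paths 0 h w"
      unfolding osc_paths_def using continuous_skorokhod_path[OF continuous_oracle_path] st h
      by (intro CollectI conjI exI[of _ s] exI[of _ t]) auto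
    then show "\<omega> \<in> {\<omega>\<in>space P. restrict (oracle_path ?st ?M N \<omega>) {0..1} \<in> osc_paths 0 h w}" using \<omega> by simp
  qed
  then have "prob (\<Union>j\<in>{a..b}. V -` E j \<inter> space P) \<le> measure (path_law P (oracle_path ?st ?M N)) (osc_paths 0 h w)"
    unfolding ml(1) by (rule finite_measure_mono[OF _ ml(2)])
  moreover have "prob (\<Union>j\<in>{a..b}. V -` E j \<inter> space P) = (\<Sum>j\<in>{a..b}. prob (V -` E j \<inter> space P))"
  proof (rule finite_measure_finite_Union)
    show "(\<lambda>j. V -` E j \<inter> space P) ` {a..b} \<subseteq> sets P" using measurable_sets[OF Vm E] by auto
    have "V -` E j \<inter> space P \<subseteq> first_jump a j" if "j \<in> {a..b}" for j
      using that a by (auto simp: E_def V_def first_jump_def)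
    then show "disjoint_family_on (\<lambda>j. V -` E j \<inter> space P) {a..b}"
      using first_jump_disjoint[of a b] unfolding disjoint_family_on_def by blast
  qed simp
  moreover have "(\<Sum>j\<in>{a..b}. prob (first_jump a j)) \<le> (\<Sum>j\<in>{a..b}. 2 * prob (V -` E j \<inter> space P))"
    using half by (intro sum_mono)
  ultimately show ?thesis using jump_prob_sum[of a b] a by (simp add: sum_distrib_left[symmetric])
qed

end

text \<open>Since \<open>(1 - q) ^ n * (1 + q) ^ n \<le> 1\<close>, Bernoulli's inequality gives
  \<open>(1 - q) ^ n \<le> 1 / (1 + n * q)\<close>, and this is at most \<open>1 - n * q / 2\<close>
  when \<open>n * q \<le> 1\<close>.\<close>

lemma power_compl_bound:
  fixes q :: real
  assumes "0 \<le> q" "q \<le> 1" "real n * q \<le> 1"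
  shows "real n * q / 2 \<le> 1 - (1 - q) ^ n"
proof -
  have "1 + real n * q \<le> (1 + q) ^ n" using assms by (intro Bernoulli_inequality) auto
  then have "(1 - q) ^ n * (1 + real n * q) \<le> (1 - q) ^ n * (1 + q) ^ n"
    using assms by (intro mult_left_mono) auto
  also have "\<dots> = (1 - q\<^sup>2) ^ n" by (simp add: power_mult_distrib[symmetric] power2_eq_square algebra_simps)
  also have "\<dots> \<le> 1" using assms by (intro power_le_one) (auto simp: power_le_one)
  finally have 1: "(1 - q) ^ n * (1 + real n * q) \<le> 1" .
  have "(1 - real n * q / 2) * (1 + real n * q) = 1 + real n * q / 2 * (1 - real n * q)"
    by (simp add: field_simps)
  also have "\<dots> \<ge> 1" using assms by simp
  finally have "(1 - q) ^ n * (1 + real n * q) \<le> (1 - real n * q / 2) * (1 + real n * q)" using 1 by linarith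
  moreover have "0 < 1 + real n * q" using assms by (intro add_pos_nonneg) auto
  ultimately have "(1 - q) ^ n \<le> 1 - real n * q / 2" by (simp only: mult_le_cancel_right_pos)
  then show ?thesis by linarith
qed

lemma osc_lower_bound:
  fixes \<eta> \<alpha> p K \<kappa> c :: real and N0 :: nat
  assumes \<eta>: "0 < \<eta>" and \<alpha>: "0 < \<alpha>" "\<alpha> < 1" and p: "2 < p" and ao: "a_osc p < a_sm \<alpha>"
    and K: "4 < K" and \<kappa>: "0 < \<kappa>" and c: "0 < c"
    and N0: "\<And>N. N \<ge> N0 \<Longrightarrow> osc_q p \<kappa> c N < 1 \<and> osc_q p \<kappa> c N * (osc_u p K c N)\<^sup>2 < 1"
    and osc: "\<And>N. N \<ge> N0 \<Longrightarrow>
        osc_noise (osc_q p \<kappa> c N) (osc_u p K c N) (osc_v p K \<kappa> c N) (P N) (\<xi> N)"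
    and B: "standard_brownian_motion_on {0..1} Q B"
  shows "\<exists>C>0. \<exists>T0. \<forall>T\<ge>T0. C * real T powr (- a_osc p) \<le>
    prokhorov_dist (path_law (pmeasure (linear_oracle (P T) (\<xi> T))) (oracle_path (step_size \<eta> \<alpha>) (linear_oracle (P T) (\<xi> T)) T))
      (path_law Q (target_path B (linear_oracle (P T) (\<xi> T))))"
proof -
  let ?st = "step_size \<eta> \<alpha>"
  have Q: "prob_space Q" using B by (simp add: standard_brownian_motion_on_def)
  define a where "a = a_osc p"
  have a: "0 < a" "a < (1 - \<alpha>) / 2" "a < 1/2"
    using p ao \<alpha> by (auto simp: a_def a_osc_def a_sm_def)
  \<comment> \<open>\<open>\<beta>\<close> lies between \<open>a / (1 - \<alpha>)\<close> and
    \<open>1/2\<close>, so the Hoelder estimate for Brownian motion over windows of length of order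
    \<open>T powr (\<alpha> - 1)\<close> is below \<open>T powr (- a)\<close> by the factor
    \<open>T powr (- \<theta>)\<close>. This whole surplus goes into the Hoelder constant, and
    \<open>l\<close> makes its failure rarer than \<open>T powr (- a)\<close>.\<close>
  define g where "g = a / (1 - \<alpha>)"
  define \<beta> where "\<beta> = (g + 1/2) / 2"
  have g: "0 < g" "g < 1/2" using a \<alpha> by (auto simp: g_def field_simps)
  have \<beta>: "0 < \<beta>" "\<beta> < 1/2" using g by (auto simp: \<beta>_def)
  have "g < \<beta>" using g by (simp add: \<beta>_def)
  then have ab: "a < (1 - \<alpha>) * \<beta>" using \<alpha> by (simp add: g_def field_simps)
  define \<theta> where "\<theta> = (1 - \<alpha>) * \<beta> - a"
  have \<theta>: "0 < \<theta>" using ab by (simp add: \<theta>_def)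
  obtain l :: nat where l: "max (1 / (1 - 2 * \<beta>)) (a / (2 * \<theta>)) < real l" using reals_Archimedean2 by blast
  then have l1: "1 < real l * (1 - 2 * \<beta>)" and l2: "a < 2 * real l * \<theta>"
    using \<beta> \<theta> by (auto simp: field_simps)
  let ?K = "Brownian_tail_const \<beta> l"
  have Kp: "0 < ?K" using l1 by (rule Brownian_tail_const_pos)
  \<comment> \<open>A window of \<open>L + 2 \<le> T powr \<alpha> / \<eta> + 3\<close> grid steps,
    doubled by the passage to the neighbourhood, has length at most
    \<open>Ch * T powr (- (1 - \<alpha>))\<close>. \<open>CD\<close> is then chosen so that the
    Hoelder bound over this length is exactly \<open>c * T powr (- a)\<close>.\<close>
  define Ch where "Ch = 2 * (1 / \<eta> + 3)"
  have Ch: "0 < Ch" using \<eta> by (simp add: Ch_def add_pos_pos)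
  define CD where "CD = c / (Holder_const \<beta> * Ch powr \<beta>)"
  have CD: "0 < CD" using c Ch Holder_const_pos[OF \<beta>(1)] by (simp add: CD_def)
  have "\<forall>\<^sub>F T::nat in sequentially. ?K / (CD ^ (2 * l) * real T powr (2 * real l * \<theta>)) \<le> \<kappa> * (c * real T powr (- a)) / 64"
    using l2 Kp CD \<kappa> c a by real_asymp
  moreover have "\<forall>\<^sub>F T::nat in sequentially. \<eta> * (real T / 4) powr (- \<alpha>) \<le> 1"
    using \<eta> \<alpha> by real_asymp
  moreover have "\<forall>\<^sub>F T::nat in sequentially. real T powr \<alpha> / \<eta> + 1 \<le> real T / 4"
    using \<eta> \<alpha> by real_asymp
  moreover have "\<forall>\<^sub>F T::nat in sequentially. c * real T powr (- a) \<le> 1/2 \<and> \<kappa> * (c * real T powr (- a)) \<le> 1"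
    using a c \<kappa> by (intro eventually_conj; real_asymp)
  moreover have "\<forall>\<^sub>F T::nat in sequentially. 1 < K * (c * real T powr (- a)) * sqrt (real T)"
    using a c K by real_asymp
  moreover have "\<forall>\<^sub>F T::nat in sequentially. max N0 8 \<le> T" by (rule eventually_ge_at_top)
  ultimately have "\<forall>\<^sub>F T::nat in sequentially. ?K / (CD ^ (2 * l) * real T powr (2 * real l * \<theta>)) \<le> \<kappa> * (c * real T powr (- a)) / 64 \<and>
      \<eta> * (real T / 4) powr (- \<alpha>) \<le> 1 \<and> real T powr \<alpha> / \<eta> + 1 \<le> real T / 4 \<and>
      (c * real T powr (- a) \<le> 1/2 \<and> \<kappa> * (c * real T powr (- a)) \<le> 1) \<and>
      1 < K * (c * real T powr (- a)) * sqrt (real T) \<and> max N0 8 \<le> T"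
    by eventually_elim blast
  then obtain T0 where T0: "\<And>T. T0 \<le> T \<Longrightarrow> ?K / (CD ^ (2 * l) * real T powr (2 * real l * \<theta>)) \<le> \<kappa> * (c * real T powr (- a)) / 64 \<and>
      \<eta> * (real T / 4) powr (- \<alpha>) \<le> 1 \<and> real T powr \<alpha> / \<eta> + 1 \<le> real T / 4 \<and>
      (c * real T powr (- a) \<le> 1/2 \<and> \<kappa> * (c * real T powr (- a)) \<le> 1) \<and>
      1 < K * (c * real T powr (- a)) * sqrt (real T) \<and> max N0 8 \<le> T"
    unfolding eventually_sequentially by blast
  have "min (1/2) (\<kappa> / 32) * c * real T powr (- a) \<le>
      prokhorov_dist (path_law (pmeasure (linear_oracle (P T) (\<xi> T))) (oracle_path ?st (linear_oracle (P T) (\<xi> T)) T))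
        (path_law Q (target_path B (linear_oracle (P T) (\<xi> T))))" if T: "T0 \<le> T" for T
  proof -
    let ?M = "linear_oracle (P T) (\<xi> T)"
    have TN: "N0 \<le> T" "8 \<le> T" using T0[OF T] by auto
    define e where "e = c * real T powr (- a)"
    have e: "0 < e" "e \<le> 1/2" "\<kappa> * e \<le> 1" using c TN T0[OF T] by (auto simp: e_def)
    define q where "q = osc_q p \<kappa> c T"
    define u where "u = osc_u p K c T"
    define v where "v = osc_v p K \<kappa> c T"
    have q_eq: "q = \<kappa> * e / real T" and u_eq: "u = K * e * sqrt (real T)"
      by (simp_all add: q_def u_def osc_q_def osc_u_def osc_eps_def e_def a_def)
    have q: "0 < q" "q < 1" using N0[OF TN(1)] \<kappa> e TN by (auto simp: q_eq)
    have u: "1 < u" using T0[OF T] by (simp add: u_eq e_def)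
    have qu: "q * u\<^sup>2 < 1" using N0[OF TN(1)] by (simp add: q_def u_def)
    have v_eq: "v = sqrt ((1 - q * u\<^sup>2) / (1 - q))" by (simp add: v_def osc_v_def q_def u_def)
    \<comment> \<open>A jump size above 1 with total variance 1 forces \<open>v \<le> 1\<close>,
      which separates the two noise levels.\<close>
    have "1 \<le> u\<^sup>2" using u by (simp add: one_le_power)
    then have "q * 1 \<le> q * u\<^sup>2" using q by (intro mult_left_mono) auto
    then have "(1 - q * u\<^sup>2) / (1 - q) \<le> 1" using q by simp
    then have "v \<le> 1" unfolding v_eq by simp
    then have v: "v < u" "0 \<le> v" using u qu q by (linarith, simp add: v_eq)
    have on: "osc_noise q u v (P T) (\<xi> T)" using osc[OF TN(1)] by (simp add: q_def u_def v_def)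
    then have PT: "prob_space (P T)" by (simp add: osc_noise_def)
    interpret prob_space "P T" by fact
    interpret osc_setup "P T" "\<xi> T" q u v using on q v by unfold_locales
    have "v\<^sup>2 = (1 - q * u\<^sup>2) / (1 - q)" using qu q by (simp add: v_eq)
    then have "q * u\<^sup>2 + (1 - q) * v\<^sup>2 = 1" using q by simp
    then have "lim_variance ?M = 1"
      using second_moment by (intro lim_variance_linear_oracle[OF PT ind]) simp_all
    then have tgt: "target_path B ?M = (\<lambda>\<omega> r. B r \<omega>)"
      by (intro target_path_unit lin_coeff_linear_oracle)
    define L where "L = nat \<lceil>real T powr \<alpha> / \<eta>\<rceil>"
    have "0 \<le> real T powr \<alpha> / \<eta>" using \<eta> by simp
    then have L: "real T powr \<alpha> / \<eta> \<le> real L" "real L \<le> real T powr \<alpha> / \<eta> + 1" unfolding L_def by linarith+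
    have LT: "real L \<le> real T / 4" using L(2) T0[OF T] by linarith
    define h where "h = real (L + 2) / real T"
    have Ta: "1 \<le> real T powr \<alpha>" using TN \<alpha> by (intro ge_one_powr_ge_zero) auto
    have h: "0 < h" "2 * h \<le> Ch * real T powr (- (1 - \<alpha>))"
    proof -
      show "0 < h" using TN by (simp add: h_def)
      have "real (L + 2) \<le> real T powr \<alpha> / \<eta> + 3" using L(2) by simp
      also have "\<dots> \<le> (1 / \<eta> + 3) * real T powr \<alpha>" using Ta by (simp add: algebra_simps)
      finally have "h \<le> (1 / \<eta> + 3) * real T powr \<alpha> / real T" unfolding h_def by (intro divide_right_mono) auto
      also have "\<dots> = (1 / \<eta> + 3) * real T powr (- (1 - \<alpha>))" using TN by (simp add: powr_diff powr_minus field_simps)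
      finally show "2 * h \<le> Ch * real T powr (- (1 - \<alpha>))" unfolding Ch_def mult.assoc by linarith
    qed
    \<comment> \<open>Only jumps in the second half are used, where the step sizes are at most 1;
      after removing the last \<open>L\<close> times, at least \<open>T / 4\<close> candidates
      remain.\<close>
    define A where "A = T div 2"
    have A: "real A \<le> real T / 2" "real T / 2 - 1/2 \<le> real A" unfolding A_def by linarith+
    have LT': "4 * L \<le> T" using LT by linarith
    have AT: "2 \<le> A" "A \<le> T - L" "T - L + L \<le> T" using LT' TN(2) unfolding A_def by linarith+
    define n where "n = Suc (T - L) - A"
    have n: "real T / 4 \<le> real n" "real n \<le> real T"
    proof -
      have "real n = real T - real L + 1 - real A" using AT LT' unfolding n_def by (simp add: of_nat_diff)
      then show "real T / 4 \<le> real n" using A LT by linarith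
      show "real n \<le> real T" using AT unfolding n_def by linarith
    qed
    \<comment> \<open>A radius below \<open>e / 2\<close> leaves an oscillation above
      \<open>e\<close> to every path of the neighbourhood. For the masses,
      \<open>n * q \<ge> \<kappa> * e / 4\<close> gives at least \<open>\<kappa> * e / 16\<close>
      for the oracle; the target contributes at most \<open>\<kappa> * e / 64\<close>, and
      \<open>\<kappa> * e / 32\<close> still fits in between.\<close>
    have "min (1/2) (\<kappa> / 32) * e \<le> prokhorov_dist (path_law (P T) (oracle_path ?st ?M T)) (path_law Q (\<lambda>\<omega> r. B r \<omega>))"
    proof (rule prokhorov_dist_ge)
      fix \<delta> :: real assume \<delta>: "0 < \<delta>" "\<delta> < min (1/2) (\<kappa> / 32) * e"
      have \<delta>1: "\<delta> < e / 2" "\<delta> < \<kappa> * e / 32"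
        using \<delta>(2) e mult_right_mono[of "min (1/2) (\<kappa> / 32)" "1/2" e] mult_right_mono[of "min (1/2) (\<kappa> / 32)" "\<kappa> / 32" e] by linarith+
      let ?\<Gamma> = "osc_paths 0 h (2 * e)"
      have "\<kappa> * e / 16 \<le> (1 - (1 - q) ^ n) / 2"
      proof -
        have "real n * q \<le> real T * q" using n q by (intro mult_right_mono) auto
        also have "\<dots> = \<kappa> * e" using TN by (simp add: q_eq)
        finally have nq: "real n * q \<le> 1" using e by linarith
        have "real T / 4 * q \<le> real n * q" using n q by (intro mult_right_mono) auto
        moreover have "real T / 4 * q = \<kappa> * e / 4" using TN by (simp add: q_eq)
        ultimately have "\<kappa> * e / 4 \<le> real n * q" by (simp only:)
        also have "\<dots> = 2 * (real n * q / 2)" by simp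
        also have "\<dots> \<le> 2 * (1 - (1 - q) ^ n)"
          using q by (intro mult_left_mono power_compl_bound[OF _ _ nq]) auto
        finally have "\<kappa> * e / 4 / 4 \<le> 2 * (1 - (1 - q) ^ n) / 4" by (rule divide_right_mono) simp
        then show ?thesis by simp
      qed
      also have "\<dots> \<le> measure (path_law (P T) (oracle_path ?st ?M T)) ?\<Gamma>"
        unfolding n_def
      proof (rule jump_oscillation_prob[OF \<eta> _ AT])
        show "?st A \<le> 1"
        proof -
          have "real A powr (- \<alpha>) \<le> (real T / 4) powr (- \<alpha>)" using A TN \<alpha> by (intro powr_mono2') auto
          then have "?st A \<le> \<eta> * (real T / 4) powr (- \<alpha>)" using \<eta> by (simp add: step_size_def)
          then show ?thesis using T0[OF T] by linarith
        qed
        show "1 \<le> real (Suc L) * ?st T"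
        proof -
          have "real T powr \<alpha> / \<eta> * ?st T \<le> real (Suc L) * ?st T"
            using L(1) step_size_pos[OF \<eta>, of T \<alpha>] TN by (intro mult_right_mono) auto
          moreover have "real T powr \<alpha> / \<eta> * ?st T = 1" using \<eta> TN by (simp add: step_size_def powr_minus)
          ultimately show ?thesis by simp
        qed
        show "real (Suc L) / real T < h" using TN by (simp add: h_def divide_strict_right_mono)
        \<comment> \<open>Half a jump has scaled size \<open>K * e / 2\<close>, which exceeds
          \<open>2 * e\<close> because \<open>K > 4\<close>.\<close>
        have "u / (2 * sqrt (real T)) = K * e / 2" using TN by (simp add: u_eq)
        moreover have "4 * e < K * e" using K e by (intro mult_strict_right_mono) auto
        ultimately show "2 * e < u / (2 * sqrt (real T))" by linarith
      qed (use \<alpha> in simp)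
      finally have \<mu>: "\<kappa> * e / 16 \<le> measure (path_law (P T) (oracle_path ?st ?M T)) ?\<Gamma>" .
      have e2: "exp \<delta> \<le> 2"
      proof -
        have "exp \<delta> \<le> 1 + \<delta> + \<delta>\<^sup>2" using \<delta> \<delta>1 e by (intro exp_bound) auto
        also have "\<dots> \<le> 1 + 1 / 4 + (1 / 4)\<^sup>2" using \<delta> \<delta>1 e by (intro add_mono power_mono) auto
        finally show ?thesis by (simp add: power2_eq_square)
      qed
      define D where "D = CD * real T powr \<theta>"
      have D: "0 < D" using CD TN by (simp add: D_def)
      have \<nu>: "measure (path_law Q (\<lambda>\<omega> r. B r \<omega>)) (skorokhod_nbhd ?\<Gamma> \<delta>) \<le> \<kappa> * e / 64"
      proof (rule Brownian_Holder[OF B _ _ \<beta>(1) l1 D, of 1])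
        fix bad assume bad: "bad \<in> sets Q" "measure Q bad \<le> ?K / D ^ (2 * l)"
          "\<And>\<omega> s t. \<omega> \<in> space Q \<Longrightarrow> \<omega> \<notin> bad \<Longrightarrow> s \<in> {0..1} \<Longrightarrow> t \<in> {0..1} \<Longrightarrow>
            \<bar>B t \<omega> - B s \<omega>\<bar> \<le> D * Holder_const \<beta> * 1 powr (1/2 - \<beta>) * \<bar>t - s\<bar> powr \<beta>"
        have "measure (path_law Q (\<lambda>\<omega> r. B r \<omega>)) (skorokhod_nbhd ?\<Gamma> \<delta>) \<le> measure Q bad"
        proof (rule measure_path_law_le[OF Q bad(1)])
          fix \<omega> assume \<omega>: "\<omega> \<in> space Q" "\<omega> \<notin> bad"
          show "(\<lambda>r\<in>{0..1}. B r \<omega>) \<notin> skorokhod_nbhd ?\<Gamma> \<delta>"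
          proof
            assume *: "(\<lambda>r\<in>{0..1}. B r \<omega>) \<in> skorokhod_nbhd ?\<Gamma> \<delta>"
            obtain s t where st: "0 \<le> s" "s < t" "t \<le> 1" "t - s \<le> exp \<delta> * h"
              "2 * e - 2 * \<delta> < \<bar>B t \<omega> - B s \<omega>\<bar>"
              using nbhd_osc_paths[OF _ *] by (auto simp: restrict_def split: if_splits)
            have "exp \<delta> * h \<le> 2 * h" using e2 h by (intro mult_right_mono) auto
            then have ts: "t - s \<le> Ch * real T powr (- (1 - \<alpha>))" using st h by linarith
            have "\<bar>B t \<omega> - B s \<omega>\<bar> \<le> D * Holder_const \<beta> * (t - s) powr \<beta>"
              using bad(3)[OF \<omega>, of s t] st by simp
            also have "\<dots> \<le> D * Holder_const \<beta> * (Ch * real T powr (- (1 - \<alpha>))) powr \<beta>"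
              using ts st D \<beta> less_imp_le[OF Holder_const_pos[OF \<beta>(1)]] by (intro mult_left_mono powr_mono2) auto
            also have "\<dots> = e"
            proof -
              have "(Ch * real T powr (- (1 - \<alpha>))) powr \<beta> = Ch powr \<beta> * real T powr (- ((1 - \<alpha>) * \<beta>))"
                by (simp only: powr_mult powr_powr mult_minus_left)
              moreover have "real T powr \<theta> * real T powr (- ((1 - \<alpha>) * \<beta>)) = real T powr (- a)"
                by (simp add: powr_add[symmetric] \<theta>_def)
              moreover have "CD * (Holder_const \<beta> * Ch powr \<beta>) = c"
                using Ch Holder_const_pos[OF \<beta>(1)] by (simp add: CD_def)
              moreover have "D * Holder_const \<beta> * (Ch powr \<beta> * real T powr (- ((1 - \<alpha>) * \<beta>))) =
                  (CD * (Holder_const \<beta> * Ch powr \<beta>)) * (real T powr \<theta> * real T powr (- ((1 - \<alpha>) * \<beta>)))"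
                by (simp add: D_def)
              ultimately show ?thesis by (simp only: e_def)
            qed
            finally show False using st(5) \<delta>1 by linarith
          qed
        qed
        also have "\<dots> \<le> ?K / D ^ (2 * l)" by (rule bad(2))
        also have "D ^ (2 * l) = CD ^ (2 * l) * real T powr (2 * real l * \<theta>)"
          using TN by (simp add: D_def power_mult_distrib powr_realpow[symmetric] powr_powr mult_ac)
        also have "?K / (CD ^ (2 * l) * real T powr (2 * real l * \<theta>)) \<le> \<kappa> * e / 64"
          using T0[OF T] by (simp add: e_def)
        finally show ?thesis .
      qed auto
      have "0 < \<kappa> * e" using \<kappa> e by simp
      then have "measure (path_law Q (\<lambda>\<omega> r. B r \<omega>)) (skorokhod_nbhd ?\<Gamma> \<delta>) + \<delta> < measure (path_law (P T) (oracle_path ?st ?M T)) ?\<Gamma>"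
        using \<mu> \<nu> \<delta>1 by linarith
      then show "\<exists>\<Gamma>\<in>sets skorokhod_borel.
        measure (path_law Q (\<lambda>\<omega> r. B r \<omega>)) (skorokhod_nbhd \<Gamma> \<delta>) + \<delta> < measure (path_law (P T) (oracle_path ?st ?M T)) \<Gamma> \<or>
        measure (path_law (P T) (oracle_path ?st ?M T)) (skorokhod_nbhd \<Gamma> \<delta>) + \<delta> < measure (path_law Q (\<lambda>\<omega> r. B r \<omega>)) \<Gamma>"
        using osc_paths_sets[of 0 h "2 * e"] by (intro bexI[of _ ?\<Gamma>]) auto
    qed (use PT Q in \<open>auto simp: path_law_def intro: measure_distr_le_1\<close>)
    moreover have "pmeasure ?M = P T" by (simp add: linear_oracle_def)
    ultimately show ?thesis unfolding tgt by (simp add: e_def mult.assoc)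
  qed
  then show ?thesis using \<kappa> c by (intro exI[of _ "min (1/2) (\<kappa> / 32) * c"] conjI exI[of _ T0]) (auto simp: a_def)
qed

section \<open>The lower bound\<close>

text \<open>Serves the parameter ranges in which a class is empty. The comparison is asked for only
  from 3 on, where \<open>ln T \<ge> 1\<close>.\<close>

lemma dominated_lower_bound:
  fixes D r r' :: "nat \<Rightarrow> real"
  assumes "\<exists>c>0. \<exists>T0. \<forall>T\<ge>T0. c * r' T \<le> D T" and "\<And>T. 3 \<le> T \<Longrightarrow> r T \<le> r' T"
  shows "\<exists>c>0. \<exists>T0. \<forall>T\<ge>T0. c * r T \<le> D T"
proof -
  obtain c T0 where c: "0 < c" "\<And>T. T0 \<le> T \<Longrightarrow> c * r' T \<le> D T" using assms(1) by blast
  have "c * r T \<le> D T" if "max T0 3 \<le> T" for T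
    using c that assms(2)[of T] order_trans[OF mult_left_mono[of "r T" "r' T" c]] by simp
  then show ?thesis using c(1) by blast
qed

lemma add_lower_bounds:
  fixes D r r' :: "nat \<Rightarrow> real"
  assumes "\<exists>c>0. \<exists>T0. \<forall>T\<ge>T0. c * r T \<le> D T" "\<exists>c>0. \<exists>T0. \<forall>T\<ge>T0. c * r' T \<le> D T"
    and "\<And>T. 1 \<le> T \<Longrightarrow> 0 \<le> r T" "\<And>T. 1 \<le> T \<Longrightarrow> 0 \<le> r' T"
  shows "\<exists>c>0. \<exists>T0. \<forall>T\<ge>T0. c * (r T + r' T) \<le> D T"
proof -
  obtain c T0 where c: "0 < c" "\<And>T. T0 \<le> T \<Longrightarrow> c * r T \<le> D T" using assms(1) by blast
  obtain c' T0' where c': "0 < c'" "\<And>T. T0' \<le> T \<Longrightarrow> c' * r' T \<le> D T" using assms(2) by blast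
  have "min c c' / 2 * (r T + r' T) \<le> D T" if T: "max (max T0 T0') 1 \<le> T" for T
  proof -
    have "min c c' * r T \<le> c * r T" "min c c' * r' T \<le> c' * r' T"
      using assms(3,4)[of T] T by (auto intro!: mult_right_mono)
    then have "min c c' * r T \<le> D T" "min c c' * r' T \<le> D T" using c(2)[of T] c'(2)[of T] T by auto
    then show ?thesis by (simp add: distrib_left)
  qed
  then show ?thesis using c(1) c'(1) by (intro exI[of _ "min c c' / 2"] conjI exI[of _ "max (max T0 T0') 1"]) auto
qed

theorem theorem3p7:
  fixes \<eta> \<alpha> p q \<gamma> :: real
    and Mom Kst \<kappa>st cst :: real and N0 :: nat
    and lam c0 \<kappa> :: real and chi :: "real \<Rightarrow> real" and N1 :: nat
    and Q :: "'v measure" and Wstar :: "real \<Rightarrow> 'v \<Rightarrow> real"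
    and Pcov :: "'w measure" and W :: "real \<Rightarrow> 'w \<Rightarrow> real"
    and Posc :: "nat \<Rightarrow> 'w measure" and \<xi>osc :: "nat \<Rightarrow> nat \<Rightarrow> 'w \<Rightarrow> real"
    and Psm :: "'w measure" and \<xi>sm :: "nat \<Rightarrow> 'w \<Rightarrow> real"
    and Pnl :: "nat \<Rightarrow> 'w measure" and b :: "nat \<Rightarrow> 'w \<Rightarrow> bool"
  assumes "\<eta> > 0" and "1/2 < \<alpha>" and "\<alpha> < 1" and "p > 2" and "1 \<le> q" and "q \<le> p/2" and "\<gamma> > 0"
    and target: "standard_brownian_motion_on {0..1} Q Wstar"
    and cov: "standard_brownian_motion_on {0..} Pcov W"
    and osc_params: "Mom > 1" "Kst > 4" "\<kappa>st > 0" "cst > 0"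
      "\<kappa>st * Kst powr p * cst powr (p + 1) \<le> Mom - 1"
    and osc_N0: "\<And>N. N \<ge> N0 \<Longrightarrow> osc_q p \<kappa>st cst N < 1 \<and>
        osc_q p \<kappa>st cst N * (osc_u p Kst cst N)\<^sup>2 < 1 \<and> osc_u p Kst cst N \<ge> 1"
    and osc: "\<And>N. N \<ge> N0 \<Longrightarrow>
        osc_noise (osc_q p \<kappa>st cst N) (osc_u p Kst cst N) (osc_v p Kst \<kappa>st cst N) (Posc N) (\<xi>osc N)"
    and sm: "gaussian_noise Psm \<xi>sm"
    and nl_params: "lam > 0" "lam * \<eta> \<le> 1/4" "smooth_cutoff chi" "c0 > 0" "\<kappa> > 0" "N1 \<ge> 1"
    and nl_N1: "\<And>N. N \<ge> N1 \<Longrightarrow>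
        c0 * real N powr (\<alpha> - 1) \<le> lam \<and> c0 * real N powr (\<alpha> - 1) * \<eta> \<le> 1/2 \<and>
        nl_rho \<alpha> q N \<le> 1/2 \<and>
        (\<Prod>s = 2..N - 1. 1 - c0 * real N powr (\<alpha> - 1) * step_size \<eta> \<alpha> s) \<ge> \<kappa> \<and>
        2 * nl_rho \<alpha> q N powr (1/2) < \<kappa>"
    and nl: "\<And>N. N \<ge> N1 \<Longrightarrow> bernoulli_variable (nl_rho \<alpha> q N) (Pnl N) (b N)"
  defines "C_lb \<equiv> cov_class \<alpha> p \<gamma> Pcov W \<union> osc_class \<alpha> p N0 Posc \<xi>osc \<union> sm_class Psm \<xi>sm \<union>
      nl_class \<eta> \<alpha> q lam c0 chi N1 Pnl b"
  shows "\<exists>c>0. \<exists>T0. \<forall>T\<ge>T0. worst_dist (step_size \<eta> \<alpha>) Q Wstar T C_lb \<ge>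
      c * (real T powr (- a_cov \<gamma>) + real T powr (- a_osc p) +
           real T powr (- a_sm \<alpha>) * sqrt (ln (real T)) + real T powr (- a_nl \<alpha> q))"
proof -
  let ?st = "step_size \<eta> \<alpha>"
  define D where "D T = worst_dist ?st Q Wstar T C_lb" for T
  have Q: "prob_space Q" using target by (simp add: standard_brownian_motion_on_def)
  have Pcov: "prob_space (completion Pcov)"
    using cov by (intro prob_space.prob_space_completion) (simp add: standard_brownian_motion_on_def)
  have prob: "prob_space (pmeasure M)" if "M \<in> C_lb" for M
    using that Pcov osc sm nl unfolding C_lb_def
    by (auto simp: cov_class_def osc_class_def sm_class_def nl_class_def cov_oracle_def linear_oracle_def nl_oracle_def
        osc_noise_def gaussian_noise_def bernoulli_variable_def split: if_splits)
  have D: "prokhorov_dist (path_law (pmeasure M) (oracle_path ?st M T)) (path_law Q (target_path Wstar M)) \<le> D T"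
    if "M \<in> C_lb" for M T
    unfolding D_def using worst_dist_ge[OF that prob Q] .
  have lift: "\<exists>c>0. \<exists>T0. \<forall>T\<ge>T0. c * r T \<le> D T"
    if bound: "\<exists>c>0. \<exists>T0. \<forall>T\<ge>T0. c * r T \<le>
        prokhorov_dist (path_law (pmeasure (M T)) (oracle_path ?st (M T) T)) (path_law Q (target_path Wstar (M T)))"
      and mem: "\<And>T. T1 \<le> T \<Longrightarrow> M T \<in> C_lb" for r and M :: "nat \<Rightarrow> 'w stoch_oracle" and T1
  proof -
    obtain c T0 where c: "0 < c" "\<And>T. T0 \<le> T \<Longrightarrow> c * r T \<le>
        prokhorov_dist (path_law (pmeasure (M T)) (oracle_path ?st (M T) T)) (path_law Q (target_path Wstar (M T)))"
      using bound by blast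
    have "c * r T \<le> D T" if "max T0 T1 \<le> T" for T
      using order_trans[OF c(2) D[OF mem]] that by auto
    then show ?thesis using c(1) by blast
  qed
  have \<alpha>0: "0 < \<alpha>" using assms(2) by linarith
  have sm_bound: "\<exists>c>0. \<exists>T0. \<forall>T\<ge>T0. c * (real T powr (- a_sm \<alpha>) * sqrt (ln (real T))) \<le> D T"
  proof (rule lift[where M = "\<lambda>T. linear_oracle Psm \<xi>sm" and ?T1.0 = 0])
    show "linear_oracle Psm \<xi>sm \<in> C_lb" by (simp add: C_lb_def sm_class_def)
  qed (rule sm_lower_bound[OF assms(1) \<alpha>0 assms(3) sm target])
  have nl_bound: "\<exists>c>0. \<exists>T0. \<forall>T\<ge>T0. c * real T powr (- a_nl \<alpha> q) \<le> D T"
  proof (rule lift[where M = "\<lambda>T. nl_oracle \<eta> \<alpha> q lam c0 chi (Pnl T) (b T) T" and ?T1.0 = N1])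
    show "nl_oracle \<eta> \<alpha> q lam c0 chi (Pnl T) (b T) T \<in> C_lb" if "N1 \<le> T" for T
      using that by (auto simp: C_lb_def nl_class_def)
  next
    have N1': "c0 * real N powr (\<alpha> - 1) * \<eta> \<le> 1/2 \<and> nl_rho \<alpha> q N \<le> 1/2 \<and>
        (\<Prod>s = 2..N - 1. 1 - c0 * real N powr (\<alpha> - 1) * step_size \<eta> \<alpha> s) \<ge> \<kappa> \<and>
        2 * nl_rho \<alpha> q N powr (1/2) < \<kappa>" if "N1 \<le> N" for N
      using nl_N1[OF that] by blast
    show "\<exists>c>0. \<exists>T0. \<forall>T\<ge>T0. c * real T powr (- a_nl \<alpha> q) \<le>
        prokhorov_dist (path_law (pmeasure (nl_oracle \<eta> \<alpha> q lam c0 chi (Pnl T) (b T) T))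
            (oracle_path ?st (nl_oracle \<eta> \<alpha> q lam c0 chi (Pnl T) (b T) T) T))
          (path_law Q (target_path Wstar (nl_oracle \<eta> \<alpha> q lam c0 chi (Pnl T) (b T) T)))"
      by (rule nl_lower_bound[OF assms(1) less_imp_le[OF \<alpha>0] nl_params(3,4,5) N1' nl Q])
  qed
  have ln1: "1 \<le> sqrt (ln (real T))" if "3 \<le> T" for T
  proof -
    have "exp 1 \<le> real T" using that e_less_272 by simp
    then show ?thesis using that by (simp add: ln_ge_iff)
  qed
  have sm_dom: "real T powr (- s) \<le> real T powr (- a_sm \<alpha>) * sqrt (ln (real T))" if "a_sm \<alpha> \<le> s" "3 \<le> T" for s T
  proof -
    have "real T powr (- s) \<le> real T powr (- a_sm \<alpha>) * 1" using that by (simp add: powr_mono)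
    also have "\<dots> \<le> real T powr (- a_sm \<alpha>) * sqrt (ln (real T))"
      using ln1[OF that(2)] by (intro mult_left_mono) auto
    finally show ?thesis .
  qed
  have osc_bound: "\<exists>c>0. \<exists>T0. \<forall>T\<ge>T0. c * real T powr (- a_osc p) \<le> D T"
  proof (cases "a_osc p < a_sm \<alpha>")
    case True
    show ?thesis
    proof (rule lift[where M = "\<lambda>T. linear_oracle (Posc T) (\<xi>osc T)" and ?T1.0 = N0])
      show "linear_oracle (Posc T) (\<xi>osc T) \<in> C_lb" if "N0 \<le> T" for T
        using that True by (auto simp: C_lb_def osc_class_def)
    next
      have "osc_q p \<kappa>st cst N < 1 \<and> osc_q p \<kappa>st cst N * (osc_u p Kst cst N)\<^sup>2 < 1" if "N0 \<le> N" for N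
        using osc_N0[OF that] by blast
      then show "\<exists>c>0. \<exists>T0. \<forall>T\<ge>T0. c * real T powr (- a_osc p) \<le>
          prokhorov_dist (path_law (pmeasure (linear_oracle (Posc T) (\<xi>osc T))) (oracle_path ?st (linear_oracle (Posc T) (\<xi>osc T)) T))
            (path_law Q (target_path Wstar (linear_oracle (Posc T) (\<xi>osc T))))"
        by (rule osc_lower_bound[OF assms(1) \<alpha>0 assms(3) assms(4) True osc_params(2-4) _ osc target])
    qed
  next
    case False
    then show ?thesis by (intro dominated_lower_bound[OF sm_bound] sm_dom) auto
  qed
  have cov_bound: "\<exists>c>0. \<exists>T0. \<forall>T\<ge>T0. c * real T powr (- a_cov \<gamma>) \<le> D T"
  proof -
    \<comment> \<open>In the last two cases the covariance class is empty and its rate is dominated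
      by one already bounded; in the middle case that bound may itself stem from the Gaussian
      class.\<close>
    consider "a_cov \<gamma> < min (a_osc p) (a_sm \<alpha>)" | "a_osc p \<le> a_cov \<gamma>" | "a_sm \<alpha> \<le> a_cov \<gamma>"
      by linarith
    then show ?thesis
    proof cases
      case 1
      then have "\<gamma> < a_sm \<alpha>" by (simp add: a_cov_def)
      then show ?thesis
        using 1
      proof (intro lift[where M = "cov_oracle \<gamma> Pcov W" and ?T1.0 = 1])
        show "cov_oracle \<gamma> Pcov W T \<in> C_lb" if "1 \<le> T" for T
          using that 1 by (auto simp: C_lb_def cov_class_def)
      qed (rule cov_lower_bound[OF assms(1) \<alpha>0 assms(3) assms(7) _ cov target])
    next
      case 2
      then show ?thesis by (intro dominated_lower_bound[OF osc_bound] powr_mono) auto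
    next
      case 3
      then show ?thesis by (intro dominated_lower_bound[OF sm_bound] sm_dom) auto
    qed
  qed
  have "\<exists>c>0. \<exists>T0. \<forall>T\<ge>T0. c * (real T powr (- a_cov \<gamma>) + real T powr (- a_osc p) +
           real T powr (- a_sm \<alpha>) * sqrt (ln (real T)) + real T powr (- a_nl \<alpha> q)) \<le> D T"
    by (intro add_lower_bounds cov_bound osc_bound sm_bound nl_bound) auto
  then show ?thesis by (simp only: D_def)
qed

end
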